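(* Let $1\le k<d$, let $X$ be a random vector in $\mathbb{R}^d$, let $n\ge 1$ and let $X_1,\dots,X_n$ be i.i.d. copies of $X$. Assume that $\lambda_k>\lambda_{k+1}$, that $\mathrm{E}[X_{(j)}^4]<\infty$ for every coordinate $X_{(j)}$ of $X$, $j\in[d]$, and let $\delta\in(0,1)$. If $$n\ \ge\ (32\mathcal{V}+4)\log(3k(d-k))+(16\nu+8)\log(4/\delta)+\frac{16(\mathcal{S}+r(n))}{\delta(\lambda_k-\lambda_{k+1})^2},$$ then with probability at least $1-\delta$ $$R([U_n])-R([U_*])\ \le\ \frac{75}{n\cdot\delta}\sum_{i=1}^{d-k}\sum_{j=1}^{k}\frac{\mathrm{E}[\langle u_{k+i},X\rangle^2\langle u_j,X\rangle^2]}{\lambda_j-\lambda_{k+i}},$$ where, with $c(d)=4(1+2\lceil\log d\rceil)$, $$\mathcal{S}:=c(d)\cdot\|\mathrm{E}[(XX^T-\Sigma)^2]\|_{\mathrm{op}},\qquad r(n):=c^2(d)\cdot n^{-1}\,\mathrm{E}\Big[\max_{i\in[n]}\|X_iX_i^T-\Sigma\|_{\mathrm{op}}^2\Big],$$ and $\mathcal{V},\nu$ are the variance parameters defined in the context.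
   Context: Notation: $[m]=\{1,\dots,m\}$; $\|\cdot\|_{\mathrm{op}}$ is the operator (spectral) norm; $\|\cdot\|_F$ the Frobenius norm. PCA setup. $\Sigma:=\mathrm{E}[XX^T]$ and $\Sigma_n:=n^{-1}\sum_{i=1}^nX_iX_i^T$. $(u_j)_{j=1}^d$ is a fixed orthonormal basis of eigenvectors of $\Sigma$ with eigenvalues $\lambda_1\ge\dots\ge\lambda_d$ (ties broken arbitrarily). $(u_{n,j})_{j=1}^d$ is an orthonormal basis of eigenvectors of $\Sigma_n$, ordered non-increasingly according to their eigenvalues, ties broken arbitrarily. $U_*\in\mathbb{R}^{d\times k}$ has columns $u_1,\dots,u_k$ and $U_n\in\mathbb{R}^{d\times k}$ has columns $u_{n,1},\dots,u_{n,k}$. $\mathrm{St}(d,k)=\{U\in\mathbb{R}^{d\times k}:U^TU=I_k\}$; $\mathrm{Gr}(d,k)=\mathrm{St}(d,k)/\sim$ with $U\sim V$ iff $V=UQ$ for some orthogonal $Q$; $[U]$ is the class of $U$. The reconstruction risk is $R([U]):=\tfrac12\mathrm{E}[\|X-UU^TX\|_2^2]$ (expectation over $X$ only). Variance parameters. Let $\delta_{ij}:=\lambda_j-\lambda_{k+i}$ for $i\in[d-k]$, $j\in[k]$, and $\widetilde X_j:=\langle X,u_j\rangle$ for $j\in[d]$. For $j,s,r,p\in[k]$ and $i,t,q,l\in[d-k]$ put $$\Gamma_{jsrp}:=\mathrm{E}[\widetilde X_j\widetilde X_s\widetilde X_r\widetilde X_p],\quad \Lambda_{ijts}:=\mathrm{E}[\widetilde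 X_{k+i}\widetilde X_j\widetilde X_{k+t}\widetilde X_s],\quad \Omega_{itql}:=\mathrm{E}[\widetilde X_{k+i}\widetilde X_{k+t}\widetilde X_{k+q}\widetilde X_{k+l}].$$ Below, $M=(m_{ij})$ ranges over $\mathbb{R}^{(d-k)\times k}$; indices in the first position of $m$ and of $\delta$ range over $[d-k]$ and those in the second position over $[k]$. $$\mathcal{V}:=\sup_{\|M\|_F=1}\ \sum_{j,r,p\in[k]}a_{jrp}(M)\,\Gamma_{jjrp}-2\sum_{i,t\in[d-k];\,j,s\in[k]}b_{ijts}(M)\,\Lambda_{ijts}+\sum_{i,q,l\in[d-k]}c_{iql}(M)\,\Omega_{iiql},$$ $$a_{jrp}(M):=\sum_{i\in[d-k]}\frac{m_{ir}m_{ip}}{\delta_{ij}\sqrt{\delta_{ir}\delta_{ip}}},\quad b_{ijts}(M):=\frac{m_{is}m_{tj}}{\delta_{ij}\sqrt{\delta_{is}\delta_{tj}}},\quad c_{iql}(M):=\sum_{j\in[k]}\frac{m_{qj}m_{lj}}{\delta_{ij}\sqrt{\delta_{qj}\delta_{lj}}};$$ $$\nu:=\sup_{\|M\|_F=1}\ \sum_{j,s,r,p\in[k]}\alpha_{jsrp}(M)\,\Gamma_{jsrp}-2\sum_{t,q\in[d-k];\,s,r\in[k]}\beta_{tsqr}(M)\,\Lambda_{tsqr}+\sum_{i,t,q,l\in[d-k]}\kappa_{itql}(M)\,\Omega_{itql},$$ $$\alpha_{jsrp}(M):=\sum_{i,t\in[d-k]}\frac{m_{ij}m_{is}m_{tr}m_{tp}}{\sqrt{\delta_{ij}\delta_{is}\delta_{tr}\delta_{tp}}},\quad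 \beta_{tsqr}(M):=\sum_{i\in[d-k],\,j\in[k]}\frac{m_{tj}m_{is}m_{qj}m_{ir}}{\sqrt{\delta_{tj}\delta_{is}\delta_{qj}\delta_{ir}}},\quad \kappa_{itql}(M):=\sum_{j,s\in[k]}\frac{m_{ij}m_{tj}m_{qs}m_{ls}}{\sqrt{\delta_{ij}\delta_{tj}\delta_{qs}\delta_{ls}}}.$$ *)

theory Defs
  imports "HOL-Probability.Probability"
begin
definition outer :: "real^'d \<Rightarrow> real^'d^'d" where
  "outer x = (\<chi> a b. x $ a * x $ b)"

definition op_norm :: "real^'n^'m \<Rightarrow> real" where
  "op_norm A = onorm (\<lambda>x. A *v x)"

text \<open>Eigenvalues and eigenvectors are numbered \<open>1, \<dots>, d\<close> by natural numbers; values outside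
  this range are irrelevant.\<close>

definition ordered_eigenbasis ::
    "real^'d^'d \<Rightarrow> (nat \<Rightarrow> real) \<Rightarrow> (nat \<Rightarrow> real^'d) \<Rightarrow> bool" where
  "ordered_eigenbasis A lam u \<longleftrightarrow>
     (\<forall>i\<in>{1..CARD('d)}. \<forall>j\<in>{1..CARD('d)}. u i \<bullet> u j = (if i = j then 1 else 0)) \<and>
     (\<forall>j\<in>{1..CARD('d)}. A *v u j = lam j *\<^sub>R u j) \<and>
     (\<forall>i\<in>{1..CARD('d)}. \<forall>j\<in>{1..CARD('d)}. i \<le> j \<longrightarrow> lam j \<le> lam i)"

text \<open>The map \<open>e\<close> identifies the column index type with \<open>{1..k}\<close>: column \<open>c\<close> is \<open>u (e c)\<close>.\<close>

definition column_matrix :: "('k \<Rightarrow> nat) \<Rightarrow> (nat \<Rightarrow> real^'d) \<Rightarrow> real^'k^'d" where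
  "column_matrix e u = (\<chi> a c. u (e c) $ a)"

definition stiefel :: "(real^'k^'d) set" where
  "stiefel = {U. transpose U ** U = mat 1}"

definition stiefel_rel :: "((real^'k^'d) \<times> (real^'k^'d)) set" where
  "stiefel_rel = {(U, V). U \<in> stiefel \<and> V \<in> stiefel \<and>
     (\<exists>Q :: real^'k^'k. orthogonal_matrix Q \<and> U = V ** Q)}"

definition grassmannian :: "(real^'k^'d) set set" where
  "grassmannian = stiefel // stiefel_rel"

definition span_class :: "real^'k^'d \<Rightarrow> (real^'k^'d) set" where
  "span_class U = stiefel_rel `` {U}"

lemma equiv_stiefel_rel: "equiv stiefel stiefel_rel"
proof (rule equivI)
  show "stiefel_rel \<subseteq> stiefel \<times> stiefel"
    by (auto simp: stiefel_rel_def)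
  show "refl_on stiefel stiefel_rel"
    by (auto simp: refl_on_def stiefel_rel_def intro: exI[of _ "mat 1"] orthogonal_matrix_id)
  show "sym stiefel_rel"
  proof (rule symI)
    fix U V :: "real^'k^'d" assume "(U, V) \<in> stiefel_rel"
    then obtain Q where Q: "U \<in> stiefel" "V \<in> stiefel" "orthogonal_matrix Q" "U = V ** Q"
      by (auto simp: stiefel_rel_def)
    then have "V = U ** transpose Q"
      by (simp add: matrix_mul_assoc[symmetric] orthogonal_matrix_def)
    with Q show "(V, U) \<in> stiefel_rel"
      unfolding stiefel_rel_def using orthogonal_matrix_transpose by blast
  qed
  show "trans stiefel_rel"
  proof (rule transI)
    fix U V W :: "real^'k^'d"
    assume "(U, V) \<in> stiefel_rel" "(V, W) \<in> stiefel_rel"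
    then obtain Q R where "U \<in> stiefel" "W \<in> stiefel" "U = V ** Q" "V = W ** R"
        "orthogonal_matrix Q" "orthogonal_matrix R"
      by (auto simp: stiefel_rel_def)
    moreover from this have "U = W ** (R ** Q)" "orthogonal_matrix (R ** Q)"
      by (simp_all only: matrix_mul_assoc orthogonal_matrix_mul)
    ultimately show "(U, W) \<in> stiefel_rel"
      unfolding stiefel_rel_def by blast
  qed
qed

lemma span_class_in_grassmannian: "U \<in> stiefel \<Longrightarrow> span_class U \<in> grassmannian"
  by (simp add: span_class_def grassmannian_def quotientI)

text \<open>The risk is a function on the Grassmannian: the common value, over all representatives
  of the class, of half the expected squared reconstruction error.\<close>

definition recon_risk :: "'a measure \<Rightarrow> ('a \<Rightarrow> real^'d) \<Rightarrow> (real^'k^'d) set \<Rightarrow> real" where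
  "recon_risk M X C = the_elem
     ((\<lambda>U. 1/2 * (\<integral>\<omega>. (norm (X \<omega> - (U ** transpose U) *v X \<omega>))\<^sup>2 \<partial>M)) ` C)"

lemma recon_risk_span_class:
  fixes U :: "real^'k^'d"
  assumes "U \<in> stiefel"
  shows "recon_risk M X (span_class U) =
    1/2 * (\<integral>\<omega>. (norm (X \<omega> - (U ** transpose U) *v X \<omega>))\<^sup>2 \<partial>M)"
proof -
  have *: "U ** transpose U = V ** transpose V" if "V \<in> span_class U" for V
  proof -
    from that obtain Q :: "real^'k^'k" where Q: "orthogonal_matrix Q" "U = V ** Q"
      by (auto simp: span_class_def stiefel_rel_def)
    have "U ** transpose U = V ** (Q ** transpose Q) ** transpose V"
      by (simp add: Q(2) matrix_transpose_mul matrix_mul_assoc)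
    then show ?thesis using Q(1) by (simp add: orthogonal_matrix_def)
  qed
  have "U \<in> span_class U"
    using assms equiv_class_self[OF equiv_stiefel_rel] by (auto simp: span_class_def)
  moreover have "1/2 * (\<integral>\<omega>. (norm (X \<omega> - (V ** transpose V) *v X \<omega>))\<^sup>2 \<partial>M)
      = 1/2 * (\<integral>\<omega>. (norm (X \<omega> - (U ** transpose U) *v X \<omega>))\<^sup>2 \<partial>M)"
    if "V \<in> span_class U" for V
    by (simp only: *[OF that])
  ultimately have "(\<lambda>V. 1/2 * (\<integral>\<omega>. (norm (X \<omega> - (V ** transpose V) *v X \<omega>))\<^sup>2 \<partial>M)) ` span_class U
    = {1/2 * (\<integral>\<omega>. (norm (X \<omega> - (U ** transpose U) *v X \<omega>))\<^sup>2 \<partial>M)}"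
    by blast
  then show ?thesis by (simp only: recon_risk_def the_elem_eq)
qed

definition second_moment :: "'a measure \<Rightarrow> ('a \<Rightarrow> real^'d) \<Rightarrow> real^'d^'d" where
  "second_moment M X = (\<integral>\<omega>. outer (X \<omega>) \<partial>M)"

definition sample_second_moment :: "nat \<Rightarrow> (nat \<Rightarrow> 'a \<Rightarrow> real^'d) \<Rightarrow> 'a \<Rightarrow> real^'d^'d" where
  "sample_second_moment n Xs \<omega> = (1 / real n) *\<^sub>R (\<Sum>i\<in>{1..n}. outer (Xs i \<omega>))"

definition c_dim :: "nat \<Rightarrow> real" where
  "c_dim d = 4 * (1 + 2 * real_of_int \<lceil>ln (real d)\<rceil>)"

definition S_param :: "'a measure \<Rightarrow> ('a \<Rightarrow> real^'d) \<Rightarrow> real" where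
  "S_param M X = c_dim CARD('d) *
     op_norm (\<integral>\<omega>. (outer (X \<omega>) - second_moment M X) ** (outer (X \<omega>) - second_moment M X) \<partial>M)"

definition r_param ::
    "'a measure \<Rightarrow> ('a \<Rightarrow> real^'d) \<Rightarrow> (nat \<Rightarrow> 'a \<Rightarrow> real^'d) \<Rightarrow> nat \<Rightarrow> real" where
  "r_param M X Xs n = (c_dim CARD('d))\<^sup>2 * (1 / real n) *
     (\<integral>\<omega>. (MAX i\<in>{1..n}. (op_norm (outer (Xs i \<omega>) - second_moment M X))\<^sup>2) \<partial>M)"

definition gap :: "nat \<Rightarrow> (nat \<Rightarrow> real) \<Rightarrow> nat \<Rightarrow> nat \<Rightarrow> real" where
  "gap k lam i j = lam j - lam (k + i)"

definition fourth_moment ::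
    "'a measure \<Rightarrow> ('a \<Rightarrow> real^'d) \<Rightarrow> (nat \<Rightarrow> real^'d) \<Rightarrow> nat \<Rightarrow> nat \<Rightarrow> nat \<Rightarrow> nat \<Rightarrow> real" where
  "fourth_moment M X u a b c e =
     (\<integral>\<omega>. (X \<omega> \<bullet> u a) * (X \<omega> \<bullet> u b) * (X \<omega> \<bullet> u c) * (X \<omega> \<bullet> u e) \<partial>M)"

definition Gamma_m where
  "Gamma_m M X u j s r p = fourth_moment M X u j s r p"

definition Lambda_m where
  "Lambda_m M X u k i j t s = fourth_moment M X u (k + i) j (k + t) s"

definition Omega_m where
  "Omega_m M X u k i t q l = fourth_moment M X u (k + i) (k + t) (k + q) (k + l)"

text \<open>A matrix with \<open>d - k\<close> rows and \<open>k\<close> columns is a function \<open>m\<close> of which only the values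
  \<open>m i j\<close> with \<open>i \<in> {1..d-k}\<close> and \<open>j \<in> {1..k}\<close> matter.\<close>

definition frob_norm :: "nat \<Rightarrow> nat \<Rightarrow> (nat \<Rightarrow> nat \<Rightarrow> real) \<Rightarrow> real" where
  "frob_norm d k m = sqrt (\<Sum>i\<in>{1..d-k}. \<Sum>j\<in>{1..k}. (m i j)\<^sup>2)"

definition a_coef :: "nat \<Rightarrow> nat \<Rightarrow> (nat \<Rightarrow> nat \<Rightarrow> real) \<Rightarrow> (nat \<Rightarrow> nat \<Rightarrow> real) \<Rightarrow> nat \<Rightarrow> nat \<Rightarrow> nat \<Rightarrow> real" where
  "a_coef d k g m j r p = (\<Sum>i\<in>{1..d-k}. (m i r * m i p) / (g i j * sqrt (g i r * g i p)))"

definition b_coef :: "(nat \<Rightarrow> nat \<Rightarrow> real) \<Rightarrow> (nat \<Rightarrow> nat \<Rightarrow> real) \<Rightarrow> nat \<Rightarrow> nat \<Rightarrow> nat \<Rightarrow> nat \<Rightarrow> real" where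
  "b_coef g m i j t s = (m i s * m t j) / (g i j * sqrt (g i s * g t j))"

definition c_coef :: "nat \<Rightarrow> (nat \<Rightarrow> nat \<Rightarrow> real) \<Rightarrow> (nat \<Rightarrow> nat \<Rightarrow> real) \<Rightarrow> nat \<Rightarrow> nat \<Rightarrow> nat \<Rightarrow> real" where
  "c_coef k g m i q l = (\<Sum>j\<in>{1..k}. (m q j * m l j) / (g i j * sqrt (g q j * g l j)))"

definition V_param ::
    "'a measure \<Rightarrow> ('a \<Rightarrow> real^'d) \<Rightarrow> (nat \<Rightarrow> real) \<Rightarrow> (nat \<Rightarrow> real^'d) \<Rightarrow> nat \<Rightarrow> real" where
  "V_param M X lam u k = (let d = CARD('d); g = gap k lam in
     SUP m\<in>{m. frob_norm d k m = 1}.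
       (\<Sum>j\<in>{1..k}. \<Sum>r\<in>{1..k}. \<Sum>p\<in>{1..k}. a_coef d k g m j r p * Gamma_m M X u j j r p)
       - 2 * (\<Sum>i\<in>{1..d-k}. \<Sum>t\<in>{1..d-k}. \<Sum>j\<in>{1..k}. \<Sum>s\<in>{1..k}.
                b_coef g m i j t s * Lambda_m M X u k i j t s)
       + (\<Sum>i\<in>{1..d-k}. \<Sum>q\<in>{1..d-k}. \<Sum>l\<in>{1..d-k}.
            c_coef k g m i q l * Omega_m M X u k i i q l))"

definition alpha_coef :: "nat \<Rightarrow> nat \<Rightarrow> (nat \<Rightarrow> nat \<Rightarrow> real) \<Rightarrow> (nat \<Rightarrow> nat \<Rightarrow> real) \<Rightarrow> nat \<Rightarrow> nat \<Rightarrow> nat \<Rightarrow> nat \<Rightarrow> real" where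
  "alpha_coef d k g m j s r p = (\<Sum>i\<in>{1..d-k}. \<Sum>t\<in>{1..d-k}.
     (m i j * m i s * m t r * m t p) / sqrt (g i j * g i s * g t r * g t p))"

definition beta_coef :: "nat \<Rightarrow> nat \<Rightarrow> (nat \<Rightarrow> nat \<Rightarrow> real) \<Rightarrow> (nat \<Rightarrow> nat \<Rightarrow> real) \<Rightarrow> nat \<Rightarrow> nat \<Rightarrow> nat \<Rightarrow> nat \<Rightarrow> real" where
  "beta_coef d k g m t s q r = (\<Sum>i\<in>{1..d-k}. \<Sum>j\<in>{1..k}.
     (m t j * m i s * m q j * m i r) / sqrt (g t j * g i s * g q j * g i r))"

definition kappa_coef :: "nat \<Rightarrow> (nat \<Rightarrow> nat \<Rightarrow> real) \<Rightarrow> (nat \<Rightarrow> nat \<Rightarrow> real) \<Rightarrow> nat \<Rightarrow> nat \<Rightarrow> nat \<Rightarrow> nat \<Rightarrow> real" where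
  "kappa_coef k g m i t q l = (\<Sum>j\<in>{1..k}. \<Sum>s\<in>{1..k}.
     (m i j * m t j * m q s * m l s) / sqrt (g i j * g t j * g q s * g l s))"

definition nu_param ::
    "'a measure \<Rightarrow> ('a \<Rightarrow> real^'d) \<Rightarrow> (nat \<Rightarrow> real) \<Rightarrow> (nat \<Rightarrow> real^'d) \<Rightarrow> nat \<Rightarrow> real" where
  "nu_param M X lam u k = (let d = CARD('d); g = gap k lam in
     SUP m\<in>{m. frob_norm d k m = 1}.
       (\<Sum>j\<in>{1..k}. \<Sum>s\<in>{1..k}. \<Sum>r\<in>{1..k}. \<Sum>p\<in>{1..k}.
          alpha_coef d k g m j s r p * Gamma_m M X u j s r p)
       - 2 * (\<Sum>t\<in>{1..d-k}. \<Sum>q\<in>{1..d-k}. \<Sum>s\<in>{1..k}. \<Sum>r\<in>{1..k}.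
                beta_coef d k g m t s q r * Lambda_m M X u k t s q r)
       + (\<Sum>i\<in>{1..d-k}. \<Sum>t\<in>{1..d-k}. \<Sum>q\<in>{1..d-k}. \<Sum>l\<in>{1..d-k}.
            kappa_coef k g m i t q l * Omega_m M X u k i t q l))"

end

theory Submission
  imports Defs
begin

text \<open>
  Write \<open>D\<close> for the difference of the sample second moment matrix and \<open>\<Sigma>\<close>, \<open>Q\<close> for the projection
  onto the first \<open>k\<close> sample eigenvectors, and \<open>\<gamma> = \<lambda>\<^sub>k - \<lambda>\<^sub>k\<^sub>+\<^sub>1\<close>. The excess risk is half of
  \<open>e = tr \<Sigma>(P - Q)\<close>, where \<open>P\<close> projects onto \<open>u\<^sub>1, \<dots>, u\<^sub>k\<close>. The argument separates a deterministic
  perturbation bound from two moment computations.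

  Deterministic part (\<open>excess_le_first_order\<close>). Since \<open>Q\<close> maximises \<open>tr (\<Sigma> + D)Q\<close> over rank \<open>k\<close>
  projections, \<open>e \<le> tr D(Q - P)\<close>. The two diagonal blocks of \<open>Q - P\<close> (with respect to \<open>P\<close>) are semidefinite of
  opposite sign and have the same trace norm \<open>s\<close>, and \<open>\<gamma> s \<le> e\<close>; so they contribute at most
  \<open>2 \<parallel>D\<parallel> s \<le> \<theta> e\<close> with \<open>\<theta> = 2 \<parallel>D\<parallel> / \<gamma>\<close>. The off-diagonal blocks contribute \<open>2 \<Sum> D\<^sub>i\<^sub>j Q\<^sub>i\<^sub>j\<close>, which
  by Cauchy-Schwarz is at most \<open>2 \<surd>(g e)\<close> with \<open>g = \<Sum> D\<^sub>i\<^sub>j\<^sup>2 / \<delta>\<^sub>i\<^sub>j\<close>, because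
  \<open>\<Sum> \<delta>\<^sub>i\<^sub>j Q\<^sub>i\<^sub>j\<^sup>2 \<le> e\<close>. Hence \<open>(1 - \<theta>)\<^sup>2 e \<le> 4 g\<close> as soon as \<open>\<theta> < 1\<close>.

  Moments. The expectation of \<open>g\<close> is exactly \<open>G / n\<close>, where \<open>G\<close> is the double sum in the theorem
  (\<open>expected_sample_cross_sq\<close>). The expectation of \<open>\<parallel>D\<parallel>\<^sup>2\<close> is at most \<open>8/3 (S + r(n)) / n\<close>
  (\<open>expected_sample_deviation_sq\<close>). This is the matrix inequality \<open>expected_op_norm_sq_sum_le\<close>:
  independence allows random signs to be inserted into a centred sum (\<open>symmetrization\<close>), and a sum
  of fixed symmetric matrices with random signs is controlled through its trace moments
  (\<open>matrix_khintchine\<close>), where the factor \<open>1 + 2 \<lceil>ln d\<rceil>\<close> of \<open>c(d)\<close> arises. One application turns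
  \<open>\<parallel>\<Sum> Y\<^sub>i\<parallel>\<^sup>2\<close> into \<open>\<parallel>\<Sum> Y\<^sub>i\<^sup>2\<parallel>\<close>, a second one compares the latter with its mean.

  Conclusion. As \<open>V\<close> and \<open>\<nu>\<close> are nonnegative, the logarithmic terms of the sample size condition
  give \<open>n \<ge> 12\<close>, enough for the moment inequality, and its last term
  gives \<open>E \<theta>\<^sup>2 \<le> 2/3 \<delta>\<close>. A single application of Markov's inequality to a linear
  combination of \<open>\<theta>\<^sup>2\<close> and \<open>g\<close> (\<open>joint_markov\<close>) then shows that \<open>4 g / (1 - \<theta>)\<^sup>2\<close> exceeds
  \<open>150 G / (n \<delta>)\<close> with probability at most \<open>\<delta>\<close>. Treating both random quantities together keeps the
  constant at 75: two separate Markov bounds with a union bound would lose more.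
\<close>

section \<open>Operator norm and Frobenius inner product of real matrices\<close>

lemma op_norm_works: "norm (A *v x) \<le> op_norm A * norm x" for A :: "real^'n^'m"
  unfolding op_norm_def by (rule onorm) (rule matrix_vector_mul_bounded_linear)

lemma op_norm_nonneg [simp]: "0 \<le> op_norm A" for A :: "real^'n^'m"
  unfolding op_norm_def by (rule onorm_pos_le) (rule matrix_vector_mul_bounded_linear)

lemma op_norm_least: "op_norm A \<le> c" if "\<And>x. norm (A *v x) \<le> c * norm x" for A :: "real^'n^'m"
  unfolding op_norm_def by (rule onorm_le) (rule that)

lemma op_norm_triangle: "op_norm (A + B) \<le> op_norm A + op_norm B" for A B :: "real^'n^'m"
  unfolding op_norm_def matrix_vector_mult_add_rdistrib
  by (rule onorm_triangle) (rule matrix_vector_mul_bounded_linear)+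

lemma op_norm_scaleR: "op_norm (c *\<^sub>R A) = \<bar>c\<bar> * op_norm A" for A :: "real^'n^'m"
  unfolding op_norm_def scaleR_matrix_vector_assoc[symmetric]
  by (rule onorm_scaleR) (rule matrix_vector_mul_bounded_linear)

lemma op_norm_zero [simp]: "op_norm (0 :: real^'n^'m) = 0"
  using op_norm_scaleR[of 0 "0 :: real^'n^'m"] by simp

lemma op_norm_minus: "op_norm (- A) = op_norm A" for A :: "real^'n^'m"
  using op_norm_scaleR[of "-1" A] by simp

lemma op_norm_diff: "op_norm (A - B) \<le> op_norm A + op_norm B" for A B :: "real^'n^'m"
  using op_norm_triangle[of A "- B"] by (simp add: op_norm_minus)

lemma op_norm_sum: "op_norm (sum f S) \<le> (\<Sum>i\<in>S. op_norm (f i))" for f :: "'i \<Rightarrow> real^'n^'m"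
proof (induction S rule: infinite_finite_induct)
  case (insert i S)
  then show ?case using op_norm_triangle[of "f i" "sum f S"] by simp
qed auto

lemma op_norm_mult: "op_norm (A ** B) \<le> op_norm A * op_norm B"
  for A :: "real^'n^'m" and B :: "real^'p^'n"
proof (rule op_norm_least)
  fix x
  have "norm ((A ** B) *v x) \<le> op_norm A * norm (B *v x)"
    using op_norm_works[of A "B *v x"] by (simp add: matrix_vector_mul_assoc)
  also have "\<dots> \<le> op_norm A * (op_norm B * norm x)"
    by (intro mult_left_mono op_norm_works op_norm_nonneg)
  finally show "norm ((A ** B) *v x) \<le> op_norm A * op_norm B * norm x" by simp
qed

lemma norm_matrix_vector_le: "norm (A *v x) \<le> norm A * norm x" for A :: "real^'n^'m"
proof -
  have "(norm (A *v x))\<^sup>2 = (\<Sum>i\<in>UNIV. (A $ i \<bullet> x)\<^sup>2)"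
    by (simp add: norm_vec_def L2_set_def sum_nonneg matrix_vector_mul_component)
  also have "\<dots> \<le> (\<Sum>i\<in>UNIV. (norm (A $ i))\<^sup>2 * (norm x)\<^sup>2)"
    by (intro sum_mono) (metis Cauchy_Schwarz_ineq2 abs_norm_cancel abs_mult power2_abs power_mono power_mult_distrib abs_ge_zero)
  also have "\<dots> = (norm A * norm x)\<^sup>2"
    by (simp add: norm_vec_def[of A] L2_set_def sum_nonneg sum_distrib_right power_mult_distrib)
  finally show ?thesis by (rule power2_le_imp_le) simp
qed

lemma op_norm_le_norm: "op_norm A \<le> norm A" for A :: "real^'n^'m"
  by (rule op_norm_least) (rule norm_matrix_vector_le)

lemma continuous_on_op_norm: "continuous_on S (op_norm :: real^'n^'m \<Rightarrow> real)"
proof (rule continuous_on_subset[of UNIV])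
  have "\<bar>op_norm A - op_norm B\<bar> \<le> norm (A - B)" for A B :: "real^'n^'m"
    using op_norm_triangle[of "A - B" B] op_norm_triangle[of "B - A" A]
      op_norm_le_norm[of "A - B"] op_norm_le_norm[of "B - A"] by (simp add: norm_minus_commute)
  then have "lipschitz_on 1 UNIV (op_norm :: real^'n^'m \<Rightarrow> real)"
    by (intro lipschitz_onI) (auto simp: dist_norm)
  then show "continuous_on UNIV (op_norm :: real^'n^'m \<Rightarrow> real)"
    by (rule lipschitz_on_continuous_on)
qed simp

lemma borel_measurable_op_norm [measurable]:
  "(op_norm :: real^'n^'m \<Rightarrow> real) \<in> borel_measurable borel"
  by (rule borel_measurable_continuous_onI) (rule continuous_on_op_norm)

lemma inner_symmetric: "x \<bullet> (A *v y) = (A *v x) \<bullet> y" if "transpose A = A" for A :: "real^'n^'n"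
  using dot_lmul_matrix[of x A y] that by (metis transpose_matrix_vector)

lemma abs_inner_op_norm: "\<bar>x \<bullet> (A *v x)\<bar> \<le> op_norm A * (norm x)\<^sup>2" for A :: "real^'n^'n"
proof -
  have "\<bar>x \<bullet> (A *v x)\<bar> \<le> norm x * norm (A *v x)" by (rule Cauchy_Schwarz_ineq2)
  also have "\<dots> \<le> norm x * (op_norm A * norm x)" by (intro mult_left_mono op_norm_works) simp
  finally show ?thesis by (simp add: power2_eq_square mult_ac)
qed

lemma inner_matrix_mult_left: "(A ** B) \<bullet> C = B \<bullet> (transpose A ** C)"
  for A :: "real^'n^'m" and B :: "real^'p^'n" and C :: "real^'p^'m"
proof -
  have "(A ** B) \<bullet> C = (\<Sum>i\<in>UNIV. \<Sum>j\<in>UNIV. \<Sum>k\<in>UNIV. A$i$k * B$k$j * C$i$j)"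
    by (simp add: inner_vec_def matrix_matrix_mult_def sum_distrib_right)
  also have "\<dots> = (\<Sum>i\<in>UNIV. \<Sum>k\<in>UNIV. \<Sum>j\<in>UNIV. A$i$k * B$k$j * C$i$j)"
    by (intro sum.cong refl sum.swap)
  also have "\<dots> = (\<Sum>k\<in>UNIV. \<Sum>i\<in>UNIV. \<Sum>j\<in>UNIV. A$i$k * B$k$j * C$i$j)"
    by (rule sum.swap)
  also have "\<dots> = (\<Sum>k\<in>UNIV. \<Sum>j\<in>UNIV. \<Sum>i\<in>UNIV. A$i$k * B$k$j * C$i$j)"
    by (intro sum.cong refl sum.swap)
  also have "\<dots> = B \<bullet> (transpose A ** C)"
    by (simp add: inner_vec_def matrix_matrix_mult_def transpose_def sum_distrib_left mult_ac)
  finally show ?thesis .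
qed

lemma inner_transpose: "transpose A \<bullet> transpose B = A \<bullet> B" for A B :: "real^'n^'m"
  unfolding inner_vec_def transpose_def by (simp add: sum.swap[of _ "UNIV :: 'n set"])

lemma inner_matrix_mult_right: "(A ** B) \<bullet> C = A \<bullet> (C ** transpose B)"
  for A :: "real^'n^'m" and B :: "real^'p^'n" and C :: "real^'p^'m"
proof -
  have "(A ** B) \<bullet> C = (transpose B ** transpose A) \<bullet> transpose C"
    by (metis inner_transpose matrix_transpose_mul)
  also have "\<dots> = A \<bullet> (C ** transpose B)"
    by (metis inner_matrix_mult_left inner_transpose matrix_transpose_mul transpose_transpose)
  finally show ?thesis .
qed

text \<open>Column by column this is the bound of a quadratic form by the operator norm and amounts
  to \<open>tr (V A A\<^sup>T) \<le> \<parallel>V\<parallel> tr (A A\<^sup>T)\<close>.\<close>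

lemma inner_matrix_mult_le: "(V ** A) \<bullet> A \<le> op_norm V * (norm A)\<^sup>2"
  for V :: "real^'n^'n" and A :: "real^'p^'n"
proof -
  have nrm: "(norm B)\<^sup>2 = (\<Sum>j\<in>UNIV. (norm (column j B))\<^sup>2)" for B :: "real^'p^'n"
    by (simp add: power2_norm_eq_inner inner_vec_def column_def) (rule sum.swap)
  have "(V ** A) \<bullet> A = (\<Sum>j\<in>UNIV. column j A \<bullet> (V *v column j A))"
    by (simp add: inner_vec_def column_def matrix_matrix_mult_def matrix_vector_mult_def mult.commute)
      (rule sum.swap)
  also have "\<dots> \<le> (\<Sum>j\<in>UNIV. op_norm V * (norm (column j A))\<^sup>2)"
    by (intro sum_mono) (use abs_inner_op_norm abs_le_D1 in blast)
  finally show ?thesis by (simp add: nrm sum_distrib_left)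
qed

lemma matrix_add_rdistrib: "(A + B) ** C = A ** C + B ** C" for A :: "real^'n^'m" and C :: "real^'p^'n"
  by (simp add: vec_eq_iff matrix_matrix_mult_def distrib_right sum.distrib)

lemma sum_matrix_mult_right: "A ** sum f S = (\<Sum>i\<in>S. A ** f i)" for A :: "real^'n^'m" and f :: "'i \<Rightarrow> real^'p^'n"
  by (induction S rule: infinite_finite_induct) (auto simp: matrix_add_ldistrib)

lemma sum_matrix_vector_mult: "sum f S *v x = (\<Sum>i\<in>S. f i *v x)" for f :: "'i \<Rightarrow> real^'n^'m"
  by (induction S rule: infinite_finite_induct) (auto simp: matrix_vector_mult_add_rdistrib)

lemma matrix_diff_ldistrib: "A ** (B - C) = A ** B - A ** C" for A :: "real^'n^'m" and B :: "real^'p^'n"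
  by (simp add: vec_eq_iff matrix_matrix_mult_def right_diff_distrib sum_subtractf)

lemma matrix_diff_rdistrib: "(A - B) ** C = A ** C - B ** C" for A :: "real^'n^'m" and C :: "real^'p^'n"
  by (simp add: vec_eq_iff matrix_matrix_mult_def left_diff_distrib sum_subtractf)

lemma matrix_scaleR_left: "(c *\<^sub>R A) ** B = c *\<^sub>R (A ** B)" for A :: "real^'n^'m" and B :: "real^'p^'n"
  by (simp add: scaleR_vec_def vec_eq_iff matrix_matrix_mult_def sum_distrib_left mult_ac)

lemma matrix_scaleR_right: "A ** (c *\<^sub>R B) = c *\<^sub>R (A ** B)" for A :: "real^'n^'m" and B :: "real^'p^'n"
  by (simp add: scaleR_vec_def vec_eq_iff matrix_matrix_mult_def sum_distrib_left mult_ac)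

lemma transpose_sum: "transpose (sum f S) = (\<Sum>i\<in>S. transpose (f i))" for f :: "'i \<Rightarrow> real^'n^'m"
  by (simp add: vec_eq_iff transpose_def)

lemma transpose_scaleR: "transpose (c *\<^sub>R A) = c *\<^sub>R transpose A" for A :: "real^'n^'m"
  by (simp add: vec_eq_iff transpose_def)

text \<open>The Frobenius norm is submultiplicative: its square for \<open>A ** B\<close> is the
  quadratic form of \<open>transpose A ** A\<close> at \<open>B\<close>.\<close>

lemma norm_matrix_mult_le: "norm (A ** B) \<le> norm A * norm B"
  for A :: "real^'n^'m" and B :: "real^'p^'n"
proof -
  have "norm (transpose A) = norm A" by (simp add: norm_eq_sqrt_inner inner_transpose)
  then have op: "op_norm (transpose A ** A) \<le> norm A * norm A"
    using op_norm_mult[of "transpose A" A] mult_mono[OF op_norm_le_norm[of "transpose A"] op_norm_le_norm[of A]]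
    by simp
  have "(norm (A ** B))\<^sup>2 = ((transpose A ** A) ** B) \<bullet> B"
    using inner_matrix_mult_left[of A B "A ** B"]
    by (simp add: power2_norm_eq_inner matrix_mul_assoc inner_commute)
  also have "\<dots> \<le> op_norm (transpose A ** A) * (norm B)\<^sup>2" by (rule inner_matrix_mult_le)
  also have "\<dots> \<le> (norm A * norm A) * (norm B)\<^sup>2" by (intro mult_right_mono op) simp
  finally have "(norm (A ** B))\<^sup>2 \<le> (norm A * norm B)\<^sup>2"
    by (simp add: power2_eq_square mult_ac)
  then show ?thesis by (rule power2_le_imp_le) simp
qed

lemma continuous_on_matrix_square: "continuous_on UNIV (\<lambda>A::real^'n^'n. A ** A)"
proof -
  have "bounded_bilinear ((**) :: real^'n^'n \<Rightarrow> real^'n^'n \<Rightarrow> real^'n^'n)"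
    by (rule bilinear_conv_bounded_bilinear[THEN iffD1])
      (auto simp: bilinear_def intro!: linearI simp: matrix_add_ldistrib matrix_add_rdistrib matrix_scaleR_left matrix_scaleR_right)
  from bounded_bilinear.continuous_on[OF this continuous_on_id continuous_on_id]
  show ?thesis by blast
qed

section \<open>A trace inequality for powers of two symmetric matrices\<close>

primrec mpow :: "real^'n^'n \<Rightarrow> nat \<Rightarrow> real^'n^'n" where
  "mpow A 0 = mat 1"
| "mpow A (Suc m) = A ** mpow A m"

lemma mpow_add: "mpow A (i + j) = mpow A i ** mpow A j"
  by (induction i) (auto simp: matrix_mul_assoc)

lemma mpow_Suc_right: "mpow A (Suc m) = mpow A m ** A"
  using mpow_add[of A m 1] by simp

lemma transpose_mpow: "transpose (mpow A m) = mpow A m" if "transpose A = A"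
proof (induction m)
  case (Suc m)
  have "transpose (mpow A (Suc m)) = transpose (mpow A m) ** transpose A"
    by (simp add: matrix_transpose_mul)
  then show ?case using Suc that by (simp only: mpow_Suc_right)
qed (simp add: transpose_mat)

text \<open>The telescoping expansion of a difference of powers of two matrices that need not
  commute.\<close>

lemma mpow_diff:
  "mpow A (Suc m) - mpow B (Suc m) = (\<Sum>q\<le>m. mpow A q ** (A - B) ** mpow B (m - q))"
proof (induction m)
  case (Suc m)
  have "mpow A (Suc (Suc m)) - mpow B (Suc (Suc m))
      = A ** (mpow A (Suc m) - mpow B (Suc m)) + (A - B) ** mpow B (Suc m)"
    by (simp add: matrix_diff_ldistrib matrix_diff_rdistrib)
  also have "A ** (mpow A (Suc m) - mpow B (Suc m))
      = (\<Sum>q\<le>m. mpow A (Suc q) ** (A - B) ** mpow B (Suc m - Suc q))"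
    by (simp only: Suc sum_matrix_mult_right) (simp add: matrix_mul_assoc)
  finally show ?case
    by (subst sum.atMost_Suc_shift) simp
qed simp

text \<open>A discretely convex sequence lies below its end values, as its leftmost maximum cannot
  be interior.\<close>

lemma midpoint_convex_le_ends:
  fixes f :: "nat \<Rightarrow> real"
  assumes conv: "\<And>i. 0 < i \<Longrightarrow> i < s \<Longrightarrow> 2 * f i \<le> f (i - 1) + f (i + 1)"
  shows "i \<le> s \<Longrightarrow> f i \<le> max (f 0) (f s)"
proof -
  define m where "m = Max (f ` {..s})"
  have m: "f i \<le> m" if "i \<le> s" for i using that by (simp add: m_def)
  have "m \<in> f ` {..s}" unfolding m_def by (rule Max_in) auto
  then obtain i0 where "i0 \<le> s \<and> f i0 = m" by auto
  then have ex: "\<exists>i. i \<le> s \<and> f i = m" by blast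
  define j where "j = (LEAST i. i \<le> s \<and> f i = m)"
  have j: "j \<le> s" "f j = m" using LeastI_ex[OF ex] by (auto simp: j_def)
  have "j = 0 \<or> j = s"
  proof (rule ccontr)
    assume "\<not> ?thesis"
    then have *: "0 < j" "j < s" using j by auto
    then have "2 * m \<le> f (j - 1) + f (j + 1)" using conv j by auto
    moreover have "f (j + 1) \<le> m" "f (j - 1) \<le> m" using * by (auto intro: m)
    ultimately have "f (j - 1) = m" by linarith
    then have "j \<le> j - 1" unfolding j_def using * by (intro Least_le) (auto simp: j_def)
    with * show False by auto
  qed
  with j m show "i \<le> s \<Longrightarrow> f i \<le> max (f 0) (f s)" by fastforce
qed

text \<open>Left multiplication by \<open>A\<close> and right multiplication by \<open>B\<close> are
  commuting self-adjoint operators on matrices with the Frobenius inner product. Hence \<open>c q =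
  H \<bullet> (A\<^sup>q H B\<^bsup>2s - q\<^esup>)\<close> satisfies \<open>2 c (i + j) \<le> c (2
  i) + c (2 j)\<close> by Cauchy-Schwarz, so that \<open>c q + c (2s - q)\<close> is largest at
  \<open>q = 0\<close>.\<close>

lemma sum_inner_mpow_le:
  fixes A B H :: "real^'n^'n"
  assumes A: "transpose A = A" and B: "transpose B = B" and H: "transpose H = H"
  shows "2 * (\<Sum>q\<le>2 * s. H \<bullet> (mpow A q ** H ** mpow B (2 * s - q)))
    \<le> real (2 * s + 1) * ((H ** H) \<bullet> mpow A (2 * s) + (H ** H) \<bullet> mpow B (2 * s))"
proof -
  define c where "c q = H \<bullet> (mpow A q ** H ** mpow B (2 * s - q))" for q
  have c_split: "c (i + j) = (mpow A i ** H ** mpow B (s - i)) \<bullet> (mpow A j ** H ** mpow B (s - j))"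
    if "i \<le> s" "j \<le> s" for i j
  proof -
    have "2 * s - (i + j) = (s - j) + (s - i)" using that by simp
    then have "c (i + j) = H \<bullet> (mpow A i ** (mpow A j ** H ** mpow B (s - j)) ** mpow B (s - i))"
      by (simp add: c_def mpow_add matrix_mul_assoc)
    also have "\<dots> = H \<bullet> (mpow A i ** ((mpow A j ** H ** mpow B (s - j)) ** mpow B (s - i)))"
      by (simp only: matrix_mul_assoc)
    also have "\<dots> = (mpow A i ** H) \<bullet> ((mpow A j ** H ** mpow B (s - j)) ** mpow B (s - i))"
      by (simp only: inner_matrix_mult_left[of "mpow A i" H] transpose_mpow[OF A])
    also have "\<dots> = (mpow A i ** H ** mpow B (s - i)) \<bullet> (mpow A j ** H ** mpow B (s - j))"
      by (simp only: inner_matrix_mult_right[of "mpow A i ** H"] transpose_mpow[OF B])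
    finally show ?thesis .
  qed
  have c_mid: "2 * c (i + j) \<le> c (2 * i) + c (2 * j)" if "i \<le> s" "j \<le> s" for i j
  proof -
    let ?x = "mpow A i ** H ** mpow B (s - i)" and ?y = "mpow A j ** H ** mpow B (s - j)"
    have "0 \<le> (?x - ?y) \<bullet> (?x - ?y)" by (rule inner_ge_zero)
    also have "\<dots> = ?x \<bullet> ?x + ?y \<bullet> ?y - 2 * (?x \<bullet> ?y)"
      by (simp only: inner_diff_left inner_diff_right inner_commute[of ?y ?x])
    finally have "2 * (?x \<bullet> ?y) \<le> ?x \<bullet> ?x + ?y \<bullet> ?y" by linarith
    then show ?thesis
      by (simp only: mult_2[of i] mult_2[of j] c_split[OF that] c_split[OF that(1) that(1)] c_split[OF that(2) that(2)])
  qed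
  define b where "b i = c (2 * i) + c (2 * (s - i))" for i
  have b_le: "b i \<le> b 0" if "i \<le> s" for i
  proof -
    have "b i \<le> max (b 0) (b s)"
    proof (rule midpoint_convex_le_ends[OF _ that])
      fix i assume i: "0 < i" "i < s"
      have "2 * c ((i - 1) + (i + 1)) \<le> c (2 * (i - 1)) + c (2 * (i + 1))"
        by (rule c_mid) (use i in auto)
      moreover have "2 * c ((s - (i - 1)) + (s - (i + 1))) \<le> c (2 * (s - (i - 1))) + c (2 * (s - (i + 1)))"
        by (rule c_mid) auto
      moreover have "(i - 1) + (i + 1) = 2 * i" "(s - (i - 1)) + (s - (i + 1)) = 2 * (s - i)"
        using i by auto
      moreover have "2 * (a + b) \<le> (p + q) + (r + t)" if "2 * a \<le> p + r" "2 * b \<le> q + t"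
        for a b p q r t :: real using that by simp
      ultimately show "2 * b i \<le> b (i - 1) + b (i + 1)" by (simp only: b_def)
    qed
    then show ?thesis by (simp add: b_def)
  qed
  have pair: "c q + c (2 * s - q) \<le> b 0" if "q \<le> 2 * s" for q
  proof (cases "even q")
    case True
    then obtain i where "q = 2 * i" by auto
    with b_le[of i] that show ?thesis by (simp add: b_def diff_mult_distrib2)
  next
    case False
    then obtain i where q: "q = 2 * i + 1" using oddE by blast
    with that have i: "Suc i \<le> s" by simp
    have "2 * c (i + Suc i) \<le> c (2 * i) + c (2 * Suc i)" by (rule c_mid) (use i in auto)
    moreover have "2 * c ((s - i) + (s - Suc i)) \<le> c (2 * (s - i)) + c (2 * (s - Suc i))"
      by (rule c_mid) auto
    moreover have "(s - i) + (s - Suc i) = 2 * s - q" "i + Suc i = q" using i q by auto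
    ultimately show ?thesis using b_le[of i] b_le[of "Suc i"] i unfolding b_def by simp
  qed
  have "(\<Sum>q\<le>2 * s. c (2 * s - q)) = (\<Sum>q\<le>2 * s. c q)"
    by (rule sum.nat_diff_reindex[of c "Suc (2 * s)", simplified lessThan_Suc_atMost, simplified])
  then have "2 * (\<Sum>q\<le>2 * s. c q) = (\<Sum>q\<le>2 * s. c q + c (2 * s - q))"
    by (simp add: sum.distrib)
  also have "\<dots> \<le> (\<Sum>q\<le>2 * s. b 0)" by (intro sum_mono pair) simp
  also have "\<dots> = real (2 * s + 1) * b 0" by simp
  also have "b 0 = (H ** H) \<bullet> mpow A (2 * s) + (H ** H) \<bullet> mpow B (2 * s)"
    using inner_matrix_mult_left[of H H "mpow B (2 * s)"] inner_matrix_mult_right[of H H "mpow A (2 * s)"]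
    by (simp add: b_def c_def H)
  finally show ?thesis unfolding c_def .
qed

section \<open>Rademacher sums of symmetric matrices\<close>

text \<open>A realisation of Rademacher signs on \<open>I\<close> is encoded by the set
  \<open>J\<close> of indices with sign \<open>+1\<close>; expectations over the signs are then sums
  over \<open>Pow I\<close>, up to the factor \<open>2 ^ card I\<close>.\<close>

definition rsign :: "'i set \<Rightarrow> 'i \<Rightarrow> real" where
  "rsign J i = (if i \<in> J then 1 else -1)"

definition flip :: "'i \<Rightarrow> 'i set \<Rightarrow> 'i set" where
  "flip i J = (if i \<in> J then J - {i} else insert i J)"

definition signed_sum :: "'i set \<Rightarrow> ('i \<Rightarrow> 'b::real_vector) \<Rightarrow> 'i set \<Rightarrow> 'b" where
  "signed_sum I H J = (\<Sum>i\<in>I. rsign J i *\<^sub>R H i)"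

lemma sum_flip:
  assumes "i \<in> I"
  shows "(\<Sum>J\<in>Pow I. f (flip i J)) = (\<Sum>J\<in>Pow I. f J)"
  by (rule sum.reindex_bij_witness[of _ "flip i" "flip i"]) (use assms in \<open>auto simp: flip_def\<close>)

lemma signed_sum_flip:
  assumes "finite I" "i \<in> I"
  shows "rsign J i *\<^sub>R (signed_sum I H J - signed_sum I H (flip i J)) = 2 *\<^sub>R H i"
proof -
  have "signed_sum I H J - signed_sum I H (flip i J)
      = (\<Sum>j\<in>I. (rsign J j - rsign (flip i J) j) *\<^sub>R H j)"
    by (simp add: signed_sum_def sum_subtractf scaleR_diff_left)
  also have "\<dots> = (\<Sum>j\<in>I. if j = i then (2 * rsign J i) *\<^sub>R H i else 0)"
  proof (intro sum.cong refl)
    fix j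
    have "rsign J j - rsign (flip i J) j = (if j = i then 2 * rsign J i else 0)"
      by (cases "j = i"; cases "i \<in> J"; cases "j \<in> J"; simp only: rsign_def flip_def; simp)
    then show "(rsign J j - rsign (flip i J) j) *\<^sub>R H j = (if j = i then (2 * rsign J i) *\<^sub>R H i else 0)"
      by simp
  qed
  also have "\<dots> = (2 * rsign J i) *\<^sub>R H i"
    using assms by simp
  finally show ?thesis by (simp add: rsign_def)
qed

lemma transpose_signed_sum:
  fixes H :: "'i \<Rightarrow> real^'n^'n"
  assumes "\<And>i. i \<in> I \<Longrightarrow> transpose (H i) = H i"
  shows "transpose (signed_sum I H J) = signed_sum I H J"
  using assms by (simp add: signed_sum_def transpose_sum transpose_scaleR)

text \<open>The recursion for the trace moments of \<open>X = \<Sum> \<epsilon>\<^sub>i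
  H\<^sub>i\<close>. Write \<open>tr X\<^bsup>2s+2\<^esup> = \<Sum> \<epsilon>\<^sub>i tr (H\<^sub>i
  X\<^bsup>2s+1\<^esup>)\<close> and average each term with the one in which the sign
  \<open>\<epsilon>\<^sub>i\<close> is flipped: this produces the difference of the
  \<open>(2s+1)\<close>-st powers of two matrices that differ by \<open>2 \<epsilon>\<^sub>i
  H\<^sub>i\<close>, to which the expansion \<open>mpow_diff\<close> and the trace inequality
  \<open>sum_inner_mpow_le\<close> apply. It is a discrete form of Gaussian integration by
  parts.\<close>

lemma norm_mpow_Suc_signed_sum:
  fixes H :: "'i \<Rightarrow> real^'n^'n"
  assumes I: "finite I" and H: "\<And>i. i \<in> I \<Longrightarrow> transpose (H i) = H i"
  shows "(\<Sum>J\<in>Pow I. (norm (mpow (signed_sum I H J) (Suc s)))\<^sup>2)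
    \<le> real (2 * s + 1) * op_norm (\<Sum>i\<in>I. H i ** H i) * (\<Sum>J\<in>Pow I. (norm (mpow (signed_sum I H J) s))\<^sup>2)"
proof -
  let ?X = "signed_sum I H"
  let ?V = "\<Sum>i\<in>I. H i ** H i"
  have sym: "transpose (?X J) = ?X J" for J by (rule transpose_signed_sum) (rule H)
  have norm_eq: "(norm (mpow (?X J) m))\<^sup>2 = mat 1 \<bullet> mpow (?X J) (2 * m)" for J m
    using inner_matrix_mult_left[of "mpow (?X J) m" "mat 1" "mpow (?X J) m"]
    by (simp add: power2_norm_eq_inner transpose_mpow sym mult_2 mpow_add)
  have one: "(\<Sum>J\<in>Pow I. rsign J i * (H i \<bullet> mpow (?X J) (Suc (2 * s))))
      \<le> real (2 * s + 1) * (\<Sum>J\<in>Pow I. (H i ** H i) \<bullet> mpow (?X J) (2 * s))" if i: "i \<in> I" for i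
  proof -
    let ?f = "\<lambda>J. rsign J i * (H i \<bullet> mpow (?X J) (Suc (2 * s)))"
    have "2 * (\<Sum>J\<in>Pow I. ?f J) = (\<Sum>J\<in>Pow I. ?f J) + (\<Sum>J\<in>Pow I. ?f (flip i J))"
      unfolding sum_flip[OF i, of ?f] by (rule mult_2)
    also have "\<dots> = (\<Sum>J\<in>Pow I. rsign J i *
        (H i \<bullet> (mpow (?X J) (Suc (2 * s)) - mpow (?X (flip i J)) (Suc (2 * s)))))"
      unfolding sum.distrib[symmetric]
      by (intro sum.cong refl, simp only: inner_diff_right) (simp add: rsign_def flip_def del: mpow.simps)
    also have "\<dots> = (\<Sum>J\<in>Pow I. 2 * (\<Sum>q\<le>2 * s.
        H i \<bullet> (mpow (?X J) q ** H i ** mpow (?X (flip i J)) (2 * s - q))))"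
    proof (intro sum.cong refl)
      fix J
      have "rsign J i * (H i \<bullet> (mpow (?X J) q ** (?X J - ?X (flip i J)) ** mpow (?X (flip i J)) (2 * s - q)))
         = H i \<bullet> (mpow (?X J) q ** (rsign J i *\<^sub>R (?X J - ?X (flip i J))) ** mpow (?X (flip i J)) (2 * s - q))" for q
        by (simp only: matrix_scaleR_left matrix_scaleR_right inner_scaleR_right)
      then show "rsign J i * (H i \<bullet> (mpow (?X J) (Suc (2 * s)) - mpow (?X (flip i J)) (Suc (2 * s))))
        = 2 * (\<Sum>q\<le>2 * s. H i \<bullet> (mpow (?X J) q ** H i ** mpow (?X (flip i J)) (2 * s - q)))"
        by (simp only: mpow_diff inner_sum_right sum_distrib_left signed_sum_flip[OF I i]
            matrix_scaleR_left matrix_scaleR_right inner_scaleR_right)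
    qed
    also have "\<dots> \<le> (\<Sum>J\<in>Pow I. real (2 * s + 1) *
        ((H i ** H i) \<bullet> mpow (?X J) (2 * s) + (H i ** H i) \<bullet> mpow (?X (flip i J)) (2 * s)))"
      by (intro sum_mono sum_inner_mpow_le sym H i)
    also have "\<dots> = 2 * (real (2 * s + 1) * (\<Sum>J\<in>Pow I. (H i ** H i) \<bullet> mpow (?X J) (2 * s)))"
      by (simp add: sum_distrib_left[symmetric] sum.distrib
          sum_flip[OF i, of "\<lambda>J. (H i ** H i) \<bullet> mpow (?X J) (2 * s)"])
    finally show ?thesis by simp
  qed
  have "(\<Sum>J\<in>Pow I. (norm (mpow (?X J) (Suc s)))\<^sup>2)
      = (\<Sum>J\<in>Pow I. ?X J \<bullet> mpow (?X J) (Suc (2 * s)))"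
  proof (intro sum.cong refl)
    fix J
    have "mat 1 \<bullet> mpow (?X J) (2 * Suc s) = mat 1 \<bullet> (?X J ** mpow (?X J) (Suc (2 * s)))" by simp
    also have "\<dots> = ?X J \<bullet> mpow (?X J) (Suc (2 * s))"
      using inner_matrix_mult_left[of "?X J" "mat 1" "mpow (?X J) (Suc (2 * s))"]
      by (simp only: sym matrix_mul_rid)
    finally show "(norm (mpow (?X J) (Suc s)))\<^sup>2 = ?X J \<bullet> mpow (?X J) (Suc (2 * s))"
      by (simp only: norm_eq)
  qed
  also have "\<dots> = (\<Sum>J\<in>Pow I. \<Sum>i\<in>I. rsign J i * (H i \<bullet> mpow (?X J) (Suc (2 * s))))"
    by (intro sum.cong refl, subst (1) signed_sum_def) (simp only: inner_sum_left inner_scaleR_left)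
  also have "\<dots> = (\<Sum>i\<in>I. \<Sum>J\<in>Pow I. rsign J i * (H i \<bullet> mpow (?X J) (Suc (2 * s))))"
    by (rule sum.swap)
  also have "\<dots> \<le> (\<Sum>i\<in>I. real (2 * s + 1) * (\<Sum>J\<in>Pow I. (H i ** H i) \<bullet> mpow (?X J) (2 * s)))"
    by (rule sum_mono) (rule one)
  finally have e1: "(\<Sum>J\<in>Pow I. (norm (mpow (?X J) (Suc s)))\<^sup>2)
      \<le> (\<Sum>i\<in>I. real (2 * s + 1) * (\<Sum>J\<in>Pow I. (H i ** H i) \<bullet> mpow (?X J) (2 * s)))"
    .
  have e2: "(\<Sum>i\<in>I. real (2 * s + 1) * (\<Sum>J\<in>Pow I. (H i ** H i) \<bullet> mpow (?X J) (2 * s)))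
      = real (2 * s + 1) * (\<Sum>J\<in>Pow I. ?V \<bullet> mpow (?X J) (2 * s))"
    unfolding sum_distrib_left[symmetric] inner_sum_left by (subst sum.swap) (rule refl)
  have e3: "real (2 * s + 1) * (\<Sum>J\<in>Pow I. ?V \<bullet> mpow (?X J) (2 * s))
      \<le> real (2 * s + 1) * (\<Sum>J\<in>Pow I. op_norm ?V * (norm (mpow (?X J) s))\<^sup>2)"
  proof (intro mult_left_mono sum_mono)
    fix J
    have "?V \<bullet> mpow (?X J) (2 * s) = ?V \<bullet> (mpow (?X J) s ** mpow (?X J) s)"
      by (simp add: mult_2 mpow_add)
    also have "\<dots> = (?V ** mpow (?X J) s) \<bullet> mpow (?X J) s"
      using inner_matrix_mult_right[of ?V "mpow (?X J) s" "mpow (?X J) s"]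
      by (simp add: transpose_mpow sym)
    finally show "?V \<bullet> mpow (?X J) (2 * s) \<le> op_norm ?V * (norm (mpow (?X J) s))\<^sup>2"
      using inner_matrix_mult_le[of ?V "mpow (?X J) s"] by (simp only:)
  qed simp
  have e4: "real (2 * s + 1) * (\<Sum>J\<in>Pow I. op_norm ?V * (norm (mpow (?X J) s))\<^sup>2)
      = real (2 * s + 1) * op_norm ?V * (\<Sum>J\<in>Pow I. (norm (mpow (?X J) s))\<^sup>2)"
    by (simp only: sum_distrib_left[symmetric] mult.assoc)
  show ?thesis by (rule order_trans[OF e1 order_trans[OF eq_refl[OF e2] order_trans[OF e3 eq_refl[OF e4]]]])
qed

lemma norm_mat_1: "(norm (mat 1 :: real^'n^'n))\<^sup>2 = CARD('n)"
proof -
  have "(mat 1 :: real^'n^'n) $ i \<bullet> mat 1 $ i = (\<Sum>j\<in>UNIV. if j = i then 1 else 0)" for i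
    unfolding inner_vec_def by (intro sum.cong refl) (simp add: mat_def)
  then show ?thesis by (simp add: power2_norm_eq_inner inner_vec_def[of "mat 1"])
qed

lemma signed_sum_trace_moment:
  fixes H :: "'i \<Rightarrow> real^'n^'n"
  assumes I: "finite I" and H: "\<And>i. i \<in> I \<Longrightarrow> transpose (H i) = H i"
  shows "(\<Sum>J\<in>Pow I. (norm (mpow (signed_sum I H J) p))\<^sup>2)
    \<le> 2 ^ card I * (CARD('n) * (\<Prod>s<p. real (2 * s + 1))) * op_norm (\<Sum>i\<in>I. H i ** H i) ^ p"
proof (induction p)
  case 0
  show ?case using I by (simp add: norm_mat_1 card_Pow)
next
  case (Suc p)
  let ?c = "real (2 * p + 1) * op_norm (\<Sum>i\<in>I. H i ** H i)"
  have "(\<Sum>J\<in>Pow I. (norm (mpow (signed_sum I H J) (Suc p)))\<^sup>2)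
      \<le> ?c * (\<Sum>J\<in>Pow I. (norm (mpow (signed_sum I H J) p))\<^sup>2)"
    by (rule norm_mpow_Suc_signed_sum[OF I H])
  also have "\<dots> \<le> ?c * (2 ^ card I * (CARD('n) * (\<Prod>s<p. real (2 * s + 1)))
      * op_norm (\<Sum>i\<in>I. H i ** H i) ^ p)"
    by (intro mult_left_mono Suc) auto
  also have "\<dots> = 2 ^ card I * (CARD('n) * (\<Prod>s<Suc p. real (2 * s + 1)))
      * op_norm (\<Sum>i\<in>I. H i ** H i) ^ Suc p"
    by (simp only: prod.lessThan_Suc power_Suc mult_ac)
  finally show ?case .
qed

text \<open>For a unit vector \<open>x\<close> the sequence \<open>m \<mapsto> \<parallel>A\<^sup>m
  x\<parallel>\<close> is log-convex, hence \<open>\<parallel>A x\<parallel>\<^sup>p \<le>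
  \<parallel>A\<^sup>p x\<parallel>\<close>.\<close>

lemma op_norm_power_le_norm_mpow:
  fixes A :: "real^'n^'n"
  assumes A: "transpose A = A"
  shows "op_norm A ^ p \<le> norm (mpow A p)"
proof -
  have step: "(norm (A *v x)) ^ m \<le> norm (mpow A m *v x)" if x: "norm x = 1" for x m
  proof -
    define f where "f m = norm (mpow A m *v x)" for m
    have log_convex: "(f (Suc m))\<^sup>2 \<le> f m * f (Suc (Suc m))" for m
    proof -
      have "(f (Suc m))\<^sup>2 = (mpow A (Suc m) *v x) \<bullet> (A *v (mpow A m *v x))"
        by (simp add: f_def power2_norm_eq_inner matrix_vector_mul_assoc)
      also have "\<dots> = (mpow A (Suc (Suc m)) *v x) \<bullet> (mpow A m *v x)"
        by (subst inner_symmetric[OF A]) (simp add: matrix_vector_mul_assoc)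
      also have "\<dots> \<le> f (Suc (Suc m)) * f m" unfolding f_def by (rule norm_cauchy_schwarz)
      finally show ?thesis by (simp add: mult.commute)
    qed
    have f0: "f 0 = 1" using x by (simp add: f_def)
    have nonneg: "0 \<le> f m" for m by (simp add: f_def)
    have ratio: "f 1 * f m \<le> f (Suc m)" for m
    proof (induction m)
      case (Suc m)
      show ?case
      proof (cases "f (Suc m) = 0")
        case False
        then have pos: "0 < f (Suc m)" using nonneg[of "Suc m"] by simp
        have "f (Suc m) * (f 1 * f (Suc m)) = f 1 * (f (Suc m))\<^sup>2" by (simp add: power2_eq_square)
        also have "\<dots> \<le> f 1 * (f m * f (Suc (Suc m)))"
          by (intro mult_left_mono log_convex nonneg)
        also have "\<dots> \<le> f (Suc m) * f (Suc (Suc m))"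
          using mult_right_mono[OF Suc nonneg[of "Suc (Suc m)"]] by (simp add: mult_ac)
        finally show ?thesis using pos by simp
      qed (use nonneg in simp)
    qed (simp add: f0)
    have "f 1 ^ m \<le> f m"
    proof (induction m)
      case (Suc m)
      have "f 1 ^ Suc m \<le> f 1 * f m" using mult_left_mono[OF Suc nonneg[of 1]] by simp
      with ratio[of m] show ?case by linarith
    qed (simp add: f0)
    then show ?thesis by (simp add: f_def)
  qed
  show ?thesis
  proof (cases "p = 0")
    case True
    have "1 \<le> real CARD('n)" by (simp add: Suc_leI)
    with norm_mat_1 have "1 \<le> (norm (mat 1 :: real^'n^'n))\<^sup>2" by metis
    then have "1 \<le> norm (mat 1 :: real^'n^'n)" using power2_le_imp_le[of 1 "norm (mat 1 :: real^'n^'n)"] by simp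
    with True show ?thesis by simp
  next
    case False
    define c where "c = root p (norm (mpow A p))"
    have "op_norm A \<le> c"
    proof (rule op_norm_least)
      fix x :: "real^'n"
      show "norm (A *v x) \<le> c * norm x"
      proof (cases "x = 0")
        case nz: False
        define y where "y = (1 / norm x) *\<^sub>R x"
        have y: "norm y = 1" using nz by (simp add: y_def)
        have "norm (A *v y) ^ p \<le> norm (mpow A p)"
          using step[OF y, of p] norm_matrix_vector_le[of "mpow A p" y] y by simp
        then have "root p (norm (A *v y) ^ p) \<le> c"
          unfolding c_def using False by (intro real_root_le_mono) auto
        then have "norm (A *v y) \<le> c" using False by (simp add: real_root_power_cancel)
        moreover have "A *v y = (1 / norm x) *\<^sub>R (A *v x)"
          by (simp add: y_def matrix_vector_mult_scaleR)
        ultimately show ?thesis using nz by (simp add: field_simps)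
      qed simp
    qed
    then have "op_norm A ^ p \<le> c ^ p" by (intro power_mono) auto
    then show ?thesis using False by (simp add: c_def real_root_pow_pos2)
  qed
qed

text \<open>The tangent of a power function lies below its graph; this is how convexity enters each
  Jensen-type step below.\<close>

lemma power_tangent_le:
  fixes a z :: real
  assumes "0 \<le> a" "0 \<le> z" "1 \<le> q"
  shows "a ^ q + q * a ^ (q - 1) * (z - a) \<le> z ^ q"
proof (cases "a = 0")
  case True
  with assms show ?thesis by (cases "q = 1") (auto simp: power_0_left)
next
  case False
  with assms have a: "0 < a" by simp
  have "1 + real q * (z / a - 1) \<le> (1 + (z / a - 1)) ^ q"
    using assms a by (intro Bernoulli_inequality) (simp add: field_simps)
  then have "(1 + real q * (z / a - 1)) * a ^ q \<le> (z / a) ^ q * a ^ q"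
    using a by (intro mult_right_mono) auto
  moreover have "(z / a) ^ q * a ^ q = z ^ q" using a by (simp add: power_divide)
  moreover have "a ^ q = a * a ^ (q - 1)" using assms by (metis One_nat_def Suc_pred less_eq_Suc_le power_Suc)
  then have "(1 + real q * (z / a - 1)) * a ^ q = a ^ q + q * a ^ (q - 1) * (z - a)"
    using a by (simp add: field_simps)
  ultimately show ?thesis by simp
qed

lemma sum_le_of_power_sum_le:
  fixes a :: "'j \<Rightarrow> real" and B :: real
  assumes a: "\<And>j. j \<in> S \<Longrightarrow> 0 \<le> a j" and B: "0 \<le> B" and q: "1 \<le> q"
    and le: "(\<Sum>j\<in>S. a j ^ q) \<le> card S * B ^ q"
  shows "(\<Sum>j\<in>S. a j) \<le> card S * B"
proof (cases "B = 0")
  case True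
  then have "(\<Sum>j\<in>S. a j ^ q) \<le> 0" using le q by (simp add: power_0_left)
  then have "(\<Sum>j\<in>S. a j ^ q) = 0" using a by (intro antisym sum_nonneg) auto
  then have "infinite S \<or> (\<forall>j\<in>S. a j = 0)"
    using a by (cases "finite S") (auto simp: sum_nonneg_eq_0_iff)
  then show ?thesis using True by auto
next
  case False
  with B have "0 < B" by simp
  have "card S * B ^ q + q * B ^ (q - 1) * ((\<Sum>j\<in>S. a j) - card S * B)
      = (\<Sum>j\<in>S. B ^ q + q * B ^ (q - 1) * (a j - B))"
    by (simp add: sum.distrib sum_distrib_left[symmetric] sum_subtractf)
  also have "\<dots> \<le> (\<Sum>j\<in>S. a j ^ q)"
    by (intro sum_mono power_tangent_le a B q)
  finally have "q * B ^ (q - 1) * ((\<Sum>j\<in>S. a j) - card S * B) \<le> 0" using le by simp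
  moreover have "0 < q * B ^ (q - 1)" using \<open>0 < B\<close> q by simp
  ultimately have "(\<Sum>j\<in>S. a j) - card S * B \<le> 0"
    by (meson mult_pos_pos not_le)
  then show ?thesis by simp
qed

text \<open>A sharp form of Stirling's bound for the double factorial \<open>(2p-1)!!\<close>, the
  moment constant of the recursion. It ensures that passing to the moment of order \<open>2p\<close>
  with \<open>p \<ge> ln d\<close> costs no more than the factor \<open>2p + 1\<close>, dimension
  included.\<close>

lemma prod_odd_times_exp_le: "(\<Prod>s<p. real (2 * s + 1)) * exp (real p) \<le> real (2 * p + 1) ^ p"
proof (induction p)
  case (Suc p)
  have "exp 1 \<le> (real (2 * p + 3) / real (2 * p + 1)) ^ Suc p"
  proof -
    have "2 * x \<le> ln ((1 + x) / (1 - x))" if x: "0 \<le> x" "x < 1" for x :: real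
    proof -
      let ?f = "\<lambda>x::real. ln (1 + x) - ln (1 - x) - 2 * x"
      have "?f 0 \<le> ?f x"
      proof (rule DERIV_nonneg_imp_nondecreasing[OF x(1)])
        fix y assume y: "0 \<le> y" "y \<le> x"
        have "(?f has_real_derivative (1 / (1 + y) + 1 / (1 - y) - 2)) (at y)"
          using y x by (auto intro!: derivative_eq_intros)
        moreover have "1 / (1 + y) + 1 / (1 - y) - 2 = 2 * y\<^sup>2 / ((1 + y) * (1 - y))"
          using y x by (simp add: divide_simps) (simp add: algebra_simps power2_eq_square)
        then have "0 \<le> 1 / (1 + y) + 1 / (1 - y) - 2" using y x by simp
        ultimately show "\<exists>z. (?f has_real_derivative z) (at y) \<and> 0 \<le> z" by blast
      qed
      moreover have "ln ((1 + x) / (1 - x)) = ln (1 + x) - ln (1 - x)"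
        using x by (intro ln_divide_pos) auto
      ultimately show ?thesis by simp
    qed
    from this[of "1 / (2 * real p + 2)"]
    have "1 / real (Suc p) \<le> ln ((1 + 1 / (2 * real p + 2)) / (1 - 1 / (2 * real p + 2)))"
      by (simp add: field_simps)
    also have "(1 + 1 / (2 * real p + 2)) / (1 - 1 / (2 * real p + 2))
        = real (2 * p + 3) / real (2 * p + 1)"
      by (simp add: divide_simps)
    finally have "1 \<le> real (Suc p) * ln (real (2 * p + 3) / real (2 * p + 1))"
      by (simp only: pos_divide_le_eq[of "real (Suc p)"] of_nat_0_less_iff mult.commute[of "ln _"])
    then have "exp 1 \<le> exp (real (Suc p) * ln (real (2 * p + 3) / real (2 * p + 1)))" by simp
    then show ?thesis
      by (simp only: exp_of_nat_mult) (simp add: divide_pos_pos)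
  qed
  then have "real (2 * p + 1) ^ Suc p * exp 1
      \<le> real (2 * p + 1) ^ Suc p * (real (2 * p + 3) / real (2 * p + 1)) ^ Suc p"
    by (intro mult_left_mono) auto
  also have "\<dots> = real (2 * p + 3) ^ Suc p"
    by (simp only: power_mult_distrib[symmetric]) simp
  finally have 1: "real (2 * p + 1) ^ Suc p * exp 1 \<le> real (2 * p + 3) ^ Suc p" .
  have "(\<Prod>s<Suc p. real (2 * s + 1)) * exp (real (Suc p))
      = ((\<Prod>s<p. real (2 * s + 1)) * exp (real p)) * (real (2 * p + 1) * exp 1)"
    by (simp add: exp_add)
  also have "\<dots> \<le> real (2 * p + 1) ^ p * (real (2 * p + 1) * exp 1)"
    by (intro mult_right_mono Suc) auto
  also have "\<dots> \<le> real (2 * p + 3) ^ Suc p" using 1 by (simp add: mult_ac)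
  also have "2 * p + 3 = 2 * Suc p + 1" by simp
  finally show ?case .
qed simp

text \<open>The square of the norm is at most a \<open>p\<close>-th root of the trace moment of
  order \<open>2p\<close>; the dimension \<open>d\<close> enters as
  \<open>d\<^bsup>1/p\<^esup>\<close>, which the choice \<open>p = \<lceil>ln d\<rceil>\<close>
  makes bounded.\<close>

lemma matrix_khintchine:
  fixes H :: "'i \<Rightarrow> real^'n^'n"
  assumes I: "finite I" and H: "\<And>i. i \<in> I \<Longrightarrow> transpose (H i) = H i" and n: "2 \<le> CARD('n)"
  shows "(\<Sum>J\<in>Pow I. (op_norm (signed_sum I H J))\<^sup>2)
    \<le> 2 ^ card I * ((1 + 2 * real_of_int \<lceil>ln (real CARD('n))\<rceil>) * op_norm (\<Sum>i\<in>I. H i ** H i))"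
proof -
  define p where "p = nat \<lceil>ln (real CARD('n))\<rceil>"
  let ?V = "op_norm (\<Sum>i\<in>I. H i ** H i)"
  have "0 < ln (real CARD('n))" using n by simp
  then have "1 \<le> \<lceil>ln (real CARD('n))\<rceil>" by linarith
  then have p: "1 \<le> p" "real_of_int \<lceil>ln (real CARD('n))\<rceil> = real p"
    unfolding p_def by linarith+
  have "ln (real CARD('n)) \<le> real p" using p(2) by linarith
  then have card: "real CARD('n) \<le> exp (real p)" using n by (subst ln_le_cancel_iff[symmetric]) auto
  have "(\<Sum>J\<in>Pow I. ((op_norm (signed_sum I H J))\<^sup>2) ^ p)
      \<le> (\<Sum>J\<in>Pow I. (norm (mpow (signed_sum I H J) p))\<^sup>2)"
    by (intro sum_mono)
      (metis op_norm_power_le_norm_mpow transpose_signed_sum[of I H] H op_norm_nonneg power_mono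
        zero_le_power power_mult mult.commute)
  also have "\<dots> \<le> 2 ^ card I * (CARD('n) * (\<Prod>s<p. real (2 * s + 1))) * ?V ^ p"
    by (rule signed_sum_trace_moment[OF I H])
  also have "\<dots> \<le> 2 ^ card I * real (2 * p + 1) ^ p * ?V ^ p"
  proof (intro mult_right_mono mult_left_mono)
    have "CARD('n) * (\<Prod>s<p. real (2 * s + 1)) \<le> exp (real p) * (\<Prod>s<p. real (2 * s + 1))"
      by (intro mult_right_mono card prod_nonneg) auto
    with prod_odd_times_exp_le[of p]
    show "CARD('n) * (\<Prod>s<p. real (2 * s + 1)) \<le> real (2 * p + 1) ^ p" by (simp add: mult.commute)
  qed auto
  finally have "(\<Sum>J\<in>Pow I. ((op_norm (signed_sum I H J))\<^sup>2) ^ p)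
      \<le> card (Pow I) * (real (2 * p + 1) * ?V) ^ p"
    using I by (simp add: card_Pow power_mult_distrib mult_ac)
  \<comment> \<open>the power mean inequality over the \<open>2 ^ card I\<close> sign patterns passes from \<open>p\<close>-th powers to first powers\<close>
  from sum_le_of_power_sum_le[OF _ _ p(1) this]
  show ?thesis using I p(2) by (simp add: card_Pow add.commute)
qed

section \<open>Symmetrization of independent matrix sums\<close>

lemma integrable_op_norm:
  fixes F :: "'a \<Rightarrow> real^'n^'m"
  assumes "integrable M F"
  shows "integrable M (\<lambda>x. op_norm (F x))"
proof (rule Bochner_Integration.integrable_bound[OF assms])
  have [measurable]: "F \<in> borel_measurable M" using assms by simp
  show "(\<lambda>x. op_norm (F x)) \<in> borel_measurable M" by measurable
qed (simp add: op_norm_le_norm)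

lemma integral_matrix_vector_mult:
  fixes F :: "'a \<Rightarrow> real^'n^'m"
  assumes "integrable M F"
  shows "(\<integral>x. F x \<partial>M) *v v = (\<integral>x. F x *v v \<partial>M)" "integrable M (\<lambda>x. F x *v v)"
proof -
  have "bounded_linear (\<lambda>A::real^'n^'m. A *v v)"
  proof (rule bounded_linear_intro)
    fix A :: "real^'n^'m" show "norm (A *v v) \<le> norm A * norm v" by (rule norm_matrix_vector_le)
  qed (auto simp: matrix_vector_mult_add_rdistrib scaleR_matrix_vector_assoc)
  then show "(\<integral>x. F x \<partial>M) *v v = (\<integral>x. F x *v v \<partial>M)" "integrable M (\<lambda>x. F x *v v)"
    using integral_bounded_linear[OF _ assms, of "\<lambda>A. A *v v"]
      integrable_bounded_linear[OF _ assms, of "\<lambda>A. A *v v"] by auto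
qed

lemma op_norm_integral_le:
  fixes F :: "'a \<Rightarrow> real^'n^'m"
  assumes F: "integrable M F"
  shows "op_norm (\<integral>x. F x \<partial>M) \<le> (\<integral>x. op_norm (F x) \<partial>M)"
proof (rule op_norm_least)
  fix v
  have "norm ((\<integral>x. F x \<partial>M) *v v) \<le> (\<integral>x. norm (F x *v v) \<partial>M)"
    unfolding integral_matrix_vector_mult[OF F]
    by (rule integral_norm_bound)
  also have "\<dots> \<le> (\<integral>x. op_norm (F x) * norm v \<partial>M)"
    using F by (intro integral_mono integrable_norm integral_matrix_vector_mult integrable_mult_left
        integrable_op_norm op_norm_works)
  finally show "norm ((\<integral>x. F x \<partial>M) *v v) \<le> (\<integral>x. op_norm (F x) \<partial>M) * norm v" by simp
qed

lemma power_sum_le: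
  fixes a :: "'i \<Rightarrow> real"
  assumes S: "finite S" and a: "\<And>i. i \<in> S \<Longrightarrow> 0 \<le> a i" and q: "1 \<le> q"
  shows "(\<Sum>i\<in>S. a i) ^ q \<le> card S ^ q * (\<Sum>i\<in>S. a i ^ q)"
proof (cases "S = {}")
  case False
  define m where "m = Max (a ` S)"
  have "m \<in> a ` S" unfolding m_def using S False by (intro Max_in) auto
  then obtain i where i: "i \<in> S" "m = a i" by auto
  have "(\<Sum>i\<in>S. a i) \<le> card S * m"
    unfolding m_def using S by (intro sum_bounded_above Max_ge) auto
  then have "(\<Sum>i\<in>S. a i) ^ q \<le> (card S * m) ^ q"
    by (intro power_mono sum_nonneg a)
  also have "\<dots> = card S ^ q * a i ^ q" by (simp add: power_mult_distrib i)
  also have "\<dots> \<le> card S ^ q * (\<Sum>i\<in>S. a i ^ q)"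
    using i S a by (intro mult_left_mono member_le_sum) auto
  finally show ?thesis .
qed (use q in \<open>simp add: power_0_left\<close>)

text \<open>Convexity at the midpoint of \<open>a\<close> and \<open>b\<close>.\<close>

lemma power_add_le:
  fixes a b :: real
  assumes "0 \<le> a" "0 \<le> b" "1 \<le> q"
  shows "2 * (a + b) ^ q \<le> 2 ^ q * (a ^ q + b ^ q)"
proof -
  let ?m = "(a + b) / 2"
  have "?m ^ q + q * ?m ^ (q - 1) * (a - ?m) \<le> a ^ q" "?m ^ q + q * ?m ^ (q - 1) * (b - ?m) \<le> b ^ q"
    by (rule power_tangent_le; use assms in simp)+
  moreover have "q * ?m ^ (q - 1) * (a - ?m) + q * ?m ^ (q - 1) * (b - ?m) = 0"
    by (simp add: distrib_left[symmetric])
  ultimately have "2 * ?m ^ q \<le> a ^ q + b ^ q" by linarith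
  then have "2 ^ q * (2 * ?m ^ q) \<le> 2 ^ q * (a ^ q + b ^ q)" by (intro mult_left_mono) auto
  moreover have "2 ^ q * (2 * ?m ^ q) = 2 * (a + b) ^ q" by (simp add: power_divide)
  ultimately show ?thesis by simp
qed

lemma integrable_op_norm_sum_power:
  fixes W :: "'i \<Rightarrow> 'a \<Rightarrow> real^'n^'m"
  assumes S: "finite S" and q: "1 \<le> q"
    and W [measurable]: "\<And>i. i \<in> S \<Longrightarrow> W i \<in> borel_measurable M"
    and int: "\<And>i. i \<in> S \<Longrightarrow> integrable M (\<lambda>\<omega>. op_norm (W i \<omega>) ^ q)"
  shows "integrable M (\<lambda>\<omega>. op_norm (\<Sum>i\<in>S. W i \<omega>) ^ q)"
proof (rule Bochner_Integration.integrable_bound)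
  show "integrable M (\<lambda>\<omega>. card S ^ q * (\<Sum>i\<in>S. op_norm (W i \<omega>) ^ q))"
    using int by (intro integrable_mult_right Bochner_Integration.integrable_sum)
  show "(\<lambda>\<omega>. op_norm (\<Sum>i\<in>S. W i \<omega>) ^ q) \<in> borel_measurable M" by measurable
  have "op_norm (\<Sum>i\<in>S. W i \<omega>) ^ q \<le> card S ^ q * (\<Sum>i\<in>S. op_norm (W i \<omega>) ^ q)" for \<omega>
  proof -
    have "op_norm (\<Sum>i\<in>S. W i \<omega>) ^ q \<le> (\<Sum>i\<in>S. op_norm (W i \<omega>)) ^ q"
      by (intro power_mono op_norm_sum) simp
    also have "\<dots> \<le> card S ^ q * (\<Sum>i\<in>S. op_norm (W i \<omega>) ^ q)"
      by (intro power_sum_le S q) simp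
    finally show ?thesis .
  qed
  then show "AE \<omega> in M. norm (op_norm (\<Sum>i\<in>S. W i \<omega>) ^ q)
      \<le> norm (card S ^ q * (\<Sum>i\<in>S. op_norm (W i \<omega>) ^ q))"
    by (auto simp: sum_nonneg)
qed

text \<open>Conditionally on \<open>A\<close>, the mean of \<open>A - B\<close> is \<open>A\<close>,
  so the claim is Jensen's inequality in the second variable followed by Fubini's theorem.\<close>

lemma (in prob_space) indep_centred_op_norm_le:
  fixes A B :: "'a \<Rightarrow> real^'n^'m"
  assumes ind: "indep_var borel A borel B"
    and B: "integrable M B" "(\<integral>\<omega>. B \<omega> \<partial>M) = 0" and q: "1 \<le> q"
    and intA: "integrable M (\<lambda>\<omega>. op_norm (A \<omega>) ^ q)"
    and int: "integrable M (\<lambda>\<omega>. op_norm (A \<omega> - B \<omega>) ^ q)"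
  shows "(\<integral>\<omega>. op_norm (A \<omega>) ^ q \<partial>M) \<le> (\<integral>\<omega>. op_norm (A \<omega> - B \<omega>) ^ q \<partial>M)"
proof -
  let ?f = "\<lambda>p::(real^'n^'m) \<times> (real^'n^'m). op_norm (fst p - snd p) ^ q"
  have rv [measurable]: "random_variable borel A" "random_variable borel B"
    and dist: "distr M borel A \<Otimes>\<^sub>M distr M borel B = distr M (borel \<Otimes>\<^sub>M borel) (\<lambda>x. (A x, B x))"
    using ind by (auto simp: indep_var_distribution_eq)
  define \<mu> where "\<mu> = distr M borel A"
  define \<nu> where "\<nu> = distr M borel B"
  interpret \<mu>: prob_space \<mu> unfolding \<mu>_def by (rule prob_space_distr) fact
  interpret \<nu>: prob_space \<nu> unfolding \<nu>_def by (rule prob_space_distr) fact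
  interpret P: pair_sigma_finite \<mu> \<nu> ..
  have sets [measurable_cong, simp]: "sets \<mu> = sets borel" "sets \<nu> = sets borel"
    by (auto simp: \<mu>_def \<nu>_def)
  have f [measurable]: "?f \<in> borel_measurable (borel \<Otimes>\<^sub>M borel)" by measurable
  have dist': "\<mu> \<Otimes>\<^sub>M \<nu> = distr M (borel \<Otimes>\<^sub>M borel) (\<lambda>x. (A x, B x))"
    using dist by (simp add: \<mu>_def \<nu>_def)
  have intf: "integrable (\<mu> \<Otimes>\<^sub>M \<nu>) ?f"
    unfolding dist' using int by (subst integrable_distr_eq) auto
  have int\<nu>: "integrable \<nu> (\<lambda>y. y)" unfolding \<nu>_def using B(1) by (subst integrable_distr_eq) auto
  have mean\<nu>: "(\<integral>y. y \<partial>\<nu>) = 0" unfolding \<nu>_def using B(2) by (subst integral_distr) auto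
  have pt: "op_norm x ^ q \<le> (\<integral>y. ?f (x, y) \<partial>\<nu>)" if intx: "integrable \<nu> (\<lambda>y. ?f (x, y))" for x
  proof -
    let ?a = "op_norm x"
    have d: "integrable \<nu> (\<lambda>y. x - y)" using int\<nu> by simp
    have "(\<integral>y. x - y \<partial>\<nu>) = x"
      using int\<nu> mean\<nu> by (simp add: \<nu>.prob_space)
    then have le: "?a \<le> (\<integral>y. op_norm (x - y) \<partial>\<nu>)" using op_norm_integral_le[OF d] by simp
    have "?a ^ q \<le> ?a ^ q + q * ?a ^ (q - 1) * ((\<integral>y. op_norm (x - y) \<partial>\<nu>) - ?a)"
      using le by simp
    also have "\<dots> = (\<integral>y. ?a ^ q + q * ?a ^ (q - 1) * (op_norm (x - y) - ?a) \<partial>\<nu>)"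
      using integrable_op_norm[OF d] by (simp add: \<nu>.prob_space)
    also have "\<dots> \<le> (\<integral>y. ?f (x, y) \<partial>\<nu>)"
    proof (rule integral_mono)
      show "integrable \<nu> (\<lambda>y. ?a ^ q + q * ?a ^ (q - 1) * (op_norm (x - y) - ?a))"
        using integrable_op_norm[OF d] by simp
      show "?a ^ q + q * ?a ^ (q - 1) * (op_norm (x - y) - ?a) \<le> ?f (x, y)" for y
        unfolding fst_conv snd_conv by (rule power_tangent_le) (use q in simp_all)
    qed (rule intx)
    finally show ?thesis .
  qed
  have "(\<integral>\<omega>. op_norm (A \<omega>) ^ q \<partial>M) = (\<integral>x. op_norm x ^ q \<partial>\<mu>)"
    unfolding \<mu>_def by (subst integral_distr) auto
  also have "\<dots> \<le> (\<integral>x. (\<integral>y. ?f (x, y) \<partial>\<nu>) \<partial>\<mu>)"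
  proof (rule integral_mono_AE)
    show "integrable \<mu> (\<lambda>x. op_norm x ^ q)"
      unfolding \<mu>_def using intA by (subst integrable_distr_eq) auto
    show "integrable \<mu> (\<lambda>x. \<integral>y. ?f (x, y) \<partial>\<nu>)"
      using P.integrable_fst'[OF intf] .
    show "AE x in \<mu>. op_norm x ^ q \<le> (\<integral>y. ?f (x, y) \<partial>\<nu>)"
      using P.AE_integrable_fst'[OF intf] by eventually_elim (rule pt)
  qed
  also have "\<dots> = (\<integral>p. ?f p \<partial>(\<mu> \<Otimes>\<^sub>M \<nu>))" by (rule P.integral_fst'[OF intf])
  also have "\<dots> = (\<integral>\<omega>. op_norm (A \<omega> - B \<omega>) ^ q \<partial>M)"
    unfolding dist' by (subst integral_distr) auto
  finally show ?thesis .
qed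

text \<open>The parts with sign \<open>+1\<close> and \<open>-1\<close> of the sum are independent
  and centred. Each of them is dominated by their difference, which is the signed sum. Jensen's
  inequality then costs a factor 2, for every choice of the signs.\<close>

lemma (in prob_space) symmetrization_fixed_signs:
  fixes W :: "'i \<Rightarrow> 'a \<Rightarrow> real^'n^'m"
  assumes I: "finite I" and ind: "indep_vars (\<lambda>_. borel) W I" and q: "1 \<le> q" and J: "J \<subseteq> I"
    and W: "\<And>i. i \<in> I \<Longrightarrow> integrable M (W i)" "\<And>i. i \<in> I \<Longrightarrow> (\<integral>\<omega>. W i \<omega> \<partial>M) = 0"
    and int: "\<And>i. i \<in> I \<Longrightarrow> integrable M (\<lambda>\<omega>. op_norm (W i \<omega>) ^ q)"
  shows "(\<integral>\<omega>. op_norm (\<Sum>i\<in>I. W i \<omega>) ^ q \<partial>M)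
    \<le> 2 ^ q * (\<integral>\<omega>. op_norm (signed_sum I (\<lambda>i. W i \<omega>) J) ^ q \<partial>M)"
proof -
  let ?A = "\<lambda>\<omega>. \<Sum>i\<in>J. W i \<omega>" and ?B = "\<lambda>\<omega>. \<Sum>i\<in>I-J. W i \<omega>"
  have fin: "finite J" "finite (I - J)" using I J finite_subset by auto
  have indAB: "indep_var borel (\<lambda>\<omega>. \<Sum>i\<in>K. W i \<omega>) borel (\<lambda>\<omega>. \<Sum>i\<in>L. W i \<omega>)"
    if "K \<inter> L = {}" "K \<subseteq> I" "L \<subseteq> I" for K L
  proof -
    have m: "(\<lambda>f. \<Sum>i\<in>S. f i) \<in> borel_measurable (PiM S (\<lambda>_. borel :: (real^'n^'m) measure))" for S :: "'i set"
      by measurable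
    from indep_var_compose[OF indep_var_restrict[OF ind that] m m]
    show ?thesis by (simp add: comp_def cong: sum.cong)
  qed
  have signed: "signed_sum I (\<lambda>i. W i \<omega>) J = ?A \<omega> - ?B \<omega>" for \<omega>
  proof -
    have "signed_sum I (\<lambda>i. W i \<omega>) J = (\<Sum>i\<in>I-J. rsign J i *\<^sub>R W i \<omega>) + (\<Sum>i\<in>J. rsign J i *\<^sub>R W i \<omega>)"
      unfolding signed_sum_def by (rule sum.subset_diff[OF J I])
    also have "(\<Sum>i\<in>I-J. rsign J i *\<^sub>R W i \<omega>) = (\<Sum>i\<in>I-J. - W i \<omega>)"
      by (intro sum.cong refl) (simp add: rsign_def)
    also have "(\<Sum>i\<in>J. rsign J i *\<^sub>R W i \<omega>) = ?A \<omega>"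
      by (intro sum.cong refl) (simp add: rsign_def)
    finally show ?thesis by (simp add: sum_negf)
  qed
  have full: "(\<Sum>i\<in>I. W i \<omega>) = ?A \<omega> + ?B \<omega>" for \<omega>
    unfolding sum.subset_diff[OF J I] by (rule add.commute)
  have meas [measurable]: "W i \<in> borel_measurable M" if "i \<in> I" for i
    using W(1)[OF that] by simp
  have int_sum: "integrable M (\<lambda>\<omega>. op_norm (\<Sum>i\<in>S. W i \<omega>) ^ q)" if "S \<subseteq> I" for S
    using that I q int meas by (intro integrable_op_norm_sum_power) (auto intro: finite_subset)
  have int_signed: "integrable M (\<lambda>\<omega>. op_norm (?A \<omega> - ?B \<omega>) ^ q)"
  proof -
    have "integrable M (\<lambda>\<omega>. op_norm (\<Sum>i\<in>I. rsign J i *\<^sub>R W i \<omega>) ^ q)"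
      using I q int meas
      by (intro integrable_op_norm_sum_power) (auto simp: op_norm_scaleR rsign_def op_norm_minus)
    then show ?thesis by (simp only: signed[symmetric] signed_sum_def)
  qed
  have intS: "integrable M (\<lambda>\<omega>. \<Sum>i\<in>S. W i \<omega>)" "(\<integral>\<omega>. (\<Sum>i\<in>S. W i \<omega>) \<partial>M) = 0" if "S \<subseteq> I" for S
    using that W by (auto simp: subset_iff Bochner_Integration.integral_sum)
  have "2 * (\<integral>\<omega>. op_norm (\<Sum>i\<in>I. W i \<omega>) ^ q \<partial>M) = (\<integral>\<omega>. 2 * op_norm (?A \<omega> + ?B \<omega>) ^ q \<partial>M)"
    by (simp add: full)
  also have "\<dots> \<le> (\<integral>\<omega>. 2 ^ q * (op_norm (?A \<omega>) ^ q + op_norm (?B \<omega>) ^ q) \<partial>M)"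
  proof (rule integral_mono)
    show "integrable M (\<lambda>\<omega>. 2 * op_norm (?A \<omega> + ?B \<omega>) ^ q)"
      using int_sum[of I] by (simp add: full)
    show "integrable M (\<lambda>\<omega>. 2 ^ q * (op_norm (?A \<omega>) ^ q + op_norm (?B \<omega>) ^ q))"
      using int_sum[of J] int_sum[of "I - J"] J by (intro integrable_mult_right) auto
    fix \<omega>
    have "2 * op_norm (?A \<omega> + ?B \<omega>) ^ q \<le> 2 * (op_norm (?A \<omega>) + op_norm (?B \<omega>)) ^ q"
      by (intro mult_left_mono power_mono op_norm_triangle) auto
    also have "\<dots> \<le> 2 ^ q * (op_norm (?A \<omega>) ^ q + op_norm (?B \<omega>) ^ q)"
      by (intro power_add_le q) auto
    finally show "2 * op_norm (?A \<omega> + ?B \<omega>) ^ q \<le> 2 ^ q * (op_norm (?A \<omega>) ^ q + op_norm (?B \<omega>) ^ q)" .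
  qed
  also have "\<dots> = 2 ^ q * ((\<integral>\<omega>. op_norm (?A \<omega>) ^ q \<partial>M) + (\<integral>\<omega>. op_norm (?B \<omega>) ^ q \<partial>M))"
    using int_sum[of J] int_sum[of "I - J"] J by simp
  also have "\<dots> \<le> 2 ^ q * ((\<integral>\<omega>. op_norm (?A \<omega> - ?B \<omega>) ^ q \<partial>M) + (\<integral>\<omega>. op_norm (?A \<omega> - ?B \<omega>) ^ q \<partial>M))"
  proof (intro mult_left_mono add_mono)
    show "(\<integral>\<omega>. op_norm (?A \<omega>) ^ q \<partial>M) \<le> (\<integral>\<omega>. op_norm (?A \<omega> - ?B \<omega>) ^ q \<partial>M)"
      using J by (intro indep_centred_op_norm_le indAB intS int_sum int_signed q) auto
    have sw: "op_norm (?A \<omega> - ?B \<omega>) = op_norm (?B \<omega> - ?A \<omega>)" for \<omega>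
      using op_norm_minus[of "?A \<omega> - ?B \<omega>"] by simp
    show "(\<integral>\<omega>. op_norm (?B \<omega>) ^ q \<partial>M) \<le> (\<integral>\<omega>. op_norm (?A \<omega> - ?B \<omega>) ^ q \<partial>M)"
      unfolding sw
      using J int_signed[unfolded sw] by (intro indep_centred_op_norm_le indAB intS int_sum q) auto
  qed simp
  finally show ?thesis by (simp add: signed)
qed

lemma (in prob_space) symmetrization:
  fixes W :: "'i \<Rightarrow> 'a \<Rightarrow> real^'n^'m"
  assumes I: "finite I" and ind: "indep_vars (\<lambda>_. borel) W I" and q: "1 \<le> q"
    and W: "\<And>i. i \<in> I \<Longrightarrow> integrable M (W i)" "\<And>i. i \<in> I \<Longrightarrow> (\<integral>\<omega>. W i \<omega> \<partial>M) = 0"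
    and int: "\<And>i. i \<in> I \<Longrightarrow> integrable M (\<lambda>\<omega>. op_norm (W i \<omega>) ^ q)"
    and F: "integrable M F"
      "\<And>\<omega>. \<omega> \<in> space M \<Longrightarrow> (\<Sum>J\<in>Pow I. op_norm (signed_sum I (\<lambda>i. W i \<omega>) J) ^ q) \<le> 2 ^ card I * F \<omega>"
  shows "(\<integral>\<omega>. op_norm (\<Sum>i\<in>I. W i \<omega>) ^ q \<partial>M) \<le> 2 ^ q * (\<integral>\<omega>. F \<omega> \<partial>M)"
proof -
  let ?L = "\<integral>\<omega>. op_norm (\<Sum>i\<in>I. W i \<omega>) ^ q \<partial>M"
  have meas: "W i \<in> borel_measurable M" if "i \<in> I" for i using W(1)[OF that] by simp
  have int_signed: "integrable M (\<lambda>\<omega>. op_norm (signed_sum I (\<lambda>i. W i \<omega>) J) ^ q)" for J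
    unfolding signed_sum_def using I q int meas
    by (intro integrable_op_norm_sum_power) (auto simp: op_norm_scaleR rsign_def op_norm_minus)
  have "2 ^ card I * ?L = (\<Sum>J\<in>Pow I. ?L)" using I by (simp add: card_Pow)
  also have "\<dots> \<le> (\<Sum>J\<in>Pow I. 2 ^ q * (\<integral>\<omega>. op_norm (signed_sum I (\<lambda>i. W i \<omega>) J) ^ q \<partial>M))"
    using assms by (intro sum_mono symmetrization_fixed_signs) auto
  also have "\<dots> = 2 ^ q * (\<integral>\<omega>. (\<Sum>J\<in>Pow I. op_norm (signed_sum I (\<lambda>i. W i \<omega>) J) ^ q) \<partial>M)"
    using int_signed by (simp add: sum_distrib_left Bochner_Integration.integral_sum)
  also have "\<dots> \<le> 2 ^ q * (\<integral>\<omega>. 2 ^ card I * F \<omega> \<partial>M)"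
    using int_signed F by (intro mult_left_mono integral_mono Bochner_Integration.integrable_sum) auto
  finally have "2 ^ card I * ?L \<le> 2 ^ card I * (2 ^ q * (\<integral>\<omega>. F \<omega> \<partial>M))" by (simp add: mult_ac)
  then show ?thesis by (rule mult_left_le_imp_le) simp
qed

section \<open>The second moment of the norm of an independent sum\<close>

lemma transpose_square: "transpose A = A \<Longrightarrow> transpose (A ** A) = A ** A" for A :: "real^'n^'n"
  by (simp add: matrix_transpose_mul)

lemma inner_sum_squares:
  fixes B :: "'i \<Rightarrow> real^'n^'n"
  assumes "\<And>i. i \<in> I \<Longrightarrow> transpose (B i) = B i"
  shows "w \<bullet> ((\<Sum>i\<in>I. B i ** B i) *v v) = (\<Sum>i\<in>I. (B i *v w) \<bullet> (B i *v v))"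
proof -
  have "w \<bullet> ((B i ** B i) *v v) = (B i *v w) \<bullet> (B i *v v)" if "i \<in> I" for i
    using inner_symmetric[OF assms[OF that], of w "B i *v v"] by (simp add: matrix_vector_mul_assoc)
  then show ?thesis by (simp add: sum_matrix_vector_mult inner_sum_right)
qed

text \<open>For the semidefinite matrix \<open>S = \<Sum> B\<^sub>i\<^sup>2\<close> the bilinear
  form is controlled by the quadratic form, through \<open>2 \<langle>w, S v\<rangle> \<le>
  \<langle>w, S w\<rangle> + \<langle>v, S v\<rangle>\<close>.\<close>

lemma op_norm_sum_squares_le:
  fixes B :: "'i \<Rightarrow> real^'n^'n"
  assumes B: "\<And>i. i \<in> I \<Longrightarrow> transpose (B i) = B i"
    and le: "\<And>v. (\<Sum>i\<in>I. (norm (B i *v v))\<^sup>2) \<le> c * (norm v)\<^sup>2"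
  shows "op_norm (\<Sum>i\<in>I. B i ** B i) \<le> c"
proof (rule op_norm_least)
  fix x :: "real^'n"
  let ?S = "\<Sum>i\<in>I. B i ** B i"
  have "w \<bullet> (?S *v v) \<le> c" if "norm v = 1" "norm w = 1" for v w
  proof -
    have "2 * (w \<bullet> (?S *v v)) = (\<Sum>i\<in>I. 2 * ((B i *v w) \<bullet> (B i *v v)))"
      by (simp add: inner_sum_squares[OF B] sum_distrib_left)
    also have "\<dots> \<le> (\<Sum>i\<in>I. (norm (B i *v w))\<^sup>2 + (norm (B i *v v))\<^sup>2)"
    proof (rule sum_mono)
      fix i
      have "0 \<le> (norm (B i *v w - B i *v v))\<^sup>2" by simp
      then show "2 * ((B i *v w) \<bullet> (B i *v v)) \<le> (norm (B i *v w))\<^sup>2 + (norm (B i *v v))\<^sup>2"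
        by (simp only: power2_norm_eq_inner inner_diff_left inner_diff_right)
          (simp add: inner_commute)
    qed
    also have "\<dots> \<le> 2 * c" using le[of w] le[of v] that by (simp add: sum.distrib)
    finally show ?thesis by simp
  qed
  note unit = this
  show "norm (?S *v x) \<le> c * norm x"
  proof (cases "x = 0 \<or> ?S *v x = 0")
    case True
    have "0 \<le> c * (norm x)\<^sup>2" using order_trans[OF _ le[of x]] by (simp add: sum_nonneg)
    then have "0 \<le> c * norm x" by (cases "x = 0") (auto simp: zero_le_mult_iff)
    with True show ?thesis by auto
  next
    case False
    let ?y = "?S *v x"
    have "(?y /\<^sub>R norm ?y) \<bullet> (?S *v (x /\<^sub>R norm x)) \<le> c"
      using False by (intro unit) auto
    moreover have "(?y /\<^sub>R norm ?y) \<bullet> (?S *v (x /\<^sub>R norm x)) = norm ?y / norm x"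
      using False by (simp add: matrix_vector_mult_scaleR power2_norm_eq_inner[symmetric] power2_eq_square divide_inverse)
    ultimately show ?thesis using False by (simp add: field_simps)
  qed
qed

lemma op_norm_sum_fourth_powers_le:
  fixes Y :: "'i \<Rightarrow> real^'n^'n"
  assumes Y: "\<And>i. i \<in> I \<Longrightarrow> transpose (Y i) = Y i" and m: "\<And>i. i \<in> I \<Longrightarrow> (op_norm (Y i))\<^sup>2 \<le> m"
  shows "op_norm (\<Sum>i\<in>I. (Y i ** Y i) ** (Y i ** Y i)) \<le> m * op_norm (\<Sum>i\<in>I. Y i ** Y i)"
proof (cases "I = {}")
  case False
  then have m0: "0 \<le> m" using m by (meson all_not_in_conv order_trans zero_le_power2)
  show ?thesis
  proof (rule op_norm_sum_squares_le)
    fix v :: "real^'n"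
    have "(\<Sum>i\<in>I. (norm ((Y i ** Y i) *v v))\<^sup>2) \<le> (\<Sum>i\<in>I. m * (norm (Y i *v v))\<^sup>2)"
    proof (rule sum_mono)
      fix i assume i: "i \<in> I"
      have "(norm ((Y i ** Y i) *v v))\<^sup>2 \<le> (op_norm (Y i) * norm (Y i *v v))\<^sup>2"
        using op_norm_works[of "Y i" "Y i *v v"] by (intro power_mono) (auto simp: matrix_vector_mul_assoc)
      also have "\<dots> \<le> m * (norm (Y i *v v))\<^sup>2"
        using m[OF i] by (simp add: power_mult_distrib mult_right_mono)
      finally show "(norm ((Y i ** Y i) *v v))\<^sup>2 \<le> m * (norm (Y i *v v))\<^sup>2" .
    qed
    also have "\<dots> = m * (v \<bullet> ((\<Sum>i\<in>I. Y i ** Y i) *v v))"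
      by (simp add: inner_sum_squares[OF Y] sum_distrib_left power2_norm_eq_inner)
    also have "\<dots> \<le> m * (op_norm (\<Sum>i\<in>I. Y i ** Y i) * (norm v)\<^sup>2)"
      using m0 abs_inner_op_norm[of v "\<Sum>i\<in>I. Y i ** Y i"] by (intro mult_left_mono) auto
    finally show "(\<Sum>i\<in>I. (norm ((Y i ** Y i) *v v))\<^sup>2) \<le> m * op_norm (\<Sum>i\<in>I. Y i ** Y i) * (norm v)\<^sup>2"
      by (simp add: mult.assoc)
  qed (use Y transpose_square in blast)
qed simp

text \<open>The trace moment of order two for the one-dimensional matrices \<open>H\<^sub>i =
  1\<close>, followed by Cauchy-Schwarz over the signs.\<close>

lemma sum_abs_signs_le:
  assumes "finite I"
  shows "(\<Sum>J\<in>Pow I. \<bar>\<Sum>i\<in>I. rsign J i\<bar>) \<le> 2 ^ card I * sqrt (card I)"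
proof -
  have s: "(norm (mpow (signed_sum I (\<lambda>_. mat 1 :: real^1^1) J) 1))\<^sup>2 = \<bar>\<Sum>i\<in>I. rsign J i\<bar> ^ 2" for J
  proof -
    have "signed_sum I (\<lambda>_. mat 1 :: real^1^1) J = (\<Sum>i\<in>I. rsign J i) *\<^sub>R mat 1"
      by (simp add: signed_sum_def scaleR_sum_left)
    then show ?thesis by (simp add: power_mult_distrib norm_mat_1)
  qed
  have V: "op_norm (\<Sum>i\<in>I. mat 1 ** mat 1 :: real^1^1) \<le> card I"
  proof -
    have "op_norm (mat 1 :: real^1^1) \<le> 1" by (rule op_norm_least) simp
    then have "(\<Sum>i\<in>I. op_norm (mat 1 ** mat 1 :: real^1^1)) \<le> card I"
      using mult_left_mono[of "op_norm (mat 1 :: real^1^1)" 1 "card I"] by simp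
    then show ?thesis using op_norm_sum[of "\<lambda>_. mat 1 ** mat 1 :: real^1^1" I] by linarith
  qed
  have "(\<Sum>J\<in>Pow I. \<bar>\<Sum>i\<in>I. rsign J i\<bar> ^ 2) \<le> 2 ^ card I * op_norm (\<Sum>i\<in>I. mat 1 ** mat 1 :: real^1^1)"
    using signed_sum_trace_moment[OF assms, of "\<lambda>_. mat 1 :: real^1^1" 1] by (simp only: s) simp
  also have "\<dots> \<le> 2 ^ card I * real (card I)" using V by (intro mult_left_mono) auto
  finally have "(\<Sum>J\<in>Pow I. \<bar>\<Sum>i\<in>I. rsign J i\<bar> ^ 2) \<le> card (Pow I) * (sqrt (card I)) ^ 2"
    using assms by (simp add: card_Pow)
  from sum_le_of_power_sum_le[OF _ _ _ this]
  show ?thesis using assms by (simp add: card_Pow)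
qed

text \<open>Let \<open>T\<^sub>i = Y\<^sub>i\<^sup>2\<close>, with mean \<open>S\<close>.
  Symmetrization and Khintchine bound the left-hand side by \<open>C E \<parallel>\<Sum>
  T\<^sub>i\<parallel>\<close>. Next \<open>\<Sum> T\<^sub>i\<close> is compared with its mean
  \<open>n S\<close>: symmetrization and Khintchine applied to \<open>T\<^sub>i - S\<close> give a
  deviation of order \<open>(C m \<parallel>\<Sum> T\<^sub>i\<parallel>)\<^bsup>1/2\<^esup>\<close>,
  because \<open>\<Sum> T\<^sub>i\<^sup>2\<close> has norm at most \<open>m \<parallel>\<Sum>
  T\<^sub>i\<parallel>\<close> with \<open>m = max \<parallel>Y\<^sub>i\<parallel>\<^sup>2\<close>.
  A fraction of \<open>\<parallel>\<Sum> T\<^sub>i\<parallel>\<close> is absorbed into the left-hand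
  side. The signed mean \<open>\<Sum> \<epsilon>\<^sub>i S\<close> is of size \<open>\<surd>n
  \<parallel>S\<parallel>\<close>, at most a third of \<open>n \<parallel>S\<parallel>\<close> when
  \<open>n \<ge> 9\<close>.\<close>

lemma (in prob_space) expected_op_norm_sq_sum_le:
  fixes Y :: "'i \<Rightarrow> 'a \<Rightarrow> real^'n^'n" and S :: "real^'n^'n"
  defines "C \<equiv> c_dim CARD('n)"
  assumes I: "finite I" "9 \<le> card I" and d: "2 \<le> CARD('n)"
    and ind: "indep_vars (\<lambda>_. borel) Y I"
    and sym: "\<And>i \<omega>. i \<in> I \<Longrightarrow> transpose (Y i \<omega>) = Y i \<omega>"
    and int: "\<And>i. i \<in> I \<Longrightarrow> integrable M (Y i)" and mean: "\<And>i. i \<in> I \<Longrightarrow> (\<integral>\<omega>. Y i \<omega> \<partial>M) = 0"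
    and int2: "\<And>i. i \<in> I \<Longrightarrow> integrable M (\<lambda>\<omega>. Y i \<omega> ** Y i \<omega>)"
    and int_op: "\<And>i. i \<in> I \<Longrightarrow> integrable M (\<lambda>\<omega>. (op_norm (Y i \<omega>))\<^sup>2)"
    and S: "\<And>i. i \<in> I \<Longrightarrow> (\<integral>\<omega>. Y i \<omega> ** Y i \<omega> \<partial>M) = S"
  shows "(\<integral>\<omega>. (op_norm (\<Sum>i\<in>I. Y i \<omega>))\<^sup>2 \<partial>M)
    \<le> 8 / 3 * (C * (card I * op_norm S) + C\<^sup>2 * (\<integral>\<omega>. (MAX i\<in>I. (op_norm (Y i \<omega>))\<^sup>2) \<partial>M))"
proof -
  define m where "m \<omega> = (MAX i\<in>I. (op_norm (Y i \<omega>))\<^sup>2)" for \<omega>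
  define t where "t \<omega> = op_norm (\<Sum>i\<in>I. Y i \<omega> ** Y i \<omega>)" for \<omega>
  define K where "K = 1 + 2 * real_of_int \<lceil>ln (real CARD('n))\<rceil>"
  have C: "C = 4 * K" by (simp add: C_def c_dim_def K_def)
  have K: "1 \<le> K"
  proof -
    have "0 \<le> ln (real CARD('n))" using d by simp
    then have "0 \<le> \<lceil>ln (real CARD('n))\<rceil>" by linarith
    then show ?thesis by (simp add: K_def)
  qed
  have ne: "I \<noteq> {}" using I by auto
  have [measurable]: "Y i \<in> borel_measurable M" if "i \<in> I" for i using int[OF that] by simp
  have m_ge: "(op_norm (Y i \<omega>))\<^sup>2 \<le> m \<omega>" if "i \<in> I" for i \<omega>
    unfolding m_def using I that by (intro Max_ge) auto
  have m0: "0 \<le> m \<omega>" for \<omega> using m_ge ne by (meson all_not_in_conv order_trans zero_le_power2)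
  have t0: "0 \<le> t \<omega>" for \<omega> by (simp add: t_def)
  have int_m: "integrable M m"
  proof (rule Bochner_Integration.integrable_bound)
    show "integrable M (\<lambda>\<omega>. \<Sum>i\<in>I. (op_norm (Y i \<omega>))\<^sup>2)"
      using int_op by (intro Bochner_Integration.integrable_sum)
    show "m \<in> borel_measurable M"
      unfolding m_def using I by (intro borel_measurable_Max) measurable
    have "m \<omega> \<le> (\<Sum>i\<in>I. (op_norm (Y i \<omega>))\<^sup>2)" for \<omega>
      unfolding m_def using I ne by (subst Max_le_iff) (auto intro!: member_le_sum)
    then show "AE \<omega> in M. norm (m \<omega>) \<le> norm (\<Sum>i\<in>I. (op_norm (Y i \<omega>))\<^sup>2)"
      by (auto simp: m0 sum_nonneg)
  qed
  have int_t: "integrable M t"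
    unfolding t_def using int2 by (intro integrable_op_norm Bochner_Integration.integrable_sum)
  have khin: "(\<Sum>J\<in>Pow I. (op_norm (signed_sum I H J))\<^sup>2) \<le> 2 ^ card I * (K * op_norm (\<Sum>i\<in>I. H i ** H i))"
    if "\<And>i. i \<in> I \<Longrightarrow> transpose (H i) = H i" for H :: "'i \<Rightarrow> real^'n^'n"
    unfolding K_def by (rule matrix_khintchine[OF I(1) that d])
  have first: "(\<integral>\<omega>. (op_norm (\<Sum>i\<in>I. Y i \<omega>))\<^sup>2 \<partial>M) \<le> C * (\<integral>\<omega>. t \<omega> \<partial>M)"
  proof -
    have "(\<integral>\<omega>. (op_norm (\<Sum>i\<in>I. Y i \<omega>))\<^sup>2 \<partial>M) \<le> 2 ^ 2 * (\<integral>\<omega>. K * t \<omega> \<partial>M)"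
    proof (rule symmetrization)
      show "integrable M (\<lambda>\<omega>. K * t \<omega>)" using int_t by simp
      show "(\<Sum>J\<in>Pow I. (op_norm (signed_sum I (\<lambda>i. Y i \<omega>) J))\<^sup>2) \<le> 2 ^ card I * (K * t \<omega>)" for \<omega>
        unfolding t_def by (rule khin) (rule sym)
    qed (use I ind int mean int_op in auto)
    then show ?thesis by (simp add: C)
  qed
  define T where "T i \<omega> = Y i \<omega> ** Y i \<omega> - S" for i \<omega>
  define F where "F \<omega> = (3 / 8 * t \<omega> + 2 / 3 * C * m \<omega>) / 2 + op_norm S * (card I / 3)" for \<omega>
  have signed_T: "(\<Sum>J\<in>Pow I. op_norm (signed_sum I (\<lambda>i. T i \<omega>) J)) \<le> 2 ^ card I * F \<omega>" for \<omega>
  proof -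
    let ?H = "\<lambda>i. Y i \<omega> ** Y i \<omega>"
    let ?b = "(3 / 8 * t \<omega> + 2 / 3 * C * m \<omega>) / 2"
    have "signed_sum I (\<lambda>i. T i \<omega>) J = signed_sum I ?H J - (\<Sum>i\<in>I. rsign J i) *\<^sub>R S" for J
      by (simp add: signed_sum_def T_def scaleR_diff_right sum_subtractf scaleR_sum_left)
    then have "op_norm (signed_sum I (\<lambda>i. T i \<omega>) J)
        \<le> op_norm (signed_sum I ?H J) + \<bar>\<Sum>i\<in>I. rsign J i\<bar> * op_norm S" for J
      using op_norm_diff[of "signed_sum I ?H J" "(\<Sum>i\<in>I. rsign J i) *\<^sub>R S"] by (simp add: op_norm_scaleR)
    then have "(\<Sum>J\<in>Pow I. op_norm (signed_sum I (\<lambda>i. T i \<omega>) J))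
        \<le> (\<Sum>J\<in>Pow I. op_norm (signed_sum I ?H J)) + (\<Sum>J\<in>Pow I. \<bar>\<Sum>i\<in>I. rsign J i\<bar>) * op_norm S"
      unfolding sum_distrib_right sum.distrib[symmetric] by (intro sum_mono)
    moreover have "(\<Sum>J\<in>Pow I. op_norm (signed_sum I ?H J)) \<le> card (Pow I) * ?b"
    proof (rule sum_le_of_power_sum_le)
      have "(\<Sum>J\<in>Pow I. (op_norm (signed_sum I ?H J))\<^sup>2) \<le> 2 ^ card I * (K * op_norm (\<Sum>i\<in>I. ?H i ** ?H i))"
        using sym by (intro khin transpose_square)
      also have "\<dots> \<le> 2 ^ card I * (K * (m \<omega> * t \<omega>))"
        unfolding t_def using K sym m_ge by (intro mult_left_mono op_norm_sum_fourth_powers_le) auto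
      also have "\<dots> \<le> 2 ^ card I * ?b\<^sup>2"
      proof (intro mult_left_mono)
        \<comment> \<open>arithmetic-geometric mean: \<open>C m t \<le> (3/8 t + 2/3 C m)\<^sup>2\<close> because \<open>4 (3/8) (2/3) = 1\<close>\<close>
        have "0 \<le> (3 / 8 * t \<omega> - 2 / 3 * C * m \<omega>)\<^sup>2" by simp
        then show "K * (m \<omega> * t \<omega>) \<le> ?b\<^sup>2" by (simp add: C power2_eq_square algebra_simps)
      qed simp
      finally show "(\<Sum>J\<in>Pow I. (op_norm (signed_sum I ?H J))\<^sup>2) \<le> card (Pow I) * ?b\<^sup>2"
        using I by (simp add: card_Pow)
      show "0 \<le> ?b" using m0[of \<omega>] t0[of \<omega>] K by (simp add: C)
    qed auto
    moreover have "(\<Sum>J\<in>Pow I. \<bar>\<Sum>i\<in>I. rsign J i\<bar>) * op_norm S \<le> 2 ^ card I * (card I / 3) * op_norm S"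
    proof (intro mult_right_mono)
      have "3 \<le> sqrt (card I)" using I(2) by (intro real_le_rsqrt) simp
      then have "3 * sqrt (card I) \<le> sqrt (card I) * sqrt (card I)" by (intro mult_right_mono) auto
      then have "sqrt (card I) \<le> card I / 3" by simp
      then have "2 ^ card I * sqrt (card I) \<le> 2 ^ card I * (card I / 3)" by (intro mult_left_mono) auto
      with sum_abs_signs_le[OF I(1)]
      show "(\<Sum>J\<in>Pow I. \<bar>\<Sum>i\<in>I. rsign J i\<bar>) \<le> 2 ^ card I * (card I / 3)" by linarith
    qed simp
    ultimately have "(\<Sum>J\<in>Pow I. op_norm (signed_sum I (\<lambda>i. T i \<omega>) J))
        \<le> 2 ^ card I * ?b + 2 ^ card I * (card I / 3) * op_norm S"
      using I by (simp only: card_Pow of_nat_power of_nat_numeral)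
    then show ?thesis by (simp only: F_def distrib_left mult_ac)
  qed
  have int_T: "integrable M (T i)" if "i \<in> I" for i
    unfolding T_def using int2[OF that] by simp
  have int_F: "integrable M F" unfolding F_def using int_t int_m by simp
  have "(\<integral>\<omega>. op_norm (\<Sum>i\<in>I. T i \<omega>) ^ 1 \<partial>M) \<le> 2 ^ 1 * (\<integral>\<omega>. F \<omega> \<partial>M)"
  proof (rule symmetrization)
    have "(\<lambda>A::real^'n^'n. A ** A - S) \<in> borel_measurable borel"
    proof (intro borel_measurable_continuous_onI)
      show "continuous_on UNIV (\<lambda>A::real^'n^'n. A ** A - S)"
        by (intro continuous_on_diff continuous_on_const continuous_on_matrix_square)
    qed
    from indep_vars_compose2[OF ind this] show "indep_vars (\<lambda>_. borel) T I"
      by (simp add: T_def[abs_def])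
    show "(\<integral>\<omega>. T i \<omega> \<partial>M) = 0" if "i \<in> I" for i
      unfolding T_def using int2[OF that] S[OF that] by (simp add: prob_space)
    show "integrable M (\<lambda>\<omega>. op_norm (T i \<omega>) ^ 1)" if "i \<in> I" for i
      using integrable_op_norm[OF int_T[OF that]] by simp
    show "(\<Sum>J\<in>Pow I. op_norm (signed_sum I (\<lambda>i. T i \<omega>) J) ^ 1) \<le> 2 ^ card I * F \<omega>" for \<omega>
      using signed_T by simp
  qed (use I int_T int_F in auto)
  then have sumT: "(\<integral>\<omega>. op_norm (\<Sum>i\<in>I. T i \<omega>) \<partial>M) \<le> 2 * (\<integral>\<omega>. F \<omega> \<partial>M)" by simp
  have "(\<integral>\<omega>. t \<omega> \<partial>M) \<le> (\<integral>\<omega>. op_norm (\<Sum>i\<in>I. T i \<omega>) + card I * op_norm S \<partial>M)"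
  proof (rule integral_mono)
    show "integrable M (\<lambda>\<omega>. op_norm (\<Sum>i\<in>I. T i \<omega>) + card I * op_norm S)"
      using int_T by (intro Bochner_Integration.integrable_add integrable_op_norm Bochner_Integration.integrable_sum) auto
    fix \<omega>
    have "(\<Sum>i\<in>I. Y i \<omega> ** Y i \<omega>) = (\<Sum>i\<in>I. T i \<omega>) + real (card I) *\<^sub>R S"
      by (simp only: T_def sum_subtractf sum_constant_scaleR) simp
    then show "t \<omega> \<le> op_norm (\<Sum>i\<in>I. T i \<omega>) + card I * op_norm S"
      unfolding t_def using op_norm_triangle[of "\<Sum>i\<in>I. T i \<omega>" "real (card I) *\<^sub>R S"]
      by (simp add: op_norm_scaleR)
  qed (rule int_t)
  also have "\<dots> = (\<integral>\<omega>. op_norm (\<Sum>i\<in>I. T i \<omega>) \<partial>M) + card I * op_norm S"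
    using int_T by (subst Bochner_Integration.integral_add)
      (auto intro!: integrable_op_norm Bochner_Integration.integrable_sum simp: prob_space)
  also have "\<dots> \<le> 2 * (\<integral>\<omega>. F \<omega> \<partial>M) + card I * op_norm S" using sumT by simp
  also have "(\<integral>\<omega>. F \<omega> \<partial>M) = 3 / 16 * (\<integral>\<omega>. t \<omega> \<partial>M) + C / 3 * (\<integral>\<omega>. m \<omega> \<partial>M) + op_norm S * (card I / 3)"
    unfolding F_def using int_t int_m by (simp add: prob_space add_divide_distrib)
  \<comment> \<open>solve \<open>E t \<le> 3/8 E t + \<dots>\<close> for \<open>E t\<close>\<close>
  finally have "(\<integral>\<omega>. t \<omega> \<partial>M) \<le> 8 / 3 * (card I * op_norm S) + 16 / 15 * (C * (\<integral>\<omega>. m \<omega> \<partial>M))"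
    by (simp add: algebra_simps)
  moreover have "0 \<le> C * (\<integral>\<omega>. m \<omega> \<partial>M)"
    using K m0 by (simp add: C integral_nonneg_AE)
  ultimately have "(\<integral>\<omega>. t \<omega> \<partial>M) \<le> 8 / 3 * (card I * op_norm S + C * (\<integral>\<omega>. m \<omega> \<partial>M))"
    by (simp add: algebra_simps)
  then have "C * (\<integral>\<omega>. t \<omega> \<partial>M) \<le> C * (8 / 3 * (card I * op_norm S + C * (\<integral>\<omega>. m \<omega> \<partial>M)))"
    using K by (intro mult_left_mono) (auto simp: C)
  with first show ?thesis
    unfolding m_def by (simp add: algebra_simps power2_eq_square)
qed

section \<open>Perturbation of the leading eigenspace\<close>

definition orthonormal_frame :: "(nat \<Rightarrow> real^'d) \<Rightarrow> bool" where
  "orthonormal_frame u \<longleftrightarrow>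
    (\<forall>i\<in>{1..CARD('d)}. \<forall>j\<in>{1..CARD('d)}. u i \<bullet> u j = (if i = j then 1 else 0))"

lemma orthonormal_frameD:
  fixes u :: "nat \<Rightarrow> real^'d"
  assumes "orthonormal_frame u" "i \<in> {1..CARD('d)}" "j \<in> {1..CARD('d)}"
  shows "u i \<bullet> u j = (if i = j then 1 else 0)"
  using assms by (auto simp: orthonormal_frame_def)

lemma orthonormal_frame_expand:
  fixes u :: "nat \<Rightarrow> real^'d"
  assumes u: "orthonormal_frame u"
  shows "(\<Sum>a\<in>{1..CARD('d)}. (u a \<bullet> x) *\<^sub>R u a) = x"
proof -
  let ?I = "{1..CARD('d)}"
  have norm1: "norm (u a) = 1" if "a \<in> ?I" for a
    using orthonormal_frameD[OF u that that] by (simp add: norm_eq_1)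
  have inj: "inj_on u ?I"
  proof (rule inj_onI, rule ccontr)
    fix a b assume *: "a \<in> ?I" "b \<in> ?I" "u a = u b" "a \<noteq> b"
    have "u a \<bullet> u b = 0" using orthonormal_frameD[OF u *(1,2)] *(4) by simp
    moreover have "u a \<bullet> u a = 1" using orthonormal_frameD[OF u *(1,1)] by simp
    ultimately show False using *(3) by simp
  qed
  have orth: "pairwise orthogonal (u ` ?I)"
    using orthonormal_frameD[OF u] unfolding pairwise_def orthogonal_def by fastforce
  moreover have "0 \<notin> u ` ?I" using norm1 by (metis imageE norm_zero zero_neq_one)
  ultimately have indep: "independent (u ` ?I)"
    by (intro pairwise_orthogonal_independent)
  have "card (u ` ?I) = DIM(real^'d)" using inj by (simp add: card_image)
  then have "span (u ` ?I) = UNIV"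
    using indep dim_eq_full[of "u ` ?I"] by (simp add: dim_eq_card_independent)
  then have "(\<Sum>b\<in>u ` ?I. (x \<bullet> b) *\<^sub>R b) = x"
    using norm1 by (intro orthonormal_basis_expand[OF orth]) auto
  then show ?thesis using inj by (simp add: sum.reindex inner_commute)
qed

lemma orthonormal_frame_inner:
  fixes u :: "nat \<Rightarrow> real^'d"
  assumes u: "orthonormal_frame u"
  shows "x \<bullet> y = (\<Sum>a\<in>{1..CARD('d)}. (u a \<bullet> x) * (u a \<bullet> y))"
proof -
  have "x \<bullet> y = (\<Sum>a\<in>{1..CARD('d)}. (u a \<bullet> x) *\<^sub>R u a) \<bullet> y"
    by (simp only: orthonormal_frame_expand[OF u])
  then show ?thesis by (simp add: inner_sum_left)
qed

lemma ordered_eigenbasis_frame: "ordered_eigenbasis A lam u \<Longrightarrow> orthonormal_frame u"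
  by (simp add: ordered_eigenbasis_def orthonormal_frame_def)

lemma ordered_eigenbasis_antimono:
  fixes A :: "real^'d^'d"
  shows "ordered_eigenbasis A lam u \<Longrightarrow> 1 \<le> i \<Longrightarrow> i \<le> j \<Longrightarrow> j \<le> CARD('d) \<Longrightarrow> lam j \<le> lam i"
  by (simp add: ordered_eigenbasis_def)

lemma ordered_eigenbasis_bilinear:
  fixes A :: "real^'d^'d"
  assumes eig: "ordered_eigenbasis A lam u"
  shows "x \<bullet> (A *v y) = (\<Sum>a\<in>{1..CARD('d)}. lam a * (u a \<bullet> x) * (u a \<bullet> y))"
proof -
  note u = ordered_eigenbasis_frame[OF eig]
  have "A *v y = A *v (\<Sum>a\<in>{1..CARD('d)}. (u a \<bullet> y) *\<^sub>R u a)"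
    by (simp only: orthonormal_frame_expand[OF u])
  also have "\<dots> = (\<Sum>a\<in>{1..CARD('d)}. (u a \<bullet> y) *\<^sub>R (A *v u a))"
    by (simp add: matrix_vector_mult_scaleR linear_sum[OF matrix_vector_mul_linear])
  also have "\<dots> = (\<Sum>a\<in>{1..CARD('d)}. (u a \<bullet> y) *\<^sub>R (lam a *\<^sub>R u a))"
    using eig by (intro sum.cong) (auto simp: ordered_eigenbasis_def)
  finally show ?thesis
    by (simp add: inner_sum_right mult_ac inner_commute)
qed

text \<open>The squared length of the projection of \<open>x\<close> onto the span of \<open>v 1,
  \<dots>, v k\<close>, when these are orthonormal.\<close>

definition captured :: "nat \<Rightarrow> (nat \<Rightarrow> real^'d) \<Rightarrow> real^'d \<Rightarrow> real" where
  "captured k v x = (\<Sum>j\<in>{1..k}. (x \<bullet> v j)\<^sup>2)"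

lemma captured_nonneg: "0 \<le> captured k v x"
  by (simp add: captured_def sum_nonneg)

lemma captured_le_1:
  fixes u v :: "nat \<Rightarrow> real^'d"
  assumes "orthonormal_frame u" "orthonormal_frame v" "k \<le> CARD('d)" "a \<in> {1..CARD('d)}"
  shows "captured k v (u a) \<le> 1"
proof -
  have "captured k v (u a) \<le> (\<Sum>j\<in>{1..CARD('d)}. (u a \<bullet> v j)\<^sup>2)"
    unfolding captured_def using assms(3) by (intro sum_mono2) auto
  also have "\<dots> = u a \<bullet> u a"
    by (subst orthonormal_frame_inner[OF assms(2)]) (simp add: power2_eq_square inner_commute)
  finally show ?thesis using orthonormal_frameD[OF assms(1) assms(4) assms(4)] by simp
qed

lemma sum_captured:
  fixes u v :: "nat \<Rightarrow> real^'d"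
  assumes u: "orthonormal_frame u" and v: "orthonormal_frame v" and k: "k \<le> CARD('d)"
  shows "(\<Sum>a\<in>{1..CARD('d)}. captured k v (u a)) = real k"
proof -
  have "(\<Sum>a\<in>{1..CARD('d)}. captured k v (u a)) = (\<Sum>j\<in>{1..k}. \<Sum>a\<in>{1..CARD('d)}. (u a \<bullet> v j)\<^sup>2)"
    unfolding captured_def by (rule sum.swap)
  also have "\<dots> = (\<Sum>j\<in>{1..k}. v j \<bullet> v j)"
    by (subst orthonormal_frame_inner[OF u]) (simp add: power2_eq_square)
  also have "\<dots> = (\<Sum>j\<in>{1..k}. 1)"
    using orthonormal_frameD[OF v] k by (intro sum.cong) auto
  finally show ?thesis by simp
qed

lemma sum_split_at: "k \<le> d \<Longrightarrow> (\<Sum>a\<in>{1..d}. f a) = (\<Sum>a\<in>{1..k}. f a) + (\<Sum>a\<in>{k+1..d}. f a)"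
  for f :: "nat \<Rightarrow> 'b::comm_monoid_add"
  using sum.ub_add_nat[of 1 k f "d - k"] by simp

text \<open>Both sides are the trace of a diagonal block of the difference of two projections of
  rank \<open>k\<close>, whose total trace vanishes.\<close>

lemma captured_defect:
  fixes u v :: "nat \<Rightarrow> real^'d"
  assumes u: "orthonormal_frame u" and v: "orthonormal_frame v" and k: "k \<le> CARD('d)"
  shows "(\<Sum>a\<in>{1..k}. 1 - captured k v (u a)) = (\<Sum>a\<in>{k+1..CARD('d)}. captured k v (u a))"
  using sum_captured[OF assms] sum_split_at[OF k, of "\<lambda>a. captured k v (u a)"]
  by (simp add: sum_subtractf)

text \<open>Any shift \<open>c\<close> of the spectrum may be used, since the two projections have
  equal trace. For \<open>c\<close> between \<open>lam (k + 1)\<close> and \<open>lam k\<close>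
  every summand is nonnegative; the choice of \<open>c\<close> is adapted to each
  application.\<close>

lemma eigen_excess_eq:
  fixes A :: "real^'d^'d"
  assumes eig: "ordered_eigenbasis A lam u" and v: "orthonormal_frame v" and k: "k \<le> CARD('d)"
  shows "(\<Sum>j\<in>{1..k}. lam j) - (\<Sum>j\<in>{1..k}. v j \<bullet> (A *v v j))
    = (\<Sum>a\<in>{1..k}. (lam a - c) * (1 - captured k v (u a)))
      + (\<Sum>a\<in>{k+1..CARD('d)}. (c - lam a) * captured k v (u a))"
proof -
  note u = ordered_eigenbasis_frame[OF eig]
  let ?q = "\<lambda>a. captured k v (u a)"
  have "(\<Sum>j\<in>{1..k}. v j \<bullet> (A *v v j)) = (\<Sum>j\<in>{1..k}. \<Sum>a\<in>{1..CARD('d)}. lam a * (u a \<bullet> v j)\<^sup>2)"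
    by (simp add: ordered_eigenbasis_bilinear[OF eig] power2_eq_square mult.assoc)
  also have "\<dots> = (\<Sum>a\<in>{1..CARD('d)}. lam a * ?q a)"
    by (subst sum.swap) (simp add: captured_def sum_distrib_left)
  also have "\<dots> = (\<Sum>a\<in>{1..k}. lam a * ?q a) + (\<Sum>a\<in>{k+1..CARD('d)}. lam a * ?q a)"
    by (rule sum_split_at[OF k])
  finally have 1: "(\<Sum>j\<in>{1..k}. v j \<bullet> (A *v v j)) = \<dots>" .
  have 2: "c * (\<Sum>a\<in>{1..k}. 1 - ?q a) = c * (\<Sum>a\<in>{k+1..CARD('d)}. ?q a)"
    by (simp only: captured_defect[OF u v k])
  have "(\<Sum>a\<in>{1..k}. (lam a - c) * (1 - ?q a))
      = (\<Sum>a\<in>{1..k}. lam a) - (\<Sum>a\<in>{1..k}. lam a * ?q a) - c * (\<Sum>a\<in>{1..k}. 1 - ?q a)"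
    by (simp add: algebra_simps sum_subtractf sum.distrib sum_distrib_left)
  moreover have "(\<Sum>a\<in>{k+1..CARD('d)}. (c - lam a) * ?q a)
      = c * (\<Sum>a\<in>{k+1..CARD('d)}. ?q a) - (\<Sum>a\<in>{k+1..CARD('d)}. lam a * ?q a)"
    by (simp add: algebra_simps sum_subtractf sum_distrib_left)
  ultimately show ?thesis using 1 2 by linarith
qed

lemma ky_fan:
  fixes A :: "real^'d^'d"
  assumes eig: "ordered_eigenbasis A lam u" and v: "orthonormal_frame v"
    and k: "1 \<le> k" "k \<le> CARD('d)"
  shows "(\<Sum>j\<in>{1..k}. v j \<bullet> (A *v v j)) \<le> (\<Sum>j\<in>{1..k}. lam j)"
proof -
  note u = ordered_eigenbasis_frame[OF eig]
  have "0 \<le> (\<Sum>a\<in>{1..k}. (lam a - lam k) * (1 - captured k v (u a)))"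
    using k captured_le_1[OF u v k(2)] ordered_eigenbasis_antimono[OF eig]
    by (intro sum_nonneg mult_nonneg_nonneg) auto
  moreover have "0 \<le> (\<Sum>a\<in>{k+1..CARD('d)}. (lam k - lam a) * captured k v (u a))"
    using k ordered_eigenbasis_antimono[OF eig]
    by (intro sum_nonneg mult_nonneg_nonneg captured_nonneg) auto
  ultimately show ?thesis using eigen_excess_eq[OF eig v k(2), of "lam k"] by simp
qed

text \<open>The bilinear form of the orthogonal projection onto the span of \<open>v 1, \<dots>, v
  k\<close>, when these are orthonormal.\<close>

definition cross_overlap :: "nat \<Rightarrow> (nat \<Rightarrow> real^'d) \<Rightarrow> real^'d \<Rightarrow> real^'d \<Rightarrow> real" where
  "cross_overlap k v x y = (\<Sum>l\<in>{1..k}. (x \<bullet> v l) * (y \<bullet> v l))"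

text \<open>A projection is idempotent, so the squared length of one of its rows is the
  corresponding diagonal entry.\<close>

lemma sum_cross_overlap_sq:
  fixes u v :: "nat \<Rightarrow> real^'d"
  assumes u: "orthonormal_frame u" and v: "orthonormal_frame v" and k: "k \<le> CARD('d)"
  shows "(\<Sum>b\<in>{1..CARD('d)}. (cross_overlap k v x (u b))\<^sup>2) = captured k v x"
proof -
  define z where "z = (\<Sum>l\<in>{1..k}. (x \<bullet> v l) *\<^sub>R v l)"
  have *: "cross_overlap k v x y = y \<bullet> z" for y
    by (simp add: cross_overlap_def z_def inner_sum_right)
  have zv: "z \<bullet> v l = x \<bullet> v l" if "l \<in> {1..k}" for l
  proof -
    have "z \<bullet> v l = (\<Sum>m\<in>{1..k}. if m = l then x \<bullet> v l else 0)"
      unfolding z_def inner_sum_left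
      using that k by (intro sum.cong) (auto simp: orthonormal_frameD[OF v])
    with that show ?thesis by simp
  qed
  have "(\<Sum>b\<in>{1..CARD('d)}. (cross_overlap k v x (u b))\<^sup>2) = z \<bullet> z"
    by (subst orthonormal_frame_inner[OF u]) (simp add: * power2_eq_square)
  also have "\<dots> = (\<Sum>l\<in>{1..k}. (x \<bullet> v l) * (z \<bullet> v l))"
    by (subst (2) z_def) (simp add: inner_sum_right)
  also have "\<dots> = captured k v x"
    unfolding captured_def using zv by (intro sum.cong) (auto simp: power2_eq_square)
  finally show ?thesis .
qed

text \<open>Split each gap as \<open>(lam j - c) + (c - lam i)\<close> with \<open>c = lam k\<close>
  and bound the sums of squares along the rows and columns of the off-diagonal block of the
  projection by \<open>1 - captured\<close> and \<open>captured\<close>: this is the right-hand side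
  of \<open>eigen_excess_eq\<close>, term by term.\<close>

lemma sum_gap_cross_overlap_le:
  fixes A :: "real^'d^'d"
  assumes eig: "ordered_eigenbasis A lam u" and v: "orthonormal_frame v"
    and k: "1 \<le> k" "k < CARD('d)"
  shows "(\<Sum>i\<in>{k+1..CARD('d)}. \<Sum>j\<in>{1..k}. (lam j - lam i) * (cross_overlap k v (u i) (u j))\<^sup>2)
    \<le> (\<Sum>j\<in>{1..k}. lam j) - (\<Sum>j\<in>{1..k}. v j \<bullet> (A *v v j))"
proof -
  note u = ordered_eigenbasis_frame[OF eig]
  let ?q = "\<lambda>a. captured k v (u a)" and ?Q = "\<lambda>i j. cross_overlap k v (u i) (u j)"
  let ?c = "lam k"
  have kd: "k \<le> CARD('d)" using k by simp
  have sym: "?Q i j = ?Q j i" for i j by (simp add: cross_overlap_def mult.commute)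
  have diag: "?Q j j = ?q j" for j by (simp add: cross_overlap_def captured_def power2_eq_square)
  have top: "(\<Sum>i\<in>{k+1..CARD('d)}. (?Q i j)\<^sup>2) \<le> 1 - ?q j" if j: "j \<in> {1..k}" for j
  proof -
    have "(?q j)\<^sup>2 + (\<Sum>i\<in>{k+1..CARD('d)}. (?Q j i)\<^sup>2)
        = (\<Sum>i\<in>insert j {k+1..CARD('d)}. (?Q j i)\<^sup>2)"
      using j by (simp add: diag)
    also have "\<dots> \<le> (\<Sum>i\<in>{1..CARD('d)}. (?Q j i)\<^sup>2)"
      using j k by (intro sum_mono2) auto
    also have "\<dots> = ?q j" by (rule sum_cross_overlap_sq[OF u v kd])
    finally have "(\<Sum>i\<in>{k+1..CARD('d)}. (?Q j i)\<^sup>2) \<le> ?q j * (1 - ?q j)"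
      by (simp add: power2_eq_square algebra_simps)
    also have "\<dots> \<le> 1 * (1 - ?q j)"
      using captured_le_1[OF u v kd, of j] j k by (intro mult_right_mono) auto
    finally show ?thesis by (simp only: sym[of _ j] mult_1)
  qed
  have bottom: "(\<Sum>j\<in>{1..k}. (?Q i j)\<^sup>2) \<le> ?q i" for i
  proof -
    have "(\<Sum>j\<in>{1..k}. (?Q i j)\<^sup>2) \<le> (\<Sum>j\<in>{1..CARD('d)}. (?Q i j)\<^sup>2)"
      using k by (intro sum_mono2) auto
    then show ?thesis by (simp only: sum_cross_overlap_sq[OF u v kd])
  qed
  have "(\<Sum>i\<in>{k+1..CARD('d)}. \<Sum>j\<in>{1..k}. (lam j - lam i) * (?Q i j)\<^sup>2)
      = (\<Sum>i\<in>{k+1..CARD('d)}. \<Sum>j\<in>{1..k}. (lam j - ?c) * (?Q i j)\<^sup>2)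
      + (\<Sum>i\<in>{k+1..CARD('d)}. \<Sum>j\<in>{1..k}. (?c - lam i) * (?Q i j)\<^sup>2)"
    unfolding sum.distrib[symmetric] by (intro sum.cong refl) (simp add: algebra_simps)
  also have "(\<Sum>i\<in>{k+1..CARD('d)}. \<Sum>j\<in>{1..k}. (lam j - ?c) * (?Q i j)\<^sup>2)
      = (\<Sum>j\<in>{1..k}. (lam j - ?c) * (\<Sum>i\<in>{k+1..CARD('d)}. (?Q i j)\<^sup>2))"
    by (subst sum.swap) (simp add: sum_distrib_left)
  also have "\<dots> \<le> (\<Sum>j\<in>{1..k}. (lam j - ?c) * (1 - ?q j))"
    using k ordered_eigenbasis_antimono[OF eig] by (intro sum_mono mult_left_mono top) auto
  also have "(\<Sum>i\<in>{k+1..CARD('d)}. \<Sum>j\<in>{1..k}. (?c - lam i) * (?Q i j)\<^sup>2)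
      = (\<Sum>i\<in>{k+1..CARD('d)}. (?c - lam i) * (\<Sum>j\<in>{1..k}. (?Q i j)\<^sup>2))"
    by (simp add: sum_distrib_left)
  also have "\<dots> \<le> (\<Sum>i\<in>{k+1..CARD('d)}. (?c - lam i) * ?q i)"
    using k ordered_eigenbasis_antimono[OF eig] by (intro sum_mono mult_left_mono bottom) auto
  finally show ?thesis using eigen_excess_eq[OF eig v kd, of ?c] by simp
qed

text \<open>Decompose every \<open>v j\<close> into its components along \<open>u 1, \<dots>, u
  k\<close> and along the other \<open>u a\<close>. The sum over all \<open>v j\<close> of the first
  diagonal part is the trace of a compression of \<open>D\<close>, hence equal to the subtracted
  sum; what remains of it runs over \<open>j > k\<close> and is small.\<close>

lemma perturbation_split:
  fixes D :: "real^'d^'d"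
  assumes u: "orthonormal_frame u" and v: "orthonormal_frame v" and k: "k \<le> CARD('d)"
    and D: "\<And>x y. x \<bullet> (D *v y) = y \<bullet> (D *v x)"
  shows "(\<Sum>j\<in>{1..k}. v j \<bullet> (D *v v j)) - (\<Sum>j\<in>{1..k}. u j \<bullet> (D *v u j))
    \<le> 2 * op_norm D * (\<Sum>a\<in>{k+1..CARD('d)}. captured k v (u a))
      + 2 * (\<Sum>i\<in>{k+1..CARD('d)}. \<Sum>j\<in>{1..k}. cross_overlap k v (u i) (u j) * (u i \<bullet> (D *v u j)))"
proof -
  let ?d = "CARD('d)"
  define P where "P x = (\<Sum>a\<in>{1..k}. (u a \<bullet> x) *\<^sub>R u a)" for x
  define R where "R x = (\<Sum>a\<in>{k+1..?d}. (u a \<bullet> x) *\<^sub>R u a)" for x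
  have PR: "P x + R x = x" for x
    using orthonormal_frame_expand[OF u, of x] sum_split_at[OF k, of "\<lambda>a. (u a \<bullet> x) *\<^sub>R u a"]
    by (simp add: P_def R_def)
  have bil: "(\<Sum>a\<in>S. (u a \<bullet> x) *\<^sub>R u a) \<bullet> (D *v (\<Sum>b\<in>T. (u b \<bullet> y) *\<^sub>R u b))
      = (\<Sum>a\<in>S. \<Sum>b\<in>T. (u a \<bullet> x) * (u b \<bullet> y) * (u a \<bullet> (D *v u b)))" for S T x y
  proof -
    have "u a \<bullet> (D *v (\<Sum>b\<in>T. (u b \<bullet> y) *\<^sub>R u b)) = (\<Sum>b\<in>T. (u b \<bullet> y) * (u a \<bullet> (D *v u b)))" for a
      by (simp add: linear_sum[OF matrix_vector_mul_linear] matrix_vector_mult_scaleR inner_sum_right)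
    then show ?thesis by (simp add: inner_sum_left sum_distrib_left mult.assoc)
  qed
  have nrm: "(norm (\<Sum>a\<in>S. (u a \<bullet> x) *\<^sub>R u a))\<^sup>2 = (\<Sum>a\<in>S. (u a \<bullet> x)\<^sup>2)" if "S \<subseteq> {1..?d}" for S x
  proof -
    have "finite S" using that finite_subset by blast
    have "(\<Sum>a\<in>S. (u a \<bullet> x) *\<^sub>R u a) \<bullet> u b = u b \<bullet> x" if b: "b \<in> S" for b
    proof -
      have "(\<Sum>a\<in>S. (u a \<bullet> x) *\<^sub>R u a) \<bullet> u b = (\<Sum>a\<in>S. if a = b then u b \<bullet> x else 0)"
        unfolding inner_sum_left using \<open>S \<subseteq> _\<close> b
        by (intro sum.cong) (auto simp: orthonormal_frameD[OF u] subset_iff)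
      with b \<open>finite S\<close> show ?thesis by simp
    qed
    then have "(\<Sum>a\<in>S. (u a \<bullet> x) * ((\<Sum>a\<in>S. (u a \<bullet> x) *\<^sub>R u a) \<bullet> u a)) = (\<Sum>a\<in>S. (u a \<bullet> x)\<^sup>2)"
      by (intro sum.cong refl) (simp add: power2_eq_square)
    then show ?thesis
      by (simp only: power2_norm_eq_inner inner_sum_right inner_scaleR_right)
  qed
  have quad: "x \<bullet> (D *v x) = P x \<bullet> (D *v P x) + 2 * (R x \<bullet> (D *v P x)) + R x \<bullet> (D *v R x)" for x
  proof -
    have "x \<bullet> (D *v x) = (P x + R x) \<bullet> (D *v (P x + R x))" by (simp only: PR)
    also have "\<dots> = P x \<bullet> (D *v P x) + P x \<bullet> (D *v R x) + R x \<bullet> (D *v P x) + R x \<bullet> (D *v R x)"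
      by (simp add: matrix_vector_right_distrib inner_add_left inner_add_right)
    also have "P x \<bullet> (D *v R x) = R x \<bullet> (D *v P x)" by (rule D)
    finally show ?thesis by simp
  qed
  have trace: "(\<Sum>j\<in>{1..?d}. P (v j) \<bullet> (D *v P (v j))) = (\<Sum>j\<in>{1..k}. u j \<bullet> (D *v u j))"
  proof -
    have "(\<Sum>j\<in>{1..?d}. P (v j) \<bullet> (D *v P (v j)))
      = (\<Sum>a\<in>{1..k}. \<Sum>b\<in>{1..k}. \<Sum>j\<in>{1..?d}. (u a \<bullet> v j) * (u b \<bullet> v j) * (u a \<bullet> (D *v u b)))"
      unfolding P_def bil by (rule trans[OF sum.swap], rule sum.cong[OF refl], rule sum.swap)
    also have "\<dots> = (\<Sum>a\<in>{1..k}. \<Sum>b\<in>{1..k}. (u a \<bullet> u b) * (u a \<bullet> (D *v u b)))"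
      by (simp add: sum_distrib_right[symmetric] orthonormal_frame_inner[OF v, of "u _" "u _"] inner_commute)
    also have "\<dots> = (\<Sum>a\<in>{1..k}. \<Sum>b\<in>{1..k}. if b = a then u a \<bullet> (D *v u a) else 0)"
      using k by (intro sum.cong) (auto simp: orthonormal_frameD[OF u])
    finally show ?thesis by simp
  qed
  have bound: "\<bar>x \<bullet> (D *v x)\<bar> \<le> op_norm D * (norm x)\<^sup>2" for x by (rule abs_inner_op_norm)
  have Pbound: "- (\<Sum>j\<in>{k+1..?d}. P (v j) \<bullet> (D *v P (v j)))
      \<le> op_norm D * (\<Sum>a\<in>{k+1..?d}. captured k v (u a))"
  proof -
    have "- (\<Sum>j\<in>{k+1..?d}. P (v j) \<bullet> (D *v P (v j)))
        \<le> (\<Sum>j\<in>{k+1..?d}. op_norm D * (norm (P (v j)))\<^sup>2)"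
      unfolding sum_negf[symmetric] by (intro sum_mono) (use bound abs_le_D2 in blast)
    also have "\<dots> = op_norm D * (\<Sum>j\<in>{k+1..?d}. \<Sum>a\<in>{1..k}. (u a \<bullet> v j)\<^sup>2)"
      unfolding P_def using k by (simp add: nrm sum_distrib_left)
    also have "(\<Sum>j\<in>{k+1..?d}. \<Sum>a\<in>{1..k}. (u a \<bullet> v j)\<^sup>2) = (\<Sum>a\<in>{1..k}. \<Sum>j\<in>{k+1..?d}. (u a \<bullet> v j)\<^sup>2)"
      by (rule sum.swap)
    also have "\<dots> = (\<Sum>a\<in>{1..k}. 1 - captured k v (u a))"
    proof (intro sum.cong refl)
      fix a assume a: "a \<in> {1..k}"
      have "1 = u a \<bullet> u a" using orthonormal_frameD[OF u, of a a] a k by simp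
      also have "\<dots> = (\<Sum>j\<in>{1..?d}. (u a \<bullet> v j)\<^sup>2)"
        by (subst orthonormal_frame_inner[OF v]) (simp add: power2_eq_square inner_commute)
      finally show "(\<Sum>j\<in>{k+1..?d}. (u a \<bullet> v j)\<^sup>2) = 1 - captured k v (u a)"
        using sum_split_at[OF k, of "\<lambda>j. (u a \<bullet> v j)\<^sup>2"] by (simp add: captured_def)
    qed
    finally show ?thesis by (simp only: captured_defect[OF u v k])
  qed
  have Rbound: "(\<Sum>j\<in>{1..k}. R (v j) \<bullet> (D *v R (v j)))
      \<le> op_norm D * (\<Sum>a\<in>{k+1..?d}. captured k v (u a))"
  proof -
    have "(\<Sum>j\<in>{1..k}. R (v j) \<bullet> (D *v R (v j))) \<le> (\<Sum>j\<in>{1..k}. op_norm D * (norm (R (v j)))\<^sup>2)"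
      by (intro sum_mono) (use bound abs_le_D1 in blast)
    also have "\<dots> = op_norm D * (\<Sum>j\<in>{1..k}. \<Sum>a\<in>{k+1..?d}. (u a \<bullet> v j)\<^sup>2)"
      unfolding R_def by (subst nrm) (auto simp add: sum_distrib_left)
    also have "(\<Sum>j\<in>{1..k}. \<Sum>a\<in>{k+1..?d}. (u a \<bullet> v j)\<^sup>2) = (\<Sum>a\<in>{k+1..?d}. captured k v (u a))"
      unfolding captured_def by (rule sum.swap)
    finally show ?thesis .
  qed
  have cross: "(\<Sum>j\<in>{1..k}. R (v j) \<bullet> (D *v P (v j)))
      = (\<Sum>i\<in>{k+1..?d}. \<Sum>j\<in>{1..k}. cross_overlap k v (u i) (u j) * (u i \<bullet> (D *v u j)))"
    unfolding P_def R_def bil cross_overlap_def sum_distrib_right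
    by (rule trans[OF sum.swap], rule sum.cong[OF refl], rule sum.swap)
  have "(\<Sum>j\<in>{1..k}. v j \<bullet> (D *v v j))
      = (\<Sum>j\<in>{1..k}. P (v j) \<bullet> (D *v P (v j))) + 2 * (\<Sum>j\<in>{1..k}. R (v j) \<bullet> (D *v P (v j)))
        + (\<Sum>j\<in>{1..k}. R (v j) \<bullet> (D *v R (v j)))"
    by (subst quad) (simp add: sum.distrib sum_distrib_left)
  with sum_split_at[OF k, of "\<lambda>j. P (v j) \<bullet> (D *v P (v j))"] trace Pbound Rbound cross
  show ?thesis by simp
qed

text \<open>The right-hand side is of first order in \<open>B - A\<close>: it is the squared
  gradient of the risk at the optimal subspace, measured in the inverse of its Hessian, up to a
  constant. The factor \<open>1 - \<theta>\<close> accounts for the action of \<open>B - A\<close>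
  within the two eigenspaces.\<close>

theorem excess_le_first_order:
  fixes A B :: "real^'d^'d"
  assumes eigA: "ordered_eigenbasis A lam u" and eigB: "ordered_eigenbasis B mu v"
    and k: "1 \<le> k" "k < CARD('d)" and gap: "lam (k + 1) < lam k"
    and \<theta>: "2 * op_norm (B - A) / (lam k - lam (k + 1)) = \<theta>" "\<theta> < 1"
  shows "((\<Sum>j\<in>{1..k}. lam j) - (\<Sum>j\<in>{1..k}. v j \<bullet> (A *v v j))) * (1 - \<theta>)\<^sup>2
    \<le> 4 * (\<Sum>i\<in>{1..CARD('d)-k}. \<Sum>j\<in>{1..k}.
        (u (k + i) \<bullet> ((B - A) *v u j))\<^sup>2 / (lam j - lam (k + i)))"
proof -
  note u = ordered_eigenbasis_frame[OF eigA] and v = ordered_eigenbasis_frame[OF eigB]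
  let ?d = "CARD('d)" and ?D = "B - A"
  let ?q = "\<lambda>a. captured k v (u a)" and ?Q = "\<lambda>i j. cross_overlap k v (u i) (u j)"
  let ?e = "(\<Sum>j\<in>{1..k}. lam j) - (\<Sum>j\<in>{1..k}. v j \<bullet> (A *v v j))"
  let ?s = "\<Sum>a\<in>{k+1..?d}. ?q a"
  let ?x = "\<Sum>i\<in>{k+1..?d}. \<Sum>j\<in>{1..k}. ?Q i j * (u i \<bullet> (?D *v u j))"
  let ?g = "\<Sum>i\<in>{k+1..?d}. \<Sum>j\<in>{1..k}. (u i \<bullet> (?D *v u j))\<^sup>2 / (lam j - lam i)"
  have kd: "k \<le> ?d" using k by simp
  have gap_pos: "0 < lam j - lam i" if "i \<in> {k+1..?d}" "j \<in> {1..k}" for i j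
  proof -
    have "lam i \<le> lam (k + 1)" "lam k \<le> lam j"
      using that ordered_eigenbasis_antimono[OF eigA, of "k+1" i] ordered_eigenbasis_antimono[OF eigA, of j k] k by auto
    with gap show ?thesis by simp
  qed
  have e0: "0 \<le> ?e" using ky_fan[OF eigA v k(1) kd] by simp
  have gap_s: "(lam k - lam (k + 1)) * ?s \<le> ?e"
  proof -
    have "(lam k - lam (k + 1)) * (\<Sum>a\<in>{1..k}. 1 - ?q a)
        \<le> (\<Sum>a\<in>{1..k}. (lam a - lam (k + 1)) * (1 - ?q a))"
      unfolding sum_distrib_left
      using k captured_le_1[OF u v kd] ordered_eigenbasis_antimono[OF eigA]
      by (intro sum_mono mult_right_mono) auto
    moreover have "0 \<le> (\<Sum>a\<in>{k+1..?d}. (lam (k + 1) - lam a) * ?q a)"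
      using ordered_eigenbasis_antimono[OF eigA, of "k + 1"]
      by (intro sum_nonneg mult_nonneg_nonneg captured_nonneg) auto
    ultimately show ?thesis
      using eigen_excess_eq[OF eigA v kd, of "lam (k + 1)"] captured_defect[OF u v kd] by simp
  qed
  have symD: "x \<bullet> (?D *v y) = y \<bullet> (?D *v x)" for x y
    by (simp add: matrix_vector_mult_diff_rdistrib inner_diff_right
        ordered_eigenbasis_bilinear[OF eigA] ordered_eigenbasis_bilinear[OF eigB] mult_ac)
  have trA: "(\<Sum>j\<in>{1..k}. u j \<bullet> (A *v u j)) = (\<Sum>j\<in>{1..k}. lam j)"
    using eigA kd orthonormal_frameD[OF u] by (intro sum.cong) (auto simp: ordered_eigenbasis_def)
  have trB: "(\<Sum>j\<in>{1..k}. v j \<bullet> (B *v v j)) = (\<Sum>j\<in>{1..k}. mu j)"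
    using eigB kd orthonormal_frameD[OF v] by (intro sum.cong) (auto simp: ordered_eigenbasis_def)
  have "?e \<le> (\<Sum>j\<in>{1..k}. v j \<bullet> (?D *v v j)) - (\<Sum>j\<in>{1..k}. u j \<bullet> (?D *v u j))"
    using ky_fan[OF eigB u k(1) kd] trA trB
    by (simp add: matrix_vector_mult_diff_rdistrib inner_diff_right sum_subtractf)
  also have "\<dots> \<le> 2 * op_norm ?D * ?s + 2 * ?x"
    by (rule perturbation_split[OF u v kd symD])
  also have "2 * op_norm ?D * ?s = \<theta> * ((lam k - lam (k + 1)) * ?s)"
  proof -
    have "2 * op_norm ?D = \<theta> * (lam k - lam (k + 1))" using gap \<theta>(1) by (auto simp: field_simps)
    then show ?thesis by (simp only: mult.assoc)
  qed
  also have "\<dots> \<le> \<theta> * ?e"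
    using gap_s gap by (intro mult_left_mono) (auto simp: \<theta>(1)[symmetric])
  finally have 1: "(1 - \<theta>) * ?e \<le> 2 * ?x" by (simp add: algebra_simps)
  have 2: "?x\<^sup>2 \<le> ?e * ?g"
  proof -
    let ?P = "{k+1..?d} \<times> {1..k}"
    define \<delta> where "\<delta> = (\<lambda>(i,j). lam j - lam i)"
    define Q where "Q = (\<lambda>(i,j). ?Q i j)"
    define w where "w = (\<lambda>(i,j). u i \<bullet> (?D *v u j))"
    have \<delta>: "0 < \<delta> p" if "p \<in> ?P" for p using that gap_pos by (auto simp: \<delta>_def)
    have "?x = (\<Sum>p\<in>?P. Q p * w p)" by (simp add: sum.cartesian_product Q_def w_def case_prod_beta)
    also have "\<dots> = (\<Sum>p\<in>?P. (sqrt (\<delta> p) * Q p) * (w p / sqrt (\<delta> p)))"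
      using \<delta> by (intro sum.cong refl) (fastforce simp: less_imp_neq)
    finally have "?x\<^sup>2 \<le> (\<Sum>p\<in>?P. (sqrt (\<delta> p) * Q p)\<^sup>2) * (\<Sum>p\<in>?P. (w p / sqrt (\<delta> p))\<^sup>2)"
      using Cauchy_Schwarz_ineq_sum by (simp only:)
    also have "(\<Sum>p\<in>?P. (sqrt (\<delta> p) * Q p)\<^sup>2) = (\<Sum>p\<in>?P. \<delta> p * (Q p)\<^sup>2)"
      using \<delta> by (intro sum.cong refl) (simp add: power_mult_distrib less_imp_le)
    also have "(\<Sum>p\<in>?P. (w p / sqrt (\<delta> p))\<^sup>2) = (\<Sum>p\<in>?P. (w p)\<^sup>2 / \<delta> p)"
      using \<delta> by (intro sum.cong refl) (simp add: power_divide less_imp_le)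
    also have "\<dots> = ?g" by (simp add: sum.cartesian_product w_def \<delta>_def case_prod_beta)
    also have "(\<Sum>p\<in>?P. \<delta> p * (Q p)\<^sup>2) = (\<Sum>i\<in>{k+1..?d}. \<Sum>j\<in>{1..k}. (lam j - lam i) * (?Q i j)\<^sup>2)"
      by (simp add: sum.cartesian_product Q_def \<delta>_def case_prod_beta)
    also have "\<dots> * ?g \<le> ?e * ?g"
      using gap_pos by (intro mult_right_mono sum_gap_cross_overlap_le[OF eigA v k] sum_nonneg)
        (auto simp: less_imp_le)
    finally show ?thesis .
  qed
  have "?e * (1 - \<theta>)\<^sup>2 \<le> 4 * ?g"
  proof (cases "?e = 0")
    case True
    have "0 \<le> ?g" using gap_pos by (intro sum_nonneg) (auto simp: less_imp_le)
    with True show ?thesis by simp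
  next
    case False
    with e0 have pos: "0 < ?e" by simp
    have "((1 - \<theta>) * ?e)\<^sup>2 \<le> (2 * ?x)\<^sup>2"
      using 1 \<theta>(2) e0 by (intro power_mono) auto
    also have "\<dots> \<le> 4 * (?e * ?g)" using 2 by (simp add: power_mult_distrib)
    finally have "?e * (?e * (1 - \<theta>)\<^sup>2) \<le> ?e * (4 * ?g)"
      by (simp only: power2_eq_square mult_ac)
    then show ?thesis using pos by (simp only: mult_le_cancel_left_pos)
  qed
  also have "?g = (\<Sum>i\<in>{1..?d-k}. \<Sum>j\<in>{1..k}. (u (k + i) \<bullet> (?D *v u j))\<^sup>2 / (lam j - lam (k + i)))"
    by (rule sum.reindex_bij_witness[of _ "\<lambda>i. k + i" "\<lambda>i. i - k"]) auto
  finally show ?thesis .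
qed

section \<open>Moments of the sample second moment matrix\<close>

lemma outer_mult_vec: "outer x *v b = (x \<bullet> b) *\<^sub>R x"
  by (simp add: vec_eq_iff outer_def matrix_vector_mult_def inner_vec_def sum_distrib_left
      sum_distrib_right mult_ac)

lemma transpose_outer: "transpose (outer x) = outer x"
  by (simp add: vec_eq_iff outer_def transpose_def mult.commute)

lemma norm_outer: "norm (outer x) = (norm x)\<^sup>2"
proof -
  have "(norm (outer x))\<^sup>2 = ((norm x)\<^sup>2)\<^sup>2"
    by (simp add: power2_norm_eq_inner inner_vec_def outer_def sum_product)
      (simp add: power2_eq_square sum_product mult_ac)
  then show ?thesis by (rule power2_eq_imp_eq) simp_all
qed

lemma outer_measurable [measurable]: "outer \<in> borel_measurable borel"
  unfolding outer_def by (intro borel_measurable_continuous_onI continuous_intros)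

text \<open>Finite fourth moments of the coordinates are used through this single
  consequence.\<close>

lemma (in prob_space) integrable_norm_pow4:
  fixes X :: "'a \<Rightarrow> real^'d"
  assumes X [measurable]: "X \<in> borel_measurable M" and moment: "\<And>j. integrable M (\<lambda>\<omega>. (X \<omega> $ j) ^ 4)"
  shows "integrable M (\<lambda>\<omega>. norm (X \<omega>) ^ 4)"
proof (rule Bochner_Integration.integrable_bound)
  show "integrable M (\<lambda>\<omega>. real CARD('d) ^ 2 * (\<Sum>j\<in>UNIV. (X \<omega> $ j) ^ 4))"
    using moment by (intro integrable_mult_right Bochner_Integration.integrable_sum)
  show "(\<lambda>\<omega>. norm (X \<omega>) ^ 4) \<in> borel_measurable M" by measurable
  have "norm x ^ 4 \<le> real CARD('d) ^ 2 * (\<Sum>j\<in>UNIV. (x $ j) ^ 4)" for x :: "real^'d"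
  proof -
    have "norm x ^ 4 = ((norm x)\<^sup>2)\<^sup>2" by simp
    also have "(norm x)\<^sup>2 = (\<Sum>j\<in>UNIV. (x $ j)\<^sup>2)"
      by (simp add: norm_vec_def L2_set_def sum_nonneg)
    also have "(\<Sum>j\<in>UNIV. (x $ j)\<^sup>2)\<^sup>2 \<le> card (UNIV :: 'd set) ^ 2 * (\<Sum>j\<in>UNIV. ((x $ j)\<^sup>2)\<^sup>2)"
      by (rule power_sum_le) auto
    finally show ?thesis by simp
  qed
  then show "AE \<omega> in M. norm (norm (X \<omega>) ^ 4) \<le> norm (real CARD('d) ^ 2 * (\<Sum>j\<in>UNIV. (X \<omega> $ j) ^ 4))"
    by (intro AE_I2) (auto simp: sum_nonneg abs_mult)
qed

lemma (in prob_space) integrable_norm_pow2: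
  fixes X :: "'a \<Rightarrow> 'b::euclidean_space"
  assumes X [measurable]: "X \<in> borel_measurable M" and int: "integrable M (\<lambda>\<omega>. norm (X \<omega>) ^ 4)"
  shows "integrable M (\<lambda>\<omega>. (norm (X \<omega>))\<^sup>2)"
proof (rule Bochner_Integration.integrable_bound)
  show "integrable M (\<lambda>\<omega>. 1 + norm (X \<omega>) ^ 4)" using int by simp
  have "t\<^sup>2 \<le> 1 + t ^ 4" for t :: real
  proof -
    have "0 \<le> (t\<^sup>2 - 1/2)\<^sup>2" by simp
    then show ?thesis by (simp add: power2_diff) (simp add: power2_eq_square power4_eq_xxxx)
  qed
  then show "AE \<omega> in M. norm ((norm (X \<omega>))\<^sup>2) \<le> norm (1 + norm (X \<omega>) ^ 4)"
    by (intro AE_I2) (auto simp: abs_of_nonneg)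
qed measurable

lemma (in prob_space) integrable_inner_pow4:
  fixes X :: "'a \<Rightarrow> 'b::euclidean_space"
  assumes X [measurable]: "X \<in> borel_measurable M" and int: "integrable M (\<lambda>\<omega>. norm (X \<omega>) ^ 4)"
  shows "integrable M (\<lambda>\<omega>. (X \<omega> \<bullet> a) * (X \<omega> \<bullet> b) * (X \<omega> \<bullet> c) * (X \<omega> \<bullet> e))"
proof (rule Bochner_Integration.integrable_bound)
  show "integrable M (\<lambda>\<omega>. norm (X \<omega>) ^ 4 * (norm a * norm b * norm c * norm e))" using int by simp
  have "\<bar>(x \<bullet> a) * (x \<bullet> b) * (x \<bullet> c) * (x \<bullet> e)\<bar> \<le> norm x ^ 4 * (norm a * norm b * norm c * norm e)" for x
  proof -
    have "\<bar>(x \<bullet> a) * (x \<bullet> b) * (x \<bullet> c) * (x \<bullet> e)\<bar>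
        \<le> (norm x * norm a) * (norm x * norm b) * (norm x * norm c) * (norm x * norm e)"
      unfolding abs_mult by (intro mult_mono Cauchy_Schwarz_ineq2) auto
    then show ?thesis by (simp add: power4_eq_xxxx mult_ac)
  qed
  then show "AE \<omega> in M. norm ((X \<omega> \<bullet> a) * (X \<omega> \<bullet> b) * (X \<omega> \<bullet> c) * (X \<omega> \<bullet> e))
      \<le> norm (norm (X \<omega>) ^ 4 * (norm a * norm b * norm c * norm e))"
    by (intro AE_I2) (metis abs_ge_self order_trans real_norm_def)
qed measurable

lemma integrable_outer:
  fixes X :: "'a \<Rightarrow> real^'d"
  assumes X [measurable]: "X \<in> borel_measurable M" and int: "integrable M (\<lambda>\<omega>. (norm (X \<omega>))\<^sup>2)"
  shows "integrable M (\<lambda>\<omega>. outer (X \<omega>))"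
  by (rule Bochner_Integration.integrable_bound[OF int]) (auto simp: norm_outer)

lemma inner_second_moment:
  fixes X :: "'a \<Rightarrow> real^'d"
  assumes int: "integrable M (\<lambda>\<omega>. outer (X \<omega>))"
  shows "a \<bullet> (second_moment M X *v b) = (\<integral>\<omega>. (a \<bullet> X \<omega>) * (b \<bullet> X \<omega>) \<partial>M)"
    "integrable M (\<lambda>\<omega>. (a \<bullet> X \<omega>) * (b \<bullet> X \<omega>))"
proof -
  have eq: "(\<lambda>\<omega>. a \<bullet> (outer (X \<omega>) *v b)) = (\<lambda>\<omega>. (a \<bullet> X \<omega>) * (b \<bullet> X \<omega>))"
    by (intro ext) (simp add: outer_mult_vec inner_commute)
  note i = integral_matrix_vector_mult[OF int, of b]
  have "a \<bullet> (second_moment M X *v b) = (\<integral>\<omega>. a \<bullet> (outer (X \<omega>) *v b) \<partial>M)"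
    unfolding second_moment_def i(1) using i(2) by (simp add: integral_inner_right)
  then show "a \<bullet> (second_moment M X *v b) = (\<integral>\<omega>. (a \<bullet> X \<omega>) * (b \<bullet> X \<omega>) \<partial>M)"
    by (simp only: eq)
  have "integrable M (\<lambda>\<omega>. a \<bullet> (outer (X \<omega>) *v b))" using i(2) by simp
  then show "integrable M (\<lambda>\<omega>. (a \<bullet> X \<omega>) * (b \<bullet> X \<omega>))" by (simp only: eq)
qed

text \<open>Mixed products of independent centred variables have mean zero.\<close>

lemma (in prob_space) expectation_sum_indep_sq:
  fixes Z :: "'i \<Rightarrow> 'a \<Rightarrow> real"
  assumes I: "finite I" and ind: "indep_vars (\<lambda>_. borel) Z I"
    and int: "\<And>i. i \<in> I \<Longrightarrow> integrable M (Z i)" and mean: "\<And>i. i \<in> I \<Longrightarrow> (\<integral>\<omega>. Z i \<omega> \<partial>M) = 0"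
    and int2: "\<And>i. i \<in> I \<Longrightarrow> integrable M (\<lambda>\<omega>. (Z i \<omega>)\<^sup>2)"
  shows "integrable M (\<lambda>\<omega>. (\<Sum>i\<in>I. Z i \<omega>)\<^sup>2) \<and> (\<integral>\<omega>. (\<Sum>i\<in>I. Z i \<omega>)\<^sup>2 \<partial>M) = (\<Sum>i\<in>I. \<integral>\<omega>. (Z i \<omega>)\<^sup>2 \<partial>M)"
  using assms
proof (induction I rule: finite_induct)
  case (insert i I)
  let ?S = "\<lambda>\<omega>. \<Sum>j\<in>I. Z j \<omega>"
  have IH: "integrable M (\<lambda>\<omega>. (?S \<omega>)\<^sup>2)" "(\<integral>\<omega>. (?S \<omega>)\<^sup>2 \<partial>M) = (\<Sum>j\<in>I. \<integral>\<omega>. (Z j \<omega>)\<^sup>2 \<partial>M)"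
    using insert.IH indep_vars_subset[OF insert.prems(1), of I] insert.prems by auto
  have iS: "integrable M ?S" using insert.prems by auto
  have ind2: "indep_var borel (Z i) borel ?S" by (rule indep_vars_sum) (use insert in auto)
  have "(\<integral>\<omega>. Z i \<omega> * ?S \<omega> \<partial>M) = (\<integral>\<omega>. Z i \<omega> \<partial>M) * (\<integral>\<omega>. ?S \<omega> \<partial>M)"
    by (rule indep_var_lebesgue_integral[OF ind2]) (use insert.prems iS in auto)
  then have cross: "(\<integral>\<omega>. Z i \<omega> * ?S \<omega> \<partial>M) = 0" using insert.prems by simp
  have icross: "integrable M (\<lambda>\<omega>. Z i \<omega> * ?S \<omega>)"
    by (rule indep_var_integrable[OF ind2]) (use insert.prems iS in auto)
  have eq: "(\<lambda>\<omega>. (\<Sum>j\<in>insert i I. Z j \<omega>)\<^sup>2) = (\<lambda>\<omega>. (Z i \<omega>)\<^sup>2 + 2 * (Z i \<omega> * ?S \<omega>) + (?S \<omega>)\<^sup>2)"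
    using insert.hyps by (intro ext) (simp add: power2_sum)
  show ?case
    unfolding eq using insert.hyps insert.prems IH cross icross by simp
qed simp


lemma identically_distributed_transfer:
  fixes h :: "'b::topological_space \<Rightarrow> 'c::{banach, second_countable_topology}"
  assumes "distr M borel Xi = distr M borel X"
    and "Xi \<in> borel_measurable M" "X \<in> borel_measurable M" "h \<in> borel_measurable borel"
  shows "integrable M (\<lambda>\<omega>. h (Xi \<omega>)) \<longleftrightarrow> integrable M (\<lambda>\<omega>. h (X \<omega>))"
    "(\<integral>\<omega>. h (Xi \<omega>) \<partial>M) = (\<integral>\<omega>. h (X \<omega>) \<partial>M)"
  using integrable_distr_eq[OF assms(2,4)] integrable_distr_eq[OF assms(3,4)]
    integral_distr[OF assms(2,4)] integral_distr[OF assms(3,4)] assms(1) by auto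

context prob_space
begin

context
  fixes X :: "'a \<Rightarrow> real^'d" and Xs :: "nat \<Rightarrow> 'a \<Rightarrow> real^'d" and n :: nat
  assumes X [measurable]: "X \<in> borel_measurable M" and n: "1 \<le> n"
    and indep: "indep_vars (\<lambda>_. borel) Xs {1..n}"
    and ident: "\<And>i. i \<in> {1..n} \<Longrightarrow> distr M borel (Xs i) = distr M borel X"
    and pow4: "integrable M (\<lambda>\<omega>. norm (X \<omega>) ^ 4)"
begin

lemma sample_measurable: "i \<in> {1..n} \<Longrightarrow> Xs i \<in> borel_measurable M"
  using indep by (simp add: indep_vars_def)

lemma sample_transfer:
  fixes h :: "real^'d \<Rightarrow> 'c::{banach, second_countable_topology}"
  assumes "i \<in> {1..n}" "h \<in> borel_measurable borel"
  shows "integrable M (\<lambda>\<omega>. h (Xs i \<omega>)) \<longleftrightarrow> integrable M (\<lambda>\<omega>. h (X \<omega>))"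
    "(\<integral>\<omega>. h (Xs i \<omega>) \<partial>M) = (\<integral>\<omega>. h (X \<omega>) \<partial>M)"
  using identically_distributed_transfer[OF ident[OF assms(1)] sample_measurable[OF assms(1)] X assms(2)]
  by auto

lemma sample_deviation_eq:
  "sample_second_moment n Xs \<omega> - second_moment M X
    = (1 / real n) *\<^sub>R (\<Sum>i\<in>{1..n}. outer (Xs i \<omega>) - second_moment M X)"
  using n by (simp add: sample_second_moment_def sum_subtractf sum_constant_scaleR scaleR_diff_right
      del: sum_constant)

text \<open>The centred matrices \<open>outer (Xs i) - second_moment M X\<close> are square
  integrable because the fourth moments are finite.\<close>

lemma expected_sample_deviation_sq:
  assumes n9: "9 \<le> n" and d: "2 \<le> CARD('d)"
  shows "integrable M (\<lambda>\<omega>. (op_norm (sample_second_moment n Xs \<omega> - second_moment M X))\<^sup>2)"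
    "(\<integral>\<omega>. (op_norm (sample_second_moment n Xs \<omega> - second_moment M X))\<^sup>2 \<partial>M)
      \<le> 8 / 3 * (S_param M X + r_param M X Xs n) / n"
proof -
  define \<Sigma> where "\<Sigma> = second_moment M X"
  define h where "h x = outer x - \<Sigma>" for x :: "real^'d"
  define Y where "Y i \<omega> = h (Xs i \<omega>)" for i \<omega>
  note [measurable] = sample_measurable
  have pow2: "integrable M (\<lambda>\<omega>. (norm (X \<omega>))\<^sup>2)" by (rule integrable_norm_pow2[OF X pow4])
  note iouter = integrable_outer[OF X pow2]
  have h [measurable]: "h \<in> borel_measurable borel" unfolding h_def by measurable
  have hh [measurable]: "(\<lambda>x. h x ** h x) \<in> borel_measurable borel"
    using measurable_compose[OF h borel_measurable_continuous_onI[OF continuous_on_matrix_square]] .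
  have ih: "integrable M (\<lambda>\<omega>. h (X \<omega>))" unfolding h_def using iouter by simp
  have mean: "(\<integral>\<omega>. h (X \<omega>) \<partial>M) = 0"
    unfolding h_def \<Sigma>_def second_moment_def using iouter by (simp add: prob_space)
  have inorm2: "integrable M (\<lambda>\<omega>. (norm (h (X \<omega>)))\<^sup>2)"
  proof (rule Bochner_Integration.integrable_bound)
    show "integrable M (\<lambda>\<omega>. 2 * norm (X \<omega>) ^ 4 + 2 * (norm \<Sigma>)\<^sup>2)" using pow4 by simp
    have "(norm (h x))\<^sup>2 \<le> 2 * norm x ^ 4 + 2 * (norm \<Sigma>)\<^sup>2" for x
    proof -
      have "(norm (h x))\<^sup>2 \<le> ((norm x)\<^sup>2 + norm \<Sigma>)\<^sup>2"
        unfolding h_def using norm_triangle_ineq4[of "outer x" \<Sigma>]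
        by (intro power_mono) (simp_all add: norm_outer)
      also have "\<dots> \<le> 2 * ((norm x)\<^sup>2)\<^sup>2 + 2 * (norm \<Sigma>)\<^sup>2"
        using zero_le_power2[of "(norm x)\<^sup>2 - norm \<Sigma>"] by (simp add: power2_sum power2_diff)
      finally show ?thesis by simp
    qed
    then show "AE \<omega> in M. norm ((norm (h (X \<omega>)))\<^sup>2) \<le> norm (2 * norm (X \<omega>) ^ 4 + 2 * (norm \<Sigma>)\<^sup>2)"
      by (intro AE_I2) (simp add: abs_of_nonneg)
  qed measurable
  have iop: "integrable M (\<lambda>\<omega>. (op_norm (h (X \<omega>)))\<^sup>2)"
    by (rule Bochner_Integration.integrable_bound[OF inorm2])
      (auto intro!: power_mono op_norm_le_norm)
  have ihh: "integrable M (\<lambda>\<omega>. h (X \<omega>) ** h (X \<omega>))"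
  proof (rule Bochner_Integration.integrable_bound[OF inorm2])
    show "(\<lambda>\<omega>. h (X \<omega>) ** h (X \<omega>)) \<in> borel_measurable M"
      using measurable_compose[OF X hh] .
    show "AE \<omega> in M. norm (h (X \<omega>) ** h (X \<omega>)) \<le> norm ((norm (h (X \<omega>)))\<^sup>2)"
      by (intro AE_I2) (simp add: power2_eq_square norm_matrix_mult_le)
  qed
  have symh: "transpose (h x) = h x" for x
  proof -
    have "transpose \<Sigma> = \<Sigma>"
    proof -
      have "bounded_linear (transpose :: real^'d^'d \<Rightarrow> real^'d^'d)"
        by (rule bounded_linear_intro[where K = 1])
          (auto simp: transpose_def vec_eq_iff norm_eq_sqrt_inner inner_transpose[unfolded transpose_def])
      from integral_bounded_linear[OF this iouter] show ?thesis
        by (simp add: \<Sigma>_def second_moment_def transpose_outer)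
    qed
    then show ?thesis by (simp add: h_def transpose_def vec_eq_iff outer_def mult.commute)
  qed
  have Yint: "integrable M (Y i)" if "i \<in> {1..n}" for i
    using sample_transfer(1)[OF that h] ih unfolding Y_def by blast
  have Yop: "integrable M (\<lambda>\<omega>. (op_norm (Y i \<omega>))\<^sup>2)" if "i \<in> {1..n}" for i
    using sample_transfer(1)[OF that, of "\<lambda>x. (op_norm (h x))\<^sup>2"] iop unfolding Y_def by simp
  have Yind: "indep_vars (\<lambda>_. borel) Y {1..n}"
    using indep_vars_compose2[OF indep, of "\<lambda>_. h" "\<lambda>_. borel"] unfolding Y_def[abs_def] by simp
  have dev: "(op_norm (sample_second_moment n Xs \<omega> - \<Sigma>))\<^sup>2 = (op_norm (\<Sum>i\<in>{1..n}. Y i \<omega>))\<^sup>2 / n\<^sup>2" for \<omega>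
    unfolding \<Sigma>_def sample_deviation_eq op_norm_scaleR
    by (simp add: Y_def h_def \<Sigma>_def power_divide)
  have "integrable M (\<lambda>\<omega>. (op_norm (\<Sum>i\<in>{1..n}. Y i \<omega>))\<^sup>2)"
    using Yint Yop by (intro integrable_op_norm_sum_power) auto
  then show "integrable M (\<lambda>\<omega>. (op_norm (sample_second_moment n Xs \<omega> - second_moment M X))\<^sup>2)"
    unfolding \<Sigma>_def[symmetric] dev by simp
  let ?C = "c_dim CARD('d)" and ?S = "\<integral>\<omega>. h (X \<omega>) ** h (X \<omega>) \<partial>M"
  let ?m = "\<integral>\<omega>. (MAX i\<in>{1..n}. (op_norm (Y i \<omega>))\<^sup>2) \<partial>M"
  have "(\<integral>\<omega>. (op_norm (\<Sum>i\<in>{1..n}. Y i \<omega>))\<^sup>2 \<partial>M)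
      \<le> 8 / 3 * (?C * (card {1..n} * op_norm ?S) + ?C\<^sup>2 * ?m)"
  proof (rule expected_op_norm_sq_sum_le)
    show "(\<integral>\<omega>. Y i \<omega> \<partial>M) = 0" if "i \<in> {1..n}" for i
      using sample_transfer(2)[OF that h] mean unfolding Y_def by simp
    show "integrable M (\<lambda>\<omega>. Y i \<omega> ** Y i \<omega>)" if "i \<in> {1..n}" for i
      using sample_transfer(1)[OF that hh] ihh unfolding Y_def by blast
    show "(\<integral>\<omega>. Y i \<omega> ** Y i \<omega> \<partial>M) = ?S" if "i \<in> {1..n}" for i
      using sample_transfer(2)[OF that hh] unfolding Y_def by simp
    show "transpose (Y i \<omega>) = Y i \<omega>" for i \<omega> by (simp add: Y_def symh)
  qed (use n9 d Yind Yint Yop in auto)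
  also have "\<dots> = n * (8 / 3 * (S_param M X + r_param M X Xs n))"
    using n unfolding S_param_def r_param_def Y_def h_def \<Sigma>_def by (simp add: field_simps)
  finally have "(\<integral>\<omega>. (op_norm (\<Sum>i\<in>{1..n}. Y i \<omega>))\<^sup>2 \<partial>M) / n\<^sup>2
      \<le> n * (8 / 3 * (S_param M X + r_param M X Xs n)) / n\<^sup>2"
    by (intro divide_right_mono) auto
  also have "\<dots> = 8 / 3 * (S_param M X + r_param M X Xs n) / n"
    using n by (simp add: power2_eq_square)
  finally show "(\<integral>\<omega>. (op_norm (sample_second_moment n Xs \<omega> - second_moment M X))\<^sup>2 \<partial>M)
      \<le> 8 / 3 * (S_param M X + r_param M X Xs n) / n"
    unfolding \<Sigma>_def[symmetric] dev by simp
qed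

text \<open>The orthogonality assumption says that the products \<open>(a \<bullet> X) (b \<bullet>
  X)\<close> are centred, so this is the variance of an average of independent variables. In the
  application \<open>a\<close> and \<open>b\<close> are different eigenvectors.\<close>

lemma expected_sample_cross_sq:
  assumes ab: "a \<bullet> (second_moment M X *v b) = 0"
  shows "integrable M (\<lambda>\<omega>. (a \<bullet> ((sample_second_moment n Xs \<omega> - second_moment M X) *v b))\<^sup>2)"
    "(\<integral>\<omega>. (a \<bullet> ((sample_second_moment n Xs \<omega> - second_moment M X) *v b))\<^sup>2 \<partial>M)
      = (\<integral>\<omega>. (a \<bullet> X \<omega>)\<^sup>2 * (b \<bullet> X \<omega>)\<^sup>2 \<partial>M) / n"
proof -
  define h where "h x = (a \<bullet> x) * (b \<bullet> x)" for x :: "real^'d"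
  have pow2: "integrable M (\<lambda>\<omega>. (norm (X \<omega>))\<^sup>2)" by (rule integrable_norm_pow2[OF X pow4])
  note iouter = integrable_outer[OF X pow2]
  have h [measurable]: "h \<in> borel_measurable borel" unfolding h_def by measurable
  have ih: "integrable M (\<lambda>\<omega>. h (X \<omega>))"
    unfolding h_def by (rule inner_second_moment(2)[OF iouter])
  have mean: "(\<integral>\<omega>. h (X \<omega>) \<partial>M) = 0"
    unfolding h_def using inner_second_moment(1)[OF iouter, of a b] ab by simp
  have h2: "(h x)\<^sup>2 = (x \<bullet> a) * (x \<bullet> a) * (x \<bullet> b) * (x \<bullet> b)" for x
    by (simp add: h_def power2_eq_square inner_commute mult_ac)
  have ih2: "integrable M (\<lambda>\<omega>. (h (X \<omega>))\<^sup>2)"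
    unfolding h2 by (rule integrable_inner_pow4[OF X pow4])
  have h2_meas: "(\<lambda>x. (h x)\<^sup>2) \<in> borel_measurable borel" by measurable
  have eq: "(a \<bullet> ((sample_second_moment n Xs \<omega> - second_moment M X) *v b))\<^sup>2
      = (\<Sum>i\<in>{1..n}. h (Xs i \<omega>))\<^sup>2 / n\<^sup>2" for \<omega>
  proof -
    have "a \<bullet> ((outer x - second_moment M X) *v b) = h x" for x
      by (simp add: matrix_vector_mult_diff_rdistrib inner_diff_right ab outer_mult_vec h_def inner_commute)
    then have "a \<bullet> ((sample_second_moment n Xs \<omega> - second_moment M X) *v b) = (\<Sum>i\<in>{1..n}. h (Xs i \<omega>)) / n"
      unfolding sample_deviation_eq scaleR_matrix_vector_assoc[symmetric] sum_matrix_vector_mult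
      by (simp add: inner_sum_right)
    then show ?thesis by (simp add: power_divide)
  qed
  have bienayme: "integrable M (\<lambda>\<omega>. (\<Sum>i\<in>{1..n}. h (Xs i \<omega>))\<^sup>2)
    \<and> (\<integral>\<omega>. (\<Sum>i\<in>{1..n}. h (Xs i \<omega>))\<^sup>2 \<partial>M) = (\<Sum>i\<in>{1..n}. \<integral>\<omega>. (h (Xs i \<omega>))\<^sup>2 \<partial>M)"
  proof (rule expectation_sum_indep_sq)
    show "indep_vars (\<lambda>_. borel) (\<lambda>i \<omega>. h (Xs i \<omega>)) {1..n}"
      using indep_vars_compose2[OF indep, of "\<lambda>_. h" "\<lambda>_. borel"] by simp
    show "integrable M (\<lambda>\<omega>. h (Xs i \<omega>))" if "i \<in> {1..n}" for i
      using sample_transfer(1)[OF that h] ih by blast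
    show "(\<integral>\<omega>. h (Xs i \<omega>) \<partial>M) = 0" if "i \<in> {1..n}" for i
      using sample_transfer(2)[OF that h] mean by simp
    show "integrable M (\<lambda>\<omega>. (h (Xs i \<omega>))\<^sup>2)" if "i \<in> {1..n}" for i
      using sample_transfer(1)[OF that h2_meas] ih2 by blast
  qed simp
  also have "(\<Sum>i\<in>{1..n}. \<integral>\<omega>. (h (Xs i \<omega>))\<^sup>2 \<partial>M) = n * (\<integral>\<omega>. (h (X \<omega>))\<^sup>2 \<partial>M)"
    using sample_transfer(2)[OF _ h2_meas] by simp
  finally have b: "integrable M (\<lambda>\<omega>. (\<Sum>i\<in>{1..n}. h (Xs i \<omega>))\<^sup>2)"
    "(\<integral>\<omega>. (\<Sum>i\<in>{1..n}. h (Xs i \<omega>))\<^sup>2 \<partial>M) = n * (\<integral>\<omega>. (h (X \<omega>))\<^sup>2 \<partial>M)" by auto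
  show "integrable M (\<lambda>\<omega>. (a \<bullet> ((sample_second_moment n Xs \<omega> - second_moment M X) *v b))\<^sup>2)"
    unfolding eq using b(1) by simp
  show "(\<integral>\<omega>. (a \<bullet> ((sample_second_moment n Xs \<omega> - second_moment M X) *v b))\<^sup>2 \<partial>M)
      = (\<integral>\<omega>. (a \<bullet> X \<omega>)\<^sup>2 * (b \<bullet> X \<omega>)\<^sup>2 \<partial>M) / n"
    unfolding eq power_mult_distrib[symmetric] h_def[symmetric]
    using b(2) n by (simp add: power2_eq_square[of "real n"])
qed

end

end

section \<open>Reconstruction risk\<close>

text \<open>The reconstruction error is the squared length of the component of \<open>X\<close>
  outside the chosen subspace.\<close>

lemma recon_risk_column_matrix:
  fixes X :: "'a \<Rightarrow> real^'d" and e :: "'k::finite \<Rightarrow> nat" and v :: "nat \<Rightarrow> real^'d"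
  assumes v: "orthonormal_frame v" and e: "bij_betw e (UNIV :: 'k set) {1..k}" and k: "k \<le> CARD('d)"
    and int: "integrable M (\<lambda>\<omega>. outer (X \<omega>))" "integrable M (\<lambda>\<omega>. (norm (X \<omega>))\<^sup>2)"
  shows "recon_risk M X (span_class (column_matrix e v))
    = 1/2 * ((\<integral>\<omega>. (norm (X \<omega>))\<^sup>2 \<partial>M) - (\<Sum>j\<in>{1..k}. v j \<bullet> (second_moment M X *v v j)))"
proof -
  let ?U = "column_matrix e v"
  have e_range: "e c \<in> {1..CARD('d)}" for c using bij_betwE[OF e] k by fastforce
  have e_inj: "e c = e c' \<longleftrightarrow> c = c'" for c c' using e by (auto simp: bij_betw_def inj_on_def)
  have "transpose ?U ** ?U = mat 1"
  proof -
    have "(transpose ?U ** ?U) $ c $ c' = v (e c) \<bullet> v (e c')" for c c'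
      by (simp add: matrix_matrix_mult_def transpose_def column_matrix_def inner_vec_def)
    then show ?thesis
      using orthonormal_frameD[OF v e_range e_range] by (simp add: vec_eq_iff mat_def e_inj)
  qed
  then have st: "?U \<in> stiefel" by (simp add: stiefel_def)
  have proj: "(?U ** transpose ?U) *v x = (\<Sum>j\<in>{1..k}. (v j \<bullet> x) *\<^sub>R v j)" for x
  proof -
    have "(?U ** transpose ?U) *v x = ?U *v (transpose ?U *v x)" by (simp only: matrix_vector_mul_assoc)
    also have "\<dots> = (\<Sum>c\<in>UNIV. (v (e c) \<bullet> x) *\<^sub>R v (e c))"
      by (simp add: vec_eq_iff matrix_vector_mult_def transpose_def column_matrix_def inner_vec_def mult.commute)
    also have "\<dots> = (\<Sum>j\<in>{1..k}. (v j \<bullet> x) *\<^sub>R v j)"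
      by (rule sum.reindex_bij_betw[OF e])
    finally show ?thesis .
  qed
  have err: "(norm (x - (?U ** transpose ?U) *v x))\<^sup>2 = (norm x)\<^sup>2 - (\<Sum>j\<in>{1..k}. (v j \<bullet> x) * (v j \<bullet> x))" for x
  proof -
    let ?p = "\<Sum>j\<in>{1..k}. (v j \<bullet> x) *\<^sub>R v j"
    have vp: "v j \<bullet> ?p = v j \<bullet> x" if "j \<in> {1..k}" for j
    proof -
      have "v j \<bullet> ?p = (\<Sum>i\<in>{1..k}. if i = j then v j \<bullet> x else 0)"
        unfolding inner_sum_right using that k orthonormal_frameD[OF v]
        by (intro sum.cong) (auto simp: inner_commute)
      with that show ?thesis by simp
    qed
    have pp: "?p \<bullet> ?p = (\<Sum>j\<in>{1..k}. (v j \<bullet> x) * (v j \<bullet> x))"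
      by (subst (1) inner_sum_left) (use vp in simp)
    have px: "?p \<bullet> x = (\<Sum>j\<in>{1..k}. (v j \<bullet> x) * (v j \<bullet> x))"
      by (simp add: inner_sum_left)
    show ?thesis
      unfolding proj power2_norm_eq_inner
      by (simp only: inner_diff_left inner_diff_right inner_commute[of x ?p] pp px)
  qed
  have "(\<integral>\<omega>. (norm (X \<omega> - (?U ** transpose ?U) *v X \<omega>))\<^sup>2 \<partial>M)
      = (\<integral>\<omega>. (norm (X \<omega>))\<^sup>2 \<partial>M) - (\<Sum>j\<in>{1..k}. v j \<bullet> (second_moment M X *v v j))"
    unfolding err inner_second_moment(1)[OF int(1)]
    using int(2) inner_second_moment(2)[OF int(1)]
    by (subst Bochner_Integration.integral_diff) (auto simp: Bochner_Integration.integral_sum)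
  then show ?thesis by (simp only: recon_risk_span_class[OF st])
qed

section \<open>Nonnegativity of the variance parameters\<close>

lemma sum_eq_single:
  assumes "finite A" "x \<in> A" "\<And>i. i \<in> A \<Longrightarrow> i \<noteq> x \<Longrightarrow> f i = 0"
  shows "sum f A = f x"
  using assms sum.mono_neutral_right[of A "{x}" f] by auto

text \<open>The suprema that define the variance parameters are taken in the reals, so they dominate
  their members only if the objective is bounded above on the unit sphere. Boundedness is propagated
  through the polynomial expressions by the following closure rules.\<close>

definition bounded_over :: "'m set \<Rightarrow> ('m \<Rightarrow> real) \<Rightarrow> bool" where
  "bounded_over S f \<longleftrightarrow> (\<exists>c. \<forall>m\<in>S. \<bar>f m\<bar> \<le> c)"

lemma bounded_over_bdd_above: "bounded_over S f \<Longrightarrow> bdd_above (f ` S)"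
  unfolding bounded_over_def by (meson abs_le_D1 bdd_aboveI2)

lemma bounded_over_const: "bounded_over S (\<lambda>m. c)"
  unfolding bounded_over_def by (intro exI[of _ "\<bar>c\<bar>"]) auto

lemma bounded_over_add:
  assumes "bounded_over S f" "bounded_over S g"
  shows "bounded_over S (\<lambda>m. f m + g m)"
proof -
  obtain a b where ab: "\<forall>m\<in>S. \<bar>f m\<bar> \<le> a" "\<forall>m\<in>S. \<bar>g m\<bar> \<le> b"
    using assms by (auto simp: bounded_over_def)
  have "\<bar>f m + g m\<bar> \<le> a + b" if "m \<in> S" for m
    using ab(1)[rule_format, OF that] ab(2)[rule_format, OF that] by linarith
  then show ?thesis unfolding bounded_over_def by blast
qed

lemma bounded_over_mult:
  assumes "bounded_over S f" "bounded_over S g"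
  shows "bounded_over S (\<lambda>m. f m * g m)"
proof -
  obtain a b where ab: "\<forall>m\<in>S. \<bar>f m\<bar> \<le> a" "\<forall>m\<in>S. \<bar>g m\<bar> \<le> b"
    using assms by (auto simp: bounded_over_def)
  have "\<bar>f m * g m\<bar> \<le> a * b" if "m \<in> S" for m
    unfolding abs_mult
    using ab(1)[rule_format, OF that] ab(2)[rule_format, OF that]
    by (intro mult_mono) (auto intro: order_trans[OF abs_ge_zero])
  then show ?thesis unfolding bounded_over_def by blast
qed

lemma bounded_over_diff:
  assumes "bounded_over S f" "bounded_over S g"
  shows "bounded_over S (\<lambda>m. f m - g m)"
  using bounded_over_add[OF assms(1) bounded_over_mult[OF bounded_over_const[of S "-1"] assms(2)]] by simp

lemma bounded_over_divide: "bounded_over S f \<Longrightarrow> bounded_over S (\<lambda>m. f m / c)"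
  using bounded_over_mult[OF _ bounded_over_const[of S "1 / c"]] by simp

lemma bounded_over_sum: "(\<And>i. i \<in> A \<Longrightarrow> bounded_over S (f i)) \<Longrightarrow> bounded_over S (\<lambda>m. \<Sum>i\<in>A. f i m)"
  by (induction A rule: infinite_finite_induct) (auto intro: bounded_over_const bounded_over_add)

lemma bounded_over_entry:
  assumes "i \<in> {1..d-k}" "j \<in> {1..k}"
  shows "bounded_over {m. frob_norm d k m = 1} (\<lambda>m. m i j)"
  unfolding bounded_over_def
proof (intro exI[of _ 1] ballI)
  fix m :: "nat \<Rightarrow> nat \<Rightarrow> real" assume "m \<in> {m. frob_norm d k m = 1}"
  then have "(\<Sum>i\<in>{1..d-k}. \<Sum>j\<in>{1..k}. (m i j)\<^sup>2) = 1" by (simp add: frob_norm_def)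
  moreover have "(m i j)\<^sup>2 \<le> (\<Sum>j\<in>{1..k}. (m i j)\<^sup>2)" using assms by (intro member_le_sum) auto
  moreover have "(\<Sum>j\<in>{1..k}. (m i j)\<^sup>2) \<le> (\<Sum>i\<in>{1..d-k}. \<Sum>j\<in>{1..k}. (m i j)\<^sup>2)"
    using assms by (intro member_le_sum[of i]) (auto intro: sum_nonneg)
  ultimately have "(m i j)\<^sup>2 \<le> 1" by linarith
  then show "\<bar>m i j\<bar> \<le> 1" by (simp add: abs_square_le_1)
qed

lemmas bounded_over_intros = bounded_over_const bounded_over_add bounded_over_mult bounded_over_diff
  bounded_over_divide bounded_over_sum bounded_over_entry

text \<open>The test matrix with a single nonzero entry, at which both objectives reduce to a
  multiple of \<open>E ((X\<^sub>1\<^sup>2 - X\<^sub>k\<^sub>+\<^sub>1\<^sup>2)\<^sup>2)\<close>,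
  plus nonnegative terms.\<close>

definition corner :: "nat \<Rightarrow> nat \<Rightarrow> real" where
  "corner i j = (if i = 1 \<and> j = 1 then 1 else 0)"

lemma corner_eq: "corner (Suc 0) (Suc 0) = 1" "i \<noteq> 1 \<Longrightarrow> corner i j = 0" "j \<noteq> 1 \<Longrightarrow> corner i j = 0"
  by (auto simp: corner_def)

lemma frob_norm_corner:
  assumes "1 \<le> k" "k < d"
  shows "frob_norm d k corner = 1"
proof -
  have "(\<Sum>i\<in>{1..d-k}. \<Sum>j\<in>{1..k}. (corner i j)\<^sup>2) = (\<Sum>j\<in>{1..k}. (corner 1 j)\<^sup>2)"
    using assms by (intro sum_eq_single) (auto simp: corner_eq)
  also have "\<dots> = 1"
    using assms by (subst sum_eq_single[of _ 1]) (auto simp: corner_eq)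
  finally show ?thesis by (simp add: frob_norm_def)
qed

lemma fourth_moment_nonneg:
  assumes "b = a" "e = c"
  shows "0 \<le> fourth_moment M X u a b c e"
proof -
  have "0 \<le> (\<integral>\<omega>. ((X \<omega> \<bullet> u a) * (X \<omega> \<bullet> u c))\<^sup>2 \<partial>M)" by simp
  then show ?thesis unfolding fourth_moment_def assms by (simp add: power2_eq_square mult_ac)
qed

lemma fourth_moment_diff_nonneg:
  assumes int: "integrable M (\<lambda>\<omega>. (X \<omega> \<bullet> u a) * (X \<omega> \<bullet> u a) * (X \<omega> \<bullet> u a) * (X \<omega> \<bullet> u a))"
    "integrable M (\<lambda>\<omega>. (X \<omega> \<bullet> u b) * (X \<omega> \<bullet> u a) * (X \<omega> \<bullet> u b) * (X \<omega> \<bullet> u a))"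
    "integrable M (\<lambda>\<omega>. (X \<omega> \<bullet> u b) * (X \<omega> \<bullet> u b) * (X \<omega> \<bullet> u b) * (X \<omega> \<bullet> u b))"
  shows "0 \<le> fourth_moment M X u a a a a - 2 * fourth_moment M X u b a b a + fourth_moment M X u b b b b"
proof -
  have "0 \<le> (\<integral>\<omega>. ((X \<omega> \<bullet> u a)\<^sup>2 - (X \<omega> \<bullet> u b)\<^sup>2)\<^sup>2 \<partial>M)" by simp
  also have "(\<lambda>\<omega>. ((X \<omega> \<bullet> u a)\<^sup>2 - (X \<omega> \<bullet> u b)\<^sup>2)\<^sup>2)
    = (\<lambda>\<omega>. (X \<omega> \<bullet> u a) * (X \<omega> \<bullet> u a) * (X \<omega> \<bullet> u a) * (X \<omega> \<bullet> u a)
      - 2 * ((X \<omega> \<bullet> u b) * (X \<omega> \<bullet> u a) * (X \<omega> \<bullet> u b) * (X \<omega> \<bullet> u a))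
      + (X \<omega> \<bullet> u b) * (X \<omega> \<bullet> u b) * (X \<omega> \<bullet> u b) * (X \<omega> \<bullet> u b))"
    by (intro ext) (simp add: power2_eq_square algebra_simps)
  also have "(\<integral>\<omega>. \<dots> \<omega> \<partial>M) = fourth_moment M X u a a a a - 2 * fourth_moment M X u b a b a + fourth_moment M X u b b b b"
    unfolding fourth_moment_def using int by simp
  finally show ?thesis .
qed

lemma V_param_nonneg:
  fixes X :: "'a \<Rightarrow> real^'d"
  assumes k: "1 \<le> k" "k < CARD('d)"
    and pos: "\<And>i j. i \<in> {1..CARD('d)-k} \<Longrightarrow> j \<in> {1..k} \<Longrightarrow> 0 < gap k lam i j"
    and core: "0 \<le> Gamma_m M X u 1 1 1 1 - 2 * Lambda_m M X u k 1 1 1 1 + Omega_m M X u k 1 1 1 1"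
  shows "0 \<le> V_param M X lam u k"
proof -
  let ?d = "CARD('d)" and ?g = "gap k lam" and ?S = "{m. frob_norm CARD('d) k m = 1}"
  let ?G = "\<lambda>m. (\<Sum>j\<in>{1..k}. \<Sum>r\<in>{1..k}. \<Sum>p\<in>{1..k}. a_coef ?d k ?g m j r p * Gamma_m M X u j j r p)"
  let ?L = "\<lambda>m. (\<Sum>i\<in>{1..?d-k}. \<Sum>t\<in>{1..?d-k}. \<Sum>j\<in>{1..k}. \<Sum>s\<in>{1..k}.
                b_coef ?g m i j t s * Lambda_m M X u k i j t s)"
  let ?O = "\<lambda>m. (\<Sum>i\<in>{1..?d-k}. \<Sum>q\<in>{1..?d-k}. \<Sum>l\<in>{1..?d-k}. c_coef k ?g m i q l * Omega_m M X u k i i q l)"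
  let ?f = "\<lambda>m. ?G m - 2 * ?L m + ?O m"
  have V: "V_param M X lam u k = (SUP m\<in>?S. ?f m)"
    by (simp only: V_param_def Let_def)
  have "bounded_over ?S ?f"
    unfolding a_coef_def b_coef_def c_coef_def by (intro bounded_over_intros)
  then have "?f corner \<le> V_param M X lam u k"
    unfolding V using frob_norm_corner[OF k] by (intro cSUP_upper bounded_over_bdd_above) auto
  moreover have "0 \<le> ?f corner"
  proof -
    have one: "1 \<in> {1..?d-k}" "1 \<in> {1..k}" using k by auto
    have g11: "0 < ?g 1 1" using pos one by blast
    have a: "a_coef ?d k ?g corner j r p = (if r = 1 \<and> p = 1 then 1 / (?g 1 j * ?g 1 1) else 0)" for j r p
    proof -
      have "a_coef ?d k ?g corner j r p = (corner 1 r * corner 1 p) / (?g 1 j * sqrt (?g 1 r * ?g 1 p))"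
        unfolding a_coef_def using one by (intro sum_eq_single) (auto simp: corner_eq)
      then show ?thesis using g11 by (auto simp: corner_def)
    qed
    have c: "c_coef k ?g corner i q l = (if q = 1 \<and> l = 1 then 1 / (?g i 1 * ?g 1 1) else 0)" for i q l
    proof -
      have "c_coef k ?g corner i q l = (corner q 1 * corner l 1) / (?g i 1 * sqrt (?g q 1 * ?g l 1))"
        unfolding c_coef_def using one by (intro sum_eq_single) (auto simp: corner_eq)
      then show ?thesis using g11 by (auto simp: corner_def)
    qed
    have G: "?G corner = (\<Sum>j\<in>{1..k}. 1 / (?g 1 j * ?g 1 1) * Gamma_m M X u j j 1 1)"
    proof (rule sum.cong[OF refl])
      fix j
      have "(\<Sum>r\<in>{1..k}. \<Sum>p\<in>{1..k}. a_coef ?d k ?g corner j r p * Gamma_m M X u j j r p)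
          = (\<Sum>p\<in>{1..k}. a_coef ?d k ?g corner j 1 p * Gamma_m M X u j j 1 p)"
        using one by (intro sum_eq_single) (auto simp: a)
      also have "\<dots> = a_coef ?d k ?g corner j 1 1 * Gamma_m M X u j j 1 1"
        using one by (intro sum_eq_single) (auto simp: a)
      finally show "(\<Sum>r\<in>{1..k}. \<Sum>p\<in>{1..k}. a_coef ?d k ?g corner j r p * Gamma_m M X u j j r p)
          = 1 / (?g 1 j * ?g 1 1) * Gamma_m M X u j j 1 1" by (simp add: a)
    qed
    have O: "?O corner = (\<Sum>i\<in>{1..?d-k}. 1 / (?g i 1 * ?g 1 1) * Omega_m M X u k i i 1 1)"
    proof (rule sum.cong[OF refl])
      fix i
      have "(\<Sum>q\<in>{1..?d-k}. \<Sum>l\<in>{1..?d-k}. c_coef k ?g corner i q l * Omega_m M X u k i i q l)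
          = (\<Sum>l\<in>{1..?d-k}. c_coef k ?g corner i 1 l * Omega_m M X u k i i 1 l)"
        using one by (intro sum_eq_single) (auto simp: c)
      also have "\<dots> = c_coef k ?g corner i 1 1 * Omega_m M X u k i i 1 1"
        using one by (intro sum_eq_single) (auto simp: c)
      finally show "(\<Sum>q\<in>{1..?d-k}. \<Sum>l\<in>{1..?d-k}. c_coef k ?g corner i q l * Omega_m M X u k i i q l)
          = 1 / (?g i 1 * ?g 1 1) * Omega_m M X u k i i 1 1" by (simp add: c)
    qed
    have b0: "b_coef ?g corner i j t s = 0" if "i \<noteq> 1 \<or> t \<noteq> 1 \<or> j \<noteq> 1 \<or> s \<noteq> 1" for i j t s
      using that by (auto simp: b_coef_def corner_def)
    have L: "?L corner = 1 / (?g 1 1 * ?g 1 1) * Lambda_m M X u k 1 1 1 1"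
    proof -
      have "?L corner = (\<Sum>t\<in>{1..?d-k}. \<Sum>j\<in>{1..k}. \<Sum>s\<in>{1..k}. b_coef ?g corner 1 j t s * Lambda_m M X u k 1 j t s)"
        using one by (intro sum_eq_single) (auto simp: b0)
      also have "\<dots> = (\<Sum>j\<in>{1..k}. \<Sum>s\<in>{1..k}. b_coef ?g corner 1 j 1 s * Lambda_m M X u k 1 j 1 s)"
        using one by (intro sum_eq_single) (auto simp: b0)
      also have "\<dots> = (\<Sum>s\<in>{1..k}. b_coef ?g corner 1 1 1 s * Lambda_m M X u k 1 1 1 s)"
        using one by (intro sum_eq_single) (auto simp: b0)
      also have "\<dots> = b_coef ?g corner 1 1 1 1 * Lambda_m M X u k 1 1 1 1"
        using one by (intro sum_eq_single) (auto simp: b0)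
      finally show ?thesis using g11 by (simp add: b_coef_def corner_eq)
    qed
    have "1 / (?g 1 1 * ?g 1 1) * Gamma_m M X u 1 1 1 1 \<le> ?G corner"
      unfolding G
    proof (rule member_le_sum[OF one(2), where f = "\<lambda>j. 1 / (?g 1 j * ?g 1 1) * Gamma_m M X u j j 1 1"])
      fix j assume "j \<in> {1..k} - {1}"
      then have "0 < ?g 1 j" using pos[OF one(1)] by blast
      then show "0 \<le> 1 / (?g 1 j * ?g 1 1) * Gamma_m M X u j j 1 1"
        using g11 unfolding Gamma_m_def by (intro mult_nonneg_nonneg fourth_moment_nonneg) auto
    qed simp
    moreover have "1 / (?g 1 1 * ?g 1 1) * Omega_m M X u k 1 1 1 1 \<le> ?O corner"
      unfolding O
    proof (rule member_le_sum[OF one(1), where f = "\<lambda>i. 1 / (?g i 1 * ?g 1 1) * Omega_m M X u k i i 1 1"])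
      fix i assume "i \<in> {1..?d-k} - {1}"
      then have "0 < ?g i 1" using pos[OF _ one(2)] by blast
      then show "0 \<le> 1 / (?g i 1 * ?g 1 1) * Omega_m M X u k i i 1 1"
        using g11 unfolding Omega_m_def by (intro mult_nonneg_nonneg fourth_moment_nonneg) auto
    qed simp
    moreover have "0 \<le> 1 / (?g 1 1 * ?g 1 1) * (Gamma_m M X u 1 1 1 1 - 2 * Lambda_m M X u k 1 1 1 1 + Omega_m M X u k 1 1 1 1)"
      using g11 core by (intro mult_nonneg_nonneg) auto
    then have "0 \<le> 1 / (?g 1 1 * ?g 1 1) * Gamma_m M X u 1 1 1 1
        - 2 * (1 / (?g 1 1 * ?g 1 1) * Lambda_m M X u k 1 1 1 1) + 1 / (?g 1 1 * ?g 1 1) * Omega_m M X u k 1 1 1 1"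
      by (simp only: distrib_left right_diff_distrib mult.left_commute)
    ultimately show ?thesis unfolding L by linarith
  qed
  ultimately show ?thesis by linarith
qed

lemma nu_param_nonneg:
  fixes X :: "'a \<Rightarrow> real^'d"
  assumes k: "1 \<le> k" "k < CARD('d)"
    and core: "0 \<le> Gamma_m M X u 1 1 1 1 - 2 * Lambda_m M X u k 1 1 1 1 + Omega_m M X u k 1 1 1 1"
  shows "0 \<le> nu_param M X lam u k"
proof -
  let ?d = "CARD('d)" and ?g = "gap k lam" and ?S = "{m. frob_norm CARD('d) k m = 1}"
  let ?G = "\<lambda>m. (\<Sum>j\<in>{1..k}. \<Sum>s\<in>{1..k}. \<Sum>r\<in>{1..k}. \<Sum>p\<in>{1..k}.
          alpha_coef ?d k ?g m j s r p * Gamma_m M X u j s r p)"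
  let ?L = "\<lambda>m. (\<Sum>t\<in>{1..?d-k}. \<Sum>q\<in>{1..?d-k}. \<Sum>s\<in>{1..k}. \<Sum>r\<in>{1..k}.
                beta_coef ?d k ?g m t s q r * Lambda_m M X u k t s q r)"
  let ?O = "\<lambda>m. (\<Sum>i\<in>{1..?d-k}. \<Sum>t\<in>{1..?d-k}. \<Sum>q\<in>{1..?d-k}. \<Sum>l\<in>{1..?d-k}.
            kappa_coef k ?g m i t q l * Omega_m M X u k i t q l)"
  let ?f = "\<lambda>m. ?G m - 2 * ?L m + ?O m"
  let ?w = "1 / sqrt (?g 1 1 * ?g 1 1 * ?g 1 1 * ?g 1 1)"
  have V: "nu_param M X lam u k = (SUP m\<in>?S. ?f m)"
    by (simp only: nu_param_def Let_def)
  have "bounded_over ?S ?f"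
    unfolding alpha_coef_def beta_coef_def kappa_coef_def by (intro bounded_over_intros)
  then have "?f corner \<le> nu_param M X lam u k"
    unfolding V using frob_norm_corner[OF k] by (intro cSUP_upper bounded_over_bdd_above) auto
  moreover have "0 \<le> ?f corner"
  proof -
    have one: "1 \<in> {1..?d-k}" "1 \<in> {1..k}" using k by auto
    have single4: "(\<Sum>a\<in>A. \<Sum>b\<in>B. \<Sum>c\<in>C. \<Sum>e\<in>D. h a b c e * F a b c e) = h 1 1 1 1 * F 1 1 1 1"
      if "finite A" "finite B" "finite C" "finite D" "1 \<in> A" "1 \<in> B" "1 \<in> C" "1 \<in> D"
        and h0: "\<And>a b c e. a \<noteq> 1 \<or> b \<noteq> 1 \<or> c \<noteq> 1 \<or> e \<noteq> 1 \<Longrightarrow> h a b c e = 0"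
      for A B C D :: "nat set" and h F :: "nat \<Rightarrow> nat \<Rightarrow> nat \<Rightarrow> nat \<Rightarrow> real"
    proof -
      have "(\<Sum>a\<in>A. \<Sum>b\<in>B. \<Sum>c\<in>C. \<Sum>e\<in>D. h a b c e * F a b c e)
          = (\<Sum>b\<in>B. \<Sum>c\<in>C. \<Sum>e\<in>D. h 1 b c e * F 1 b c e)"
        using that by (intro sum_eq_single) auto
      also have "\<dots> = (\<Sum>c\<in>C. \<Sum>e\<in>D. h 1 1 c e * F 1 1 c e)"
        using that by (intro sum_eq_single) auto
      also have "\<dots> = (\<Sum>e\<in>D. h 1 1 1 e * F 1 1 1 e)"
        using that by (intro sum_eq_single) auto
      also have "\<dots> = h 1 1 1 1 * F 1 1 1 1"
        using that by (intro sum_eq_single) auto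
      finally show ?thesis .
    qed
    have alpha: "alpha_coef ?d k ?g corner j s r p = (if j = 1 \<and> s = 1 \<and> r = 1 \<and> p = 1 then ?w else 0)" for j s r p
    proof -
      have "alpha_coef ?d k ?g corner j s r p
          = (\<Sum>t\<in>{1..?d-k}. (corner 1 j * corner 1 s * corner t r * corner t p) / sqrt (?g 1 j * ?g 1 s * ?g t r * ?g t p))"
        unfolding alpha_coef_def using one by (intro sum_eq_single) (auto simp: corner_eq)
      also have "\<dots> = (corner 1 j * corner 1 s * corner 1 r * corner 1 p) / sqrt (?g 1 j * ?g 1 s * ?g 1 r * ?g 1 p)"
        using one by (intro sum_eq_single) (auto simp: corner_eq)
      finally show ?thesis by (auto simp: corner_def)
    qed
    have beta: "beta_coef ?d k ?g corner t s q r = (if t = 1 \<and> q = 1 \<and> s = 1 \<and> r = 1 then ?w else 0)" for t s q r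
    proof -
      have "beta_coef ?d k ?g corner t s q r
          = (\<Sum>j\<in>{1..k}. (corner t j * corner 1 s * corner q j * corner 1 r) / sqrt (?g t j * ?g 1 s * ?g q j * ?g 1 r))"
        unfolding beta_coef_def using one by (intro sum_eq_single) (auto simp: corner_eq)
      also have "\<dots> = (corner t 1 * corner 1 s * corner q 1 * corner 1 r) / sqrt (?g t 1 * ?g 1 s * ?g q 1 * ?g 1 r)"
        using one by (intro sum_eq_single) (auto simp: corner_eq)
      finally show ?thesis by (auto simp: corner_def)
    qed
    have kappa: "kappa_coef k ?g corner i t q l = (if i = 1 \<and> t = 1 \<and> q = 1 \<and> l = 1 then ?w else 0)" for i t q l
    proof -
      have "kappa_coef k ?g corner i t q l
          = (\<Sum>s\<in>{1..k}. (corner i 1 * corner t 1 * corner q s * corner l s) / sqrt (?g i 1 * ?g t 1 * ?g q s * ?g l s))"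
        unfolding kappa_coef_def using one by (intro sum_eq_single) (auto simp: corner_eq)
      also have "\<dots> = (corner i 1 * corner t 1 * corner q 1 * corner l 1) / sqrt (?g i 1 * ?g t 1 * ?g q 1 * ?g l 1)"
        using one by (intro sum_eq_single) (auto simp: corner_eq)
      finally show ?thesis by (auto simp: corner_def)
    qed
    have G: "?G corner = ?w * Gamma_m M X u 1 1 1 1"
      by (subst single4) (use one in \<open>auto simp: alpha\<close>)
    have O: "?O corner = ?w * Omega_m M X u k 1 1 1 1"
      by (subst single4) (use one in \<open>auto simp: kappa\<close>)
    have L: "?L corner = ?w * Lambda_m M X u k 1 1 1 1"
      by (subst single4[of _ _ _ _ "\<lambda>t q s r. beta_coef ?d k ?g corner t s q r" "\<lambda>t q s r. Lambda_m M X u k t s q r"])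
        (use one in \<open>auto simp: beta\<close>)
    have "?f corner = ?w * (Gamma_m M X u 1 1 1 1 - 2 * Lambda_m M X u k 1 1 1 1 + Omega_m M X u k 1 1 1 1)"
      unfolding G O L by (simp only: distrib_left right_diff_distrib mult.left_commute)
    also have "0 \<le> \<dots>"
    proof (rule mult_nonneg_nonneg[OF _ core])
      have "0 \<le> ?g 1 1 * ?g 1 1 * ?g 1 1 * ?g 1 1"
        using zero_le_square[of "?g 1 1 * ?g 1 1"] by (simp only: mult.assoc)
      then show "0 \<le> ?w" by (rule divide_nonneg_nonneg[OF zero_le_one real_sqrt_ge_zero])
    qed
    finally show ?thesis .
  qed
  ultimately show ?thesis by linarith
qed

section \<open>The excess risk bound\<close>

text \<open>If \<open>6 y\<^sup>2 + 6/5 \<theta>\<^sup>2 < 1\<close> with \<open>y\<^sup>2 = 2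
  \<delta> g / (75 a)\<close>, then \<open>y < 1 - \<theta>\<close>, since \<open>(\<theta> +
  y)\<^sup>2 \<le> 6/5 \<theta>\<^sup>2 + 6 y\<^sup>2\<close>. The expectation of the left-hand side
  is at most \<open>(12/75 + 4/5) \<delta> \<le> \<delta>\<close>, and Markov's inequality
  applies.\<close>

lemma (in prob_space) joint_markov:
  fixes \<theta> g :: "'a \<Rightarrow> real"
  assumes g: "integrable M g" "\<And>\<omega>. 0 \<le> g \<omega>" "(\<integral>\<omega>. g \<omega> \<partial>M) \<le> a"
    and \<theta>: "\<theta> \<in> borel_measurable M" "integrable M (\<lambda>\<omega>. (\<theta> \<omega>)\<^sup>2)"
      "(\<integral>\<omega>. (\<theta> \<omega>)\<^sup>2 \<partial>M) \<le> 2 / 3 * \<delta>"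
    and \<delta>: "0 < \<delta>"
  shows "\<exists>A\<in>sets M. prob A \<ge> 1 - \<delta> \<and> (\<forall>\<omega>\<in>A. \<theta> \<omega> < 1 \<and> 2 * \<delta> * g \<omega> \<le> 75 * a * (1 - \<theta> \<omega>)\<^sup>2)"
proof -
  note [measurable] = \<theta>(1) borel_measurable_integrable[OF g(1)]
  have less1: "x < 1" if "6 / 5 * x\<^sup>2 < 1" for x :: real
  proof (rule ccontr)
    assume "\<not> x < 1"
    then have "1 \<le> x\<^sup>2" by (simp add: one_le_power)
    with that show False by simp
  qed
  have markov: "prob {\<omega> \<in> space M. W \<omega> < 1} \<ge> 1 - \<delta>"
    if W: "integrable M W" "\<And>\<omega>. 0 \<le> W \<omega>" "(\<integral>\<omega>. W \<omega> \<partial>M) \<le> \<delta>" for W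
  proof -
    have [measurable]: "W \<in> borel_measurable M" using W(1) by simp
    have "prob {\<omega> \<in> space M. 1 \<le> W \<omega>} \<le> \<delta>"
      using integral_Markov_inequality_measure[OF W(1), of "{}" 1] W(2,3) by simp
    moreover have "prob {\<omega> \<in> space M. \<not> 1 \<le> W \<omega>} = 1 - prob {\<omega> \<in> space M. 1 \<le> W \<omega>}"
      by (rule prob_neg) measurable
    ultimately show ?thesis by (simp add: not_le)
  qed
  have Eg: "0 \<le> (\<integral>\<omega>. g \<omega> \<partial>M)" using g(2) by simp
  then have a0: "0 \<le> a" using g(3) by linarith
  show ?thesis
  proof (cases "a = 0")
    case False
    with a0 have a: "0 < a" by simp
    define W where "W \<omega> = 12 * \<delta> / (75 * a) * g \<omega> + 6 / 5 * (\<theta> \<omega>)\<^sup>2" for \<omega>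
    have "(\<integral>\<omega>. W \<omega> \<partial>M) = 12 * \<delta> / (75 * a) * (\<integral>\<omega>. g \<omega> \<partial>M) + 6 / 5 * (\<integral>\<omega>. (\<theta> \<omega>)\<^sup>2 \<partial>M)"
      unfolding W_def using g \<theta> by simp
    also have "\<dots> \<le> 12 * \<delta> / (75 * a) * a + 6 / 5 * (2 / 3 * \<delta>)"
      using a \<delta> g \<theta> by (intro add_mono mult_left_mono) auto
    also have "\<dots> \<le> \<delta>" using a \<delta> by simp
    finally have EW: "(\<integral>\<omega>. W \<omega> \<partial>M) \<le> \<delta>" .
    have W0: "0 \<le> W \<omega>" for \<omega> unfolding W_def using g(2) a \<delta> by simp
    have intW: "integrable M W" unfolding W_def using g \<theta> by simp
    have good: "\<theta> \<omega> < 1 \<and> 2 * \<delta> * g \<omega> \<le> 75 * a * (1 - \<theta> \<omega>)\<^sup>2" if "W \<omega> < 1" for \<omega>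
    proof
      have "0 \<le> 12 * \<delta> / (75 * a) * g \<omega>" using a \<delta> g(2) by simp
      then show "\<theta> \<omega> < 1" using that less1 unfolding W_def by simp
      \<comment> \<open>the weights 6 and 6/5 are conjugate, so that the quadratic polynomial in \<open>\<theta>\<close> is a perfect square\<close>
      have "0 \<le> 36 / 5 * (\<theta> \<omega> - 5 / 6)\<^sup>2" by simp
      then have "1 - 6 / 5 * (\<theta> \<omega>)\<^sup>2 \<le> 6 * (1 - \<theta> \<omega>)\<^sup>2" by (simp add: power2_eq_square algebra_simps)
      with that have "12 * \<delta> / (75 * a) * g \<omega> \<le> 6 * (1 - \<theta> \<omega>)\<^sup>2" unfolding W_def by simp
      then show "2 * \<delta> * g \<omega> \<le> 75 * a * (1 - \<theta> \<omega>)\<^sup>2" using a by (simp add: field_simps)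
    qed
    show ?thesis
      by (rule bexI[of _ "{\<omega> \<in> space M. W \<omega> < 1}"])
        (use markov[OF intW W0 EW] good in \<open>auto simp: W_def\<close>)
  next
    case True
    have "(\<integral>\<omega>. g \<omega> \<partial>M) = 0" using Eg g(3) True by linarith
    \<comment> \<open>for \<open>a = 0\<close> the claimed bound on \<open>g\<close> says that \<open>g = 0\<close>, an almost sure event\<close>
    then have AE: "AE \<omega> in M. g \<omega> = 0" using g by (subst (asm) integral_nonneg_eq_0_iff_AE) auto
    let ?A = "{\<omega> \<in> space M. 6 / 5 * (\<theta> \<omega>)\<^sup>2 < 1}"
    have "prob ?A \<ge> 1 - \<delta>" using \<theta> \<delta> by (intro markov) auto
    moreover have "prob ?A = prob {\<omega> \<in> ?A. g \<omega> = 0}"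
      using AE by (intro finite_measure_eq_AE) auto
    ultimately show ?thesis
      by (intro bexI[of _ "{\<omega> \<in> ?A. g \<omega> = 0}"]) (auto simp: True less1)
  qed
qed

theorem theorem2:
  fixes M :: "'a measure"
    and X :: "'a \<Rightarrow> real^'d"
    and Xs :: "nat \<Rightarrow> 'a \<Rightarrow> real^'d"
    and e :: "'k::finite \<Rightarrow> nat"
    and d k n :: nat
    and lam :: "nat \<Rightarrow> real" and u :: "nat \<Rightarrow> real^'d"
    and lam_n :: "'a \<Rightarrow> nat \<Rightarrow> real" and u_n :: "'a \<Rightarrow> nat \<Rightarrow> real^'d"
    and \<delta> :: real
  assumes "prob_space M"
    and dims: "d = CARD('d)" "k = CARD('k)" "1 \<le> k" "k < d"
    and e: "bij_betw e (UNIV :: 'k set) {1..k}"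
    and X: "X \<in> borel_measurable M"
    and n: "1 \<le> n"
    and indep: "prob_space.indep_vars M (\<lambda>_. borel) Xs {1..n}"
    and ident: "\<And>i. i \<in> {1..n} \<Longrightarrow> distr M borel (Xs i) = distr M borel X"
    and moment: "\<And>j. integrable M (\<lambda>\<omega>. (X \<omega> $ j) ^ 4)"
    and eig: "ordered_eigenbasis (second_moment M X) lam u"
    and eig_n: "\<And>\<omega>. \<omega> \<in> space M \<Longrightarrow>
          ordered_eigenbasis (sample_second_moment n Xs \<omega>) (lam_n \<omega>) (u_n \<omega>)"
    and gap: "lam k > lam (k + 1)"
    and \<delta>: "0 < \<delta>" "\<delta> < 1"
    and sample_size:
      "real n \<ge> (32 * V_param M X lam u k + 4) * ln (3 * real k * real (d - k))
              + (16 * nu_param M X lam u k + 8) * ln (4 / \<delta>)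
              + 16 * (S_param M X + r_param M X Xs n) / (\<delta> * (lam k - lam (k + 1))\<^sup>2)"
  shows "\<exists>A \<in> sets M. measure M A \<ge> 1 - \<delta> \<and>
    (\<forall>\<omega>\<in>A. recon_risk M X (span_class (column_matrix e (u_n \<omega>)))
            - recon_risk M X (span_class (column_matrix e u))
          \<le> 75 / (real n * \<delta>) *
             (\<Sum>i\<in>{1..d-k}. \<Sum>j\<in>{1..k}.
                (\<integral>\<omega>'. (u (k + i) \<bullet> X \<omega>')\<^sup>2 * (u j \<bullet> X \<omega>')\<^sup>2 \<partial>M) / (lam j - lam (k + i))))"
proof -
  interpret prob_space M by fact
  define D where "D \<omega> = sample_second_moment n Xs \<omega> - second_moment M X" for \<omega>
  define \<gamma> where "\<gamma> = lam k - lam (k + 1)"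
  define \<theta> where "\<theta> \<omega> = 2 * op_norm (D \<omega>) / \<gamma>" for \<omega>
  define g where "g \<omega> = (\<Sum>i\<in>{1..d-k}. \<Sum>j\<in>{1..k}.
      (u (k + i) \<bullet> (D \<omega> *v u j))\<^sup>2 / (lam j - lam (k + i)))" for \<omega>
  define G where "G = (\<Sum>i\<in>{1..d-k}. \<Sum>j\<in>{1..k}.
      (\<integral>\<omega>'. (u (k + i) \<bullet> X \<omega>')\<^sup>2 * (u j \<bullet> X \<omega>')\<^sup>2 \<partial>M) / (lam j - lam (k + i)))"
  define SR where "SR = S_param M X + r_param M X Xs n"
  note [measurable] = X
  have kd: "1 \<le> k" "k < CARD('d)" "k \<le> CARD('d)" "2 \<le> CARD('d)"
    using dims(3,4) unfolding dims(1) by linarith+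
  note u = ordered_eigenbasis_frame[OF eig]
  have pow4: "integrable M (\<lambda>\<omega>. norm (X \<omega>) ^ 4)" by (rule integrable_norm_pow4[OF X moment])
  have pow2: "integrable M (\<lambda>\<omega>. (norm (X \<omega>))\<^sup>2)" by (rule integrable_norm_pow2[OF X pow4])
  have \<gamma>: "0 < \<gamma>" using gap by (simp add: \<gamma>_def)
  have gap_pos: "0 < lam j - lam (k + i)" if "i \<in> {1..d-k}" "j \<in> {1..k}" for i j
  proof -
    have "lam (k + i) \<le> lam (k + 1)" "lam k \<le> lam j"
      using that dims ordered_eigenbasis_antimono[OF eig, of "k+1" "k+i"]
        ordered_eigenbasis_antimono[OF eig, of j k] by auto
    with gap show ?thesis by simp
  qed

  have n9: "9 \<le> n" and SR: "16 * SR / (\<delta> * \<gamma>\<^sup>2) \<le> n"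
  proof -
    have core: "0 \<le> Gamma_m M X u 1 1 1 1 - 2 * Lambda_m M X u k 1 1 1 1 + Omega_m M X u k 1 1 1 1"
      unfolding Gamma_m_def Lambda_m_def Omega_m_def
      by (rule fourth_moment_diff_nonneg) (rule integrable_inner_pow4[OF X pow4])+
    have "0 \<le> V_param M X lam u k"
      by (rule V_param_nonneg[OF kd(1,2) _ core]) (use gap_pos dims in \<open>auto simp: gap_def\<close>)
    moreover have "0 \<le> nu_param M X lam u k" by (rule nu_param_nonneg[OF kd(1,2) core])
    moreover have "1 \<le> ln (3 * real k * real (d - k))"
    proof -
      have "3 * 1 * 1 \<le> 3 * real k * real (d - k)" using dims by (intro mult_mono) auto
      then have "exp 1 \<le> 3 * real k * real (d - k)" using exp_le by linarith
      then show ?thesis using dims by (subst ln_ge_iff) auto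
    qed
    moreover have "1 \<le> ln (4 / \<delta>)"
    proof -
      have "4 \<le> 4 / \<delta>" using \<delta> by (simp add: field_simps)
      then have "exp 1 \<le> 4 / \<delta>" using exp_le by linarith
      then show ?thesis using \<delta> by (subst ln_ge_iff) auto
    qed
    ultimately have "4 * 1 + 8 * 1 \<le> (32 * V_param M X lam u k + 4) * ln (3 * real k * real (d - k))
        + (16 * nu_param M X lam u k + 8) * ln (4 / \<delta>)"
      by (intro add_mono mult_mono) auto
    moreover have "0 \<le> 16 * SR / (\<delta> * \<gamma>\<^sup>2)"
    proof -
      have "0 \<le> ln (real CARD('d))" using kd by simp
      then have "0 \<le> \<lceil>ln (real CARD('d))\<rceil>" by linarith
      then have "0 \<le> c_dim CARD('d)" by (simp add: c_dim_def)
      moreover have "0 \<le> (MAX i\<in>{1..n}. (op_norm (outer (Xs i \<omega>) - second_moment M X))\<^sup>2)" for \<omega>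
        using n by (subst Max_ge_iff) auto
      ultimately have "0 \<le> SR"
        unfolding SR_def S_param_def r_param_def
        by (intro add_nonneg_nonneg mult_nonneg_nonneg Bochner_Integration.integral_nonneg) auto
      then show ?thesis using \<delta> by simp
    qed
    ultimately have "12 \<le> real n" "16 * SR / (\<delta> * \<gamma>\<^sup>2) \<le> n"
      using sample_size unfolding SR_def \<gamma>_def by linarith+
    then show "9 \<le> n" "16 * SR / (\<delta> * \<gamma>\<^sup>2) \<le> n" by auto
  qed

  have int\<theta>: "integrable M (\<lambda>\<omega>. (\<theta> \<omega>)\<^sup>2)" and E\<theta>: "(\<integral>\<omega>. (\<theta> \<omega>)\<^sup>2 \<partial>M) \<le> 2 / 3 * \<delta>"
  proof -
    note dev = expected_sample_deviation_sq[OF X n indep ident pow4 n9 kd(4), folded D_def SR_def]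
    have eq: "(\<theta> \<omega>)\<^sup>2 = 4 / \<gamma>\<^sup>2 * (op_norm (D \<omega>))\<^sup>2" for \<omega>
      by (simp add: \<theta>_def power_divide power_mult_distrib)
    show "integrable M (\<lambda>\<omega>. (\<theta> \<omega>)\<^sup>2)" unfolding eq using dev(1) by simp
    have "(\<integral>\<omega>. (\<theta> \<omega>)\<^sup>2 \<partial>M) = 4 / \<gamma>\<^sup>2 * (\<integral>\<omega>. (op_norm (D \<omega>))\<^sup>2 \<partial>M)" unfolding eq by simp
    also have "\<dots> \<le> 4 / \<gamma>\<^sup>2 * (8 / 3 * SR / n)" by (intro mult_left_mono dev(2)) auto
    also have "\<dots> = 2 / 3 * \<delta> * ((16 * SR / (\<delta> * \<gamma>\<^sup>2)) / n)" using \<delta> by (simp add: field_simps)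
    also have "\<dots> \<le> 2 / 3 * \<delta> * 1"
    proof (rule mult_left_mono)
      have "0 < real n" using n by simp
      then show "16 * SR / (\<delta> * \<gamma>\<^sup>2) / n \<le> 1" using SR by (subst divide_le_eq_1_pos)
    qed (use \<delta> in simp)
    finally show "(\<integral>\<omega>. (\<theta> \<omega>)\<^sup>2 \<partial>M) \<le> 2 / 3 * \<delta>" by simp
  qed

  have intg: "integrable M g" and Eg: "(\<integral>\<omega>. g \<omega> \<partial>M) = G / n"
  proof -
    have cross: "integrable M (\<lambda>\<omega>. (u (k + i) \<bullet> (D \<omega> *v u j))\<^sup>2)"
      "(\<integral>\<omega>. (u (k + i) \<bullet> (D \<omega> *v u j))\<^sup>2 \<partial>M) = (\<integral>\<omega>. (u (k + i) \<bullet> X \<omega>)\<^sup>2 * (u j \<bullet> X \<omega>)\<^sup>2 \<partial>M) / n"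
      if "i \<in> {1..d-k}" "j \<in> {1..k}" for i j
    proof -
      have "k + i \<le> d" "j \<le> d" using that dims(4) by auto
      then have ki: "k + i \<in> {1..CARD('d)}" "j \<in> {1..CARD('d)}" "k + i \<noteq> j"
        using that unfolding dims(1) by auto
      have "second_moment M X *v u j = lam j *\<^sub>R u j" using eig that kd by (simp add: ordered_eigenbasis_def)
      then have "u (k + i) \<bullet> (second_moment M X *v u j) = 0"
        using orthonormal_frameD[OF u ki(1,2)] ki(3) by simp
      from expected_sample_cross_sq[OF X n indep ident pow4 this, folded D_def]
      show "integrable M (\<lambda>\<omega>. (u (k + i) \<bullet> (D \<omega> *v u j))\<^sup>2)"
        "(\<integral>\<omega>. (u (k + i) \<bullet> (D \<omega> *v u j))\<^sup>2 \<partial>M) = (\<integral>\<omega>. (u (k + i) \<bullet> X \<omega>)\<^sup>2 * (u j \<bullet> X \<omega>)\<^sup>2 \<partial>M) / n"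
        by auto
    qed
    show "integrable M g"
      unfolding g_def using cross(1)
      by (intro Bochner_Integration.integrable_sum Bochner_Integration.integrable_divide) auto
    have "(\<integral>\<omega>. g \<omega> \<partial>M) = (\<Sum>i\<in>{1..d-k}. \<Sum>j\<in>{1..k}.
        (\<integral>\<omega>. (u (k + i) \<bullet> (D \<omega> *v u j))\<^sup>2 \<partial>M) / (lam j - lam (k + i)))"
      unfolding g_def using cross(1)
      by (subst Bochner_Integration.integral_sum, fastforce, intro sum.cong refl,
          subst Bochner_Integration.integral_sum, auto)
    also have "\<dots> = G / n"
      unfolding G_def sum_divide_distrib by (intro sum.cong refl) (simp add: cross(2))
    finally show "(\<integral>\<omega>. g \<omega> \<partial>M) = G / n" .
  qed

  have g0: "0 \<le> g \<omega>" for \<omega>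
    unfolding g_def using gap_pos by (intro sum_nonneg divide_nonneg_pos) auto
  have \<theta>_meas: "\<theta> \<in> borel_measurable M"
  proof -
    have "Xs i \<in> borel_measurable M" if "i \<in> {1..n}" for i
      using indep that by (simp add: indep_vars_def)
    then have [measurable]: "D \<in> borel_measurable M"
      unfolding D_def[abs_def] sample_second_moment_def
      by (intro borel_measurable_diff borel_measurable_scaleR borel_measurable_sum
          measurable_compose[OF _ outer_measurable]) auto
    show ?thesis unfolding \<theta>_def[abs_def] by measurable
  qed
  from joint_markov[OF intg g0 eq_refl[OF Eg] \<theta>_meas int\<theta> E\<theta> \<delta>(1)]
  obtain A where A: "A \<in> sets M" "prob A \<ge> 1 - \<delta>"
    and good: "\<And>\<omega>. \<omega> \<in> A \<Longrightarrow> \<theta> \<omega> < 1 \<and> 2 * \<delta> * g \<omega> \<le> 75 * (G / n) * (1 - \<theta> \<omega>)\<^sup>2"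
    by blast

  have "recon_risk M X (span_class (column_matrix e (u_n \<omega>)))
      - recon_risk M X (span_class (column_matrix e u)) \<le> 75 / (real n * \<delta>) * G" if \<omega>: "\<omega> \<in> A" for \<omega>
  proof -
    have sp: "\<omega> \<in> space M" using A(1) \<omega> sets.sets_into_space by blast
    let ?E = "(\<Sum>j\<in>{1..k}. lam j) - (\<Sum>j\<in>{1..k}. u_n \<omega> j \<bullet> (second_moment M X *v u_n \<omega> j))"
    note iouter = integrable_outer[OF X pow2]
    have "(\<Sum>j\<in>{1..k}. u j \<bullet> (second_moment M X *v u j)) = (\<Sum>j\<in>{1..k}. lam j)"
      using eig kd orthonormal_frameD[OF u] by (intro sum.cong) (auto simp: ordered_eigenbasis_def)
    then have risk: "recon_risk M X (span_class (column_matrix e (u_n \<omega>)))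
        - recon_risk M X (span_class (column_matrix e u)) = ?E / 2"
      using recon_risk_column_matrix[OF ordered_eigenbasis_frame[OF eig_n[OF sp]] e kd(3) iouter pow2]
        recon_risk_column_matrix[OF u e kd(3) iouter pow2]
      by (simp add: field_simps)
    have \<theta>1: "\<theta> \<omega> < 1" using good[OF \<omega>] by simp
    then have pos: "0 < (1 - \<theta> \<omega>)\<^sup>2" by simp
    have "?E * (1 - \<theta> \<omega>)\<^sup>2 \<le> 4 * g \<omega>"
      using excess_le_first_order[OF eig eig_n[OF sp] kd(1,2) gap _ \<theta>1]
      unfolding g_def \<theta>_def D_def \<gamma>_def dims(1) by simp
    then have "\<delta> * (?E * (1 - \<theta> \<omega>)\<^sup>2) \<le> \<delta> * (4 * g \<omega>)" using \<delta> by (intro mult_left_mono) auto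
    also have "\<dots> \<le> 150 * (G / n) * (1 - \<theta> \<omega>)\<^sup>2" using good[OF \<omega>] by simp
    finally have "(\<delta> * ?E) * (1 - \<theta> \<omega>)\<^sup>2 \<le> (150 * (G / n)) * (1 - \<theta> \<omega>)\<^sup>2" by (simp only: mult.assoc)
    then have "\<delta> * ?E \<le> 150 * (G / n)" using pos by (rule mult_right_le_imp_le)
    then show ?thesis unfolding risk using \<delta> n by (simp add: field_simps)
  qed
  with A show ?thesis unfolding G_def by blast
qed

end
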